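(* Let $(n_1,\dots,n_k)$ be a vector of positive integers with $\sum_{i=1}^kn_i=n$, where $k\in\{1,\dots,n\}$, and let $\kappa>0$. For $\omega\ge1$ let $p_B(n_1,\dots,n_k;\omega,\kappa)$ be the eppf associated with the normalized Bessel random measure with parameter $(\omega,\kappa)$ and mean measure $P_0$ ($P_0$ non-atomic), namely $$p_B(n_1,\dots,n_k;\omega,\kappa)=\kappa^k\int_0^{+\infty}\frac{u^{n-1}}{\Gamma(n)}\left(\frac{\omega+\sqrt{\omega^2-1}}{\omega+u+\sqrt{(\omega+u)^2-1}}\right)^{\kappa}\frac{1}{(u+\omega)^n}\prod_{j=1}^k\Gamma(n_j)\;{}_2F_1\!\left(\frac{n_j}{2},\frac{n_j+1}{2};1;\frac{1}{(u+\omega)^2}\right)du .$$ Then $$\lim_{\omega\to+\infty}p_B(n_1,\dots,n_k;\omega,\kappa)=p_D(n_1,\dots,n_k;\kappa),$$ where $p_D(n_1,\dots,n_k;\kappa)=\frac{\Gamma(\kappa)}{\Gamma(\kappa+n)}\,\kappa^k\prod_{j=1}^k\Gamma(n_j)$ is the eppf of the Dirichlet process with measure parameter $\kappa P_0$.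
   Context: Normalized Bessel random measure with parameter $(\omega,\kappa)$, $\omega\ge1$, $\kappa>0$, and mean measure $P_0$ (a probability measure on a Borel set $\Theta\subset\mathbb{R}^m$): let $$\rho(s;\omega)=\frac1s e^{-\omega s}I_0(s),\quad s>0,\qquad I_\nu(s)=\sum_{m=0}^{+\infty}\frac{(s/2)^{2m+\nu}}{m!\,\Gamma(\nu+m+1)}$$ ($I_\nu$ is the modified Bessel function). Let $\{J_j\}_{j\ge1}$ be the points of a Poisson process on $(0,+\infty)$ with intensity $\kappa\rho(s;\omega)\,ds$ and, independently, let $\tau_1,\tau_2,\dots$ be iid from $P_0$; the normalized Bessel random measure is $P=\sum_{j\ge1}\frac{J_j}{T}\delta_{\tau_j}$ with $T=\sum_{j\ge1}J_j$. Eppf (exchangeable partition probability function): if $\theta_1,\dots,\theta_n$ are, conditionally on a discrete random probability measure $Q$, iid from $Q$, the eppf of $Q$ at $(n_1,\dots,n_k)$ is the probability that the random partition of $\{1,\dots,n\}$ induced by ties among the $\theta_i$ equals a given partition with block sizes $n_1,\dots,n_k$. ${}_2F_1(\alpha_1,\alpha_2;\gamma;z)=\sum_{m=0}^{\infty}\frac{(\alpha_1)_m(\alpha_2)_m}{(\gamma)_m}\frac{z^m}{m!}$, with $(\alpha)_m=\Gamma(\alpha+m)/\Gamma(\alpha)$, is the hypergeometric series. *)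

theory Defs
  imports "HOL-Probability.Probability"
begin

definition bessel_I :: "real \<Rightarrow> real \<Rightarrow> real" where
  "bessel_I \<nu> s = (\<Sum>m. (s / 2) powr (2 * real m + \<nu>) / (fact m * Gamma (\<nu> + real m + 1)))"

definition hypergeo_2F1 :: "real \<Rightarrow> real \<Rightarrow> real \<Rightarrow> real \<Rightarrow> real" where
  "hypergeo_2F1 a b c z = (\<Sum>m. pochhammer a m * pochhammer b m / pochhammer c m * z ^ m / fact m)"


text \<open>Poisson point processes on the positive half-line, given by an enumeration of their points.\<close>

definition num_points :: "(nat \<Rightarrow> 'w \<Rightarrow> real) \<Rightarrow> real set \<Rightarrow> 'w \<Rightarrow> ennreal" where
  "num_points J A x = emeasure (count_space UNIV) {j. J j x \<in> A}"

text \<open>The probabilities are those of the Poisson law, spelled out so that the rate 0 is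
  included. Sets of infinite intensity need no clause: all intensities below are sigma-finite.\<close>

definition poisson_points :: "'w measure \<Rightarrow> real measure \<Rightarrow> (nat \<Rightarrow> 'w \<Rightarrow> real) \<Rightarrow> bool" where
  "poisson_points M \<Lambda> J \<longleftrightarrow>
     prob_space M \<and>
     (\<forall>j. J j \<in> borel_measurable M) \<and>
     (\<forall>j. \<forall>x\<in>space M. 0 < J j x) \<and>
     (\<forall>A\<in>sets borel. emeasure \<Lambda> A < \<infinity> \<longrightarrow>
        (\<forall>i. \<P>(x in M. num_points J A x = of_nat i) =
             measure \<Lambda> A ^ i / fact i * exp (- measure \<Lambda> A))) \<and>
     (\<forall>\<A>. finite \<A> \<and> disjoint \<A> \<and> (\<forall>A\<in>\<A>. A \<in> sets borel \<and> emeasure \<Lambda> A < \<infinity>) \<longrightarrow>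
        prob_space.indep_vars M (\<lambda>_. borel) (num_points J) \<A>)"

definition bessel_rho :: "real \<Rightarrow> real \<Rightarrow> real" where
  "bessel_rho \<omega> s = 1 / s * exp (- \<omega> * s) * bessel_I 0 s"

definition bessel_intensity :: "real \<Rightarrow> real \<Rightarrow> real measure" where
  "bessel_intensity \<omega> \<kappa> =
     density lborel (\<lambda>s. ennreal (\<kappa> * bessel_rho \<omega> s) * indicator {0<..} s)"


text \<open>The measure with mass \<open>J j x / T x\<close> at \<open>\<tau> j x\<close>, where \<open>T x\<close> is the total of the \<open>J j x\<close>:
  the weights, seen as a measure on the indices, are pushed forward along \<open>j \<mapsto> \<tau> j x\<close>.
  Only the sigma-algebra of \<open>S\<close> matters. If \<open>T x = \<infinity>\<close>, this is the null measure.\<close>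

definition normalized_rm ::
  "'a measure \<Rightarrow> (nat \<Rightarrow> 'w \<Rightarrow> real) \<Rightarrow> (nat \<Rightarrow> 'w \<Rightarrow> 'a) \<Rightarrow> 'w \<Rightarrow> 'a measure" where
  "normalized_rm S J \<tau> x =
     distr (density (count_space UNIV) (\<lambda>j. ennreal (J j x) / (\<Sum>i. ennreal (J i x)))) S
       (\<lambda>j. \<tau> j x)"

text \<open>The last conjunct says that the \<open>\<tau> j\<close> are iid from \<open>P0\<close> and that the sequences \<open>J\<close> and
  \<open>\<tau>\<close> are independent of each other.\<close>

definition bessel_points ::
  "'w measure \<Rightarrow> real \<Rightarrow> real \<Rightarrow> 'a measure \<Rightarrow> (nat \<Rightarrow> 'w \<Rightarrow> real) \<Rightarrow> (nat \<Rightarrow> 'w \<Rightarrow> 'a) \<Rightarrow> bool" where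
  "bessel_points M \<omega> \<kappa> P0 J \<tau> \<longleftrightarrow>
     poisson_points M (bessel_intensity \<omega> \<kappa>) J \<and>
     (\<forall>j. \<tau> j \<in> measurable M P0) \<and>
     distr M ((\<Pi>\<^sub>M j\<in>UNIV. borel) \<Otimes>\<^sub>M (\<Pi>\<^sub>M j\<in>UNIV. P0)) (\<lambda>x. (\<lambda>j. J j x, \<lambda>j. \<tau> j x)) =
       distr M (\<Pi>\<^sub>M j\<in>UNIV. borel) (\<lambda>x j. J j x) \<Otimes>\<^sub>M (\<Pi>\<^sub>M j\<in>UNIV. P0)"

definition normalized_bessel_rm ::
  "'w measure \<Rightarrow> real \<Rightarrow> real \<Rightarrow> 'a measure \<Rightarrow> ('w \<Rightarrow> 'a measure) \<Rightarrow> bool" where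
  "normalized_bessel_rm M \<omega> \<kappa> P0 P \<longleftrightarrow>
     (\<exists>J \<tau>. bessel_points M \<omega> \<kappa> P0 J \<tau> \<and> P = normalized_rm P0 J \<tau>)"


definition tie_partition :: "nat \<Rightarrow> (nat \<Rightarrow> 'a) \<Rightarrow> nat set set" where
  "tie_partition n \<theta> = {1..n} // {(i, j). i \<in> {1..n} \<and> j \<in> {1..n} \<and> \<theta> i = \<theta> j}"

text \<open>The law of \<open>\<theta> 1, \<dots>, \<theta> n\<close> when these are iid from \<open>Q\<close> conditionally on \<open>Q\<close>.\<close>

definition sample_law :: "'w measure \<Rightarrow> ('w \<Rightarrow> 'a measure) \<Rightarrow> nat \<Rightarrow> (nat \<Rightarrow> 'a) measure" where
  "sample_law M Q n = Giry_Monad.bind M (\<lambda>x. \<Pi>\<^sub>M i\<in>{1..n}. Q x)"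

definition eppf :: "'w measure \<Rightarrow> ('w \<Rightarrow> 'a measure) \<Rightarrow> nat \<Rightarrow> nat set set \<Rightarrow> real" where
  "eppf M Q n \<A> = \<P>(\<theta> in sample_law M Q n. tie_partition n \<theta> = \<A>)"


text \<open>Dirichlet laws and processes after Ferguson: a gamma law of shape 0 is the point mass at 0, so
  that the parameters of a Dirichlet law may vanish (but not all of them).\<close>

definition gamma_law :: "real \<Rightarrow> real measure" where
  "gamma_law a =
     (if a = 0 then return borel 0
      else density lborel
        (\<lambda>x. ennreal (x powr (a - 1) * exp (- x) / Gamma a) * indicator {0<..} x))"

definition dirichlet_law :: "nat \<Rightarrow> (nat \<Rightarrow> real) \<Rightarrow> (nat \<Rightarrow> real) measure" where
  "dirichlet_law r a =
     distr (\<Pi>\<^sub>M i\<in>{..<r}. gamma_law (a i)) (\<Pi>\<^sub>M i\<in>{..<r}. borel)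
       (\<lambda>g. \<lambda>i\<in>{..<r}. g i / (\<Sum>l<r. g l))"

definition dirichlet_process :: "'w measure \<Rightarrow> 'a measure \<Rightarrow> ('w \<Rightarrow> 'a measure) \<Rightarrow> bool" where
  "dirichlet_process M \<alpha> Q \<longleftrightarrow>
     prob_space M \<and>
     Q \<in> measurable M (prob_algebra \<alpha>) \<and>
     (\<forall>r A. disjoint_family_on A {..<r} \<and> (\<forall>i<r. A i \<in> sets \<alpha>) \<and> (\<Union>i<r. A i) = space \<alpha> \<longrightarrow>
        distr M (\<Pi>\<^sub>M i\<in>{..<r}. borel) (\<lambda>x. \<lambda>i\<in>{..<r}. measure (Q x) (A i)) =
          dirichlet_law r (\<lambda>i. measure \<alpha> (A i)))"


text \<open>The vector of block sizes is the list \<open>ns\<close>; thus \<open>n = sum_list ns\<close> and \<open>k = length ns\<close>.\<close>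

definition p_B :: "nat list \<Rightarrow> real \<Rightarrow> real \<Rightarrow> real" where
  "p_B ns \<omega> \<kappa> =
     (let n = sum_list ns; k = length ns in
      \<kappa> ^ k *
      (LINT u:{0<..}|lborel.
         u ^ (n - 1) / Gamma (real n) *
         ((\<omega> + sqrt (\<omega>\<^sup>2 - 1)) / (\<omega> + u + sqrt ((\<omega> + u)\<^sup>2 - 1))) powr \<kappa> *
         (1 / (u + \<omega>) ^ n) *
         (\<Prod>j<k. Gamma (real (ns ! j)) *
            hypergeo_2F1 (real (ns ! j) / 2) ((real (ns ! j) + 1) / 2) 1 (1 / (u + \<omega>)\<^sup>2))))"

definition p_D :: "nat list \<Rightarrow> real \<Rightarrow> real" where
  "p_D ns \<kappa> =
     (let n = sum_list ns; k = length ns in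
      Gamma \<kappa> / Gamma (\<kappa> + real n) * \<kappa> ^ k * (\<Prod>j<k. Gamma (real (ns ! j))))"

end

theory Submission
  imports Defs "HOL-Real_Asymp.Real_Asymp"
begin

text \<open>
  One method computes both eppfs. Cut the space into finitely many cells, ever finer, so that any two
  distinct points end up in different cells. Then a sample has tie pattern \<open>\<A>\<close> iff, for all fine enough
  partitions, the cells that it visits have tie pattern \<open>\<A>\<close>. Hence the eppf of a random measure \<open>Q\<close> is the
  limit of \<open>E \<Sum>\<^sub>c \<Prod>\<^sub>B Q(cell (c B)) ^ card B\<close>, where \<open>c\<close> runs through the injective labellings of the
  blocks \<open>B \<in> \<A>\<close> by cells (\<open>eppf_eq_integral_tie_prob\<close>, \<open>cell_tie_prob_tendsto\<close>). Suppose that, in this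
  expectation, a block \<open>B\<close> in a cell of \<open>P\<close>-mass \<open>p\<close> contributes a factor \<open>\<beta>\<^sub>B p + O(p\<^sup>2)\<close>. As the masses
  sum to 1 and, \<open>P\<close> having no atoms, their squares sum to something that tends to 0, the sum over
  \<open>c\<close> tends to \<open>\<Prod>\<^sub>B \<beta>\<^sub>B\<close> (\<open>injective_sum_limit\<close>): only first-order coefficients survive.

  The random normalization is removed by \<open>1 / T ^ n = 1 / \<Gamma>(n) \<integral> u ^ (n - 1) exp (- u T) du\<close>, after which
  the masses of the cells are independent. For the Dirichlet process they are gamma variables, the
  factors are \<open>(\<kappa> p)\<^sub>k\<close> with \<open>k = card B\<close>, so that \<open>\<beta>\<^sub>B = \<kappa> \<Gamma>(k)\<close>, and a beta integral over \<open>u\<close> remains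
  (\<open>dirichlet_law_moment\<close>, \<open>eppf_dirichlet_process\<close>).

  For the Bessel measure, the Laplace functional of the marked Poisson process
  (\<open>marked_poisson_laplace_functional\<close>) shows that the cell masses \<open>T\<^sub>c\<close> have the joint Laplace transform
  \<open>\<Prod>\<^sub>c exp (- p\<^sub>c \<psi>(u\<^sub>c))\<close>, where \<open>\<psi>(u)\<close> is the integral of \<open>1 - exp (- u s)\<close> against the intensity. Their
  mixed moments are derivatives of it (\<open>laplace_moments_product\<close>), and the \<open>k\<close>-th derivative of
  \<open>exp (- p \<psi>)\<close> is, up to sign, \<open>exp (- p \<psi>) (p \<beta>\<^sub>k + O(p\<^sup>2))\<close> with \<open>\<beta>\<^sub>k(u)\<close> the integral of
  \<open>s ^ k exp (- u s)\<close> against the intensity (\<open>exponential_family_expansion\<close>). So the eppf is the integral of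
  \<open>u ^ (n - 1) / \<Gamma>(n) exp (- \<psi>(u)) \<Prod>\<^sub>B \<beta>\<^sub>k(u)\<close> with \<open>k = card B\<close> (\<open>eppf_normalized_bessel\<close>).
  Termwise integration of the series of \<open>I\<^sub>0\<close> turns \<open>\<beta>\<^sub>k\<close> into a hypergeometric series; the case \<open>k = 1\<close> is
  the binomial series \<open>\<beta>\<^sub>1(u) = \<kappa> / sqrt ((\<omega> + u)\<^sup>2 - 1)\<close>, and integrating it gives
  \<open>\<psi>\<close> as \<open>\<kappa>\<close> times a logarithm, so that \<open>exp (- \<psi>)\<close> is the power with exponent \<open>\<kappa>\<close> in the eppf.

  For the limit, substitute \<open>u = \<omega> v\<close>. As \<open>\<omega> \<rightarrow> \<infinity>\<close> the hypergeometric factors tend to 1 and the integrand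
  tends to a multiple of \<open>v ^ (n - 1) (1 + v) powr (- \<kappa> - n)\<close>; another multiple of this function
  dominates it. The limit is the beta integral of the Dirichlet case (\<open>p_B_tendsto_p_D\<close>).
\<close>

section \<open>Gamma and beta integrals\<close>

lemma nn_integral_powr_exp:
  fixes a c :: real
  assumes "a > 0" "c > 0"
  shows "(\<integral>\<^sup>+s. ennreal (s powr (a - 1) * exp (- (c * s))) * indicator {0<..} s \<partial>lborel)
           = ennreal (Gamma a / c powr a)"
proof -
  let ?g = "\<lambda>s::real. ennreal (s powr (a - 1) * exp (- s)) * indicator {0<..} s"
  have "(\<integral>\<^sup>+s. ?g s \<partial>lborel) =
      (\<integral>\<^sup>+s. ennreal (indicator {0..} s * s powr (a - 1) / exp s) \<partial>lborel)"
    by (intro nn_integral_cong) (auto simp: indicator_def exp_minus field_simps)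
  also have "\<dots> = ennreal (Gamma a)"
    by (rule Gamma_conv_nn_integral_real[OF assms(1), symmetric])
  finally have *: "(\<integral>\<^sup>+s. ?g s \<partial>lborel) = ennreal (Gamma a)" .
  have "(\<integral>\<^sup>+s. ennreal (s powr (a - 1) * exp (- (c * s))) * indicator {0<..} s \<partial>lborel) =
      (\<integral>\<^sup>+s. ennreal (c powr (1 - a)) * ?g (0 + c * s) \<partial>lborel)"
  proof (intro nn_integral_cong)
    fix s :: real
    have "c powr (1 - a) * ((c * s) powr (a - 1)) = s powr (a - 1)" if "s > 0"
      using that assms by (simp add: powr_mult flip: powr_add mult.assoc)
    then show "ennreal (s powr (a - 1) * exp (- (c * s))) * indicator {0<..} s =
        ennreal (c powr (1 - a)) * ?g (0 + c * s)"
      using assms(2)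
      by (auto simp: indicator_def zero_less_mult_iff mult.assoc[symmetric] simp flip: ennreal_mult')
  qed
  also have "\<dots> = ennreal (c powr (1 - a)) * (\<integral>\<^sup>+s. ?g (0 + c * s) \<partial>lborel)"
    by (rule nn_integral_cmult) measurable
  also have "c powr (1 - a) = c powr (-a) * c"
    using assms(2) by (simp add: powr_mult_base' powr_diff powr_minus field_simps)
  also have "ennreal (c powr (-a) * c) * (\<integral>\<^sup>+s. ?g (0 + c * s) \<partial>lborel)
      = ennreal (c powr (-a)) * (ennreal \<bar>c\<bar> * (\<integral>\<^sup>+s. ?g (0 + c * s) \<partial>lborel))"
    using assms(2) by (simp add: ennreal_mult' mult.assoc)
  also have "ennreal \<bar>c\<bar> * (\<integral>\<^sup>+s. ?g (0 + c * s) \<partial>lborel) = (\<integral>\<^sup>+s. ?g s \<partial>lborel)"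
    using assms(2) by (intro nn_integral_real_affine[symmetric]) auto
  also note *
  also have "ennreal (c powr (-a)) * ennreal (Gamma a) = ennreal (Gamma a / c powr a)"
    using assms by (subst ennreal_mult'[symmetric]) (auto simp: powr_minus field_simps)
  finally show ?thesis .
qed

lemma nn_integral_power_exp:
  fixes c :: real
  assumes "n \<ge> 1" "c > 0"
  shows "(\<integral>\<^sup>+s. ennreal (s ^ (n - 1) * exp (- (c * s))) * indicator {0<..} s \<partial>lborel)
           = ennreal (Gamma (real n) / c ^ n)"
proof -
  have "(\<integral>\<^sup>+s. ennreal (s ^ (n - 1) * exp (- (c * s))) * indicator {0<..} s \<partial>lborel)
      = (\<integral>\<^sup>+s. ennreal (s powr (real n - 1) * exp (- (c * s))) * indicator {0<..} s \<partial>lborel)"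
  proof (intro nn_integral_cong)
    fix s :: real
    have "s ^ (n - 1) = s powr (real n - 1)" if "s > 0"
      using that assms(1) by (simp add: of_nat_diff flip: powr_realpow)
    then show "ennreal (s ^ (n - 1) * exp (- (c * s))) * indicator {0<..} s =
        ennreal (s powr (real n - 1) * exp (- (c * s))) * indicator {0<..} s"
      by (auto simp: indicator_def)
  qed
  also have "\<dots> = ennreal (Gamma (real n) / c powr real n)"
    using assms by (intro nn_integral_powr_exp) auto
  finally show ?thesis
    using assms by (simp add: powr_realpow)
qed

text \<open>
  Write \<open>(1 + u) powr (- (\<kappa> + n))\<close> as a gamma integral over \<open>s\<close> and swap the integrals: the inner one over
  \<open>u\<close> is then again a gamma integral, and so is what remains.
\<close>

lemma nn_integral_beta_prime:
  fixes \<kappa> :: real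
  assumes "n \<ge> 1" "\<kappa> > 0"
  shows "(\<integral>\<^sup>+u. ennreal (u ^ (n - 1) / Gamma (real n) * (1 + u) powr (- (\<kappa> + real n)))
              * indicator {0<..} u \<partial>lborel)
           = ennreal (Gamma \<kappa> / Gamma (\<kappa> + real n))"
proof -
  let ?b = "\<kappa> + real n"
  let ?e = "\<lambda>u s. ennreal (u ^ (n - 1) / Gamma (real n) / Gamma ?b) *
        ennreal (s powr (?b - 1) * exp (- ((1 + u) * s))) * indicator {0<..} s * indicator {0<..} u"
  have b: "?b > 0" "Gamma ?b > 0" "Gamma (real n) > 0"
    using assms by (auto intro!: Gamma_real_pos add_pos_nonneg)
  then have b0: "Gamma ?b \<noteq> 0" "Gamma (real n) \<noteq> 0" by linarith+
  have "(\<integral>\<^sup>+u. ennreal (u ^ (n - 1) / Gamma (real n) * (1 + u) powr (- ?b))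
              * indicator {0<..} u \<partial>lborel) = (\<integral>\<^sup>+u. \<integral>\<^sup>+s. ?e u s \<partial>lborel \<partial>lborel)"
  proof (intro nn_integral_cong)
    fix u :: real
    show "ennreal (u ^ (n - 1) / Gamma (real n) * (1 + u) powr (- ?b)) * indicator {0<..} u
        = (\<integral>\<^sup>+s. ?e u s \<partial>lborel)"
    proof (cases "u > 0")
      case True
      then have "(\<integral>\<^sup>+s. ?e u s \<partial>lborel) = ennreal (u ^ (n - 1) / Gamma (real n) / Gamma ?b) *
          (\<integral>\<^sup>+s. ennreal (s powr (?b - 1) * exp (- ((1 + u) * s))) * indicator {0<..} s \<partial>lborel)"
        by (simp add: nn_integral_cmult mult.assoc)
      also have "\<dots> = ennreal (u ^ (n - 1) / Gamma (real n) / Gamma ?b) *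
          ennreal (Gamma ?b / (1 + u) powr ?b)"
        using True b by (subst nn_integral_powr_exp) auto
      also have "\<dots> = ennreal (u ^ (n - 1) / Gamma (real n) * (1 + u) powr (- ?b))"
        unfolding powr_minus_divide using b True
        by (subst ennreal_mult'[symmetric]) (auto simp: b0)
      finally show ?thesis using True by simp
    next
      case False
      then have "indicator {0<..} u = (0::ennreal)" by simp
      then show ?thesis by (simp only: mult_zero_right mult_zero_left nn_integral_const)
    qed
  qed
  also have "\<dots> = (\<integral>\<^sup>+s. \<integral>\<^sup>+u. ?e u s \<partial>lborel \<partial>lborel)"
    by (rule lborel_pair.Fubini') measurable
  also have "\<dots> = (\<integral>\<^sup>+s. ennreal (1 / Gamma ?b) *
      (ennreal (s powr (\<kappa> - 1) * exp (- (1 * s))) * indicator {0<..} s) \<partial>lborel)"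
  proof (intro nn_integral_cong)
    fix s :: real
    show "(\<integral>\<^sup>+u. ?e u s \<partial>lborel) = ennreal (1 / Gamma ?b) *
      (ennreal (s powr (\<kappa> - 1) * exp (- (1 * s))) * indicator {0<..} s)"
    proof (cases "s > 0")
      case True
      have "(\<integral>\<^sup>+u. ?e u s \<partial>lborel) =
          (\<integral>\<^sup>+u. ennreal (s powr (?b - 1) * exp (-s) / Gamma (real n) / Gamma ?b) *
            (ennreal (u ^ (n - 1) * exp (- (s * u))) * indicator {0<..} u) \<partial>lborel)"
      proof (intro nn_integral_cong)
        fix u :: real
        have "exp (- ((1 + u) * s)) = exp (-s) * exp (- (s * u))"
          by (simp add: algebra_simps flip: exp_add)
        then show "?e u s = ennreal (s powr (?b - 1) * exp (-s) / Gamma (real n) / Gamma ?b) *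
            (ennreal (u ^ (n - 1) * exp (- (s * u))) * indicator {0<..} u)"
          using True b by (auto simp: indicator_def field_simps b0 simp flip: ennreal_mult')
      qed
      also have "\<dots> = ennreal (s powr (?b - 1) * exp (-s) / Gamma (real n) / Gamma ?b) *
          ennreal (Gamma (real n) / s ^ n)"
        using True assms by (subst nn_integral_cmult, simp, subst nn_integral_power_exp) auto
      also have "\<dots> = ennreal (1 / Gamma ?b * (s powr (\<kappa> - 1) * exp (- s)))"
      proof -
        have "s powr (?b - 1) = s powr (\<kappa> - 1) * s ^ n"
          using True by (simp add: algebra_simps flip: powr_realpow powr_add)
        then show ?thesis
          using b True by (subst ennreal_mult'[symmetric]) (auto simp: field_simps b0)
      qed
      also have "\<dots> = ennreal (1 / Gamma ?b) * ennreal (s powr (\<kappa> - 1) * exp (- s))"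
        using b by (intro ennreal_mult) auto
      finally show ?thesis using True by simp
    next
      case False
      then have "indicator {0<..} s = (0::ennreal)" by simp
      then show ?thesis by (simp only: mult_zero_right mult_zero_left nn_integral_const)
    qed
  qed
  also have "\<dots> = ennreal (1 / Gamma ?b) * ennreal (Gamma \<kappa> / 1 powr \<kappa>)"
    using assms by (subst nn_integral_cmult, simp, subst nn_integral_powr_exp) auto
  also have "\<dots> = ennreal (Gamma \<kappa> / Gamma ?b)"
    using b by (subst ennreal_mult'[symmetric]) (auto simp: field_simps b0)
  finally show ?thesis .
qed

section \<open>The Laplace transform of the modified Bessel function\<close>

lemma bessel_I0_sums:
  assumes "s > 0"
  shows "(\<lambda>m. (s / 2) ^ (2 * m) / (fact m)\<^sup>2) sums bessel_I 0 s"
proof -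
  have "summable (\<lambda>m. (s / 2) ^ (2 * m) / (fact m)\<^sup>2)"
  proof (rule summable_comparison_test')
    show "summable (\<lambda>m. inverse (fact m) * ((s / 2)\<^sup>2) ^ m)"
      by (rule summable_exp)
    show "norm ((s / 2) ^ (2 * m) / (fact m)\<^sup>2) \<le> inverse (fact m) * ((s / 2)\<^sup>2) ^ m" for m
    proof -
      have "(fact m :: real) \<le> (fact m)\<^sup>2"
        by (intro self_le_power) auto
      then have "(s / 2) ^ (2 * m) / (fact m)\<^sup>2 \<le> (s / 2) ^ (2 * m) / fact m"
        using assms by (intro divide_left_mono) auto
      moreover have "(s / 2) ^ (2 * m) / fact m = inverse (fact m) * ((s / 2)\<^sup>2) ^ m"
        unfolding power_mult[of "s / 2" 2 m] by (rule divide_inverse_commute)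
      moreover have "0 \<le> (s / 2) ^ (2 * m) / (fact m)\<^sup>2"
        by (intro divide_nonneg_nonneg) (use assms in auto)
      ultimately show ?thesis
        by (metis abs_of_nonneg real_norm_def)
    qed
  qed
  then have sums: "(\<lambda>m. (s / 2) ^ (2 * m) / (fact m)\<^sup>2) sums (\<Sum>m. (s / 2) ^ (2 * m) / (fact m)\<^sup>2)"
    by (rule summable_sums)
  have "(s / 2) ^ (2 * m) / (fact m)\<^sup>2
      = (s / 2) powr (2 * real m + 0) / (fact m * Gamma (0 + real m + 1))" for m
  proof -
    have "Gamma (0 + real m + 1) = fact m"
      using Gamma_fact[of m, where 'a = real] by (simp add: add.commute)
    moreover have "(s / 2) powr (2 * real m + 0) = (s / 2) ^ (2 * m)"
      using assms powr_realpow[of "s / 2" "2 * m"] by simp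
    ultimately show ?thesis
      by (simp add: power2_eq_square)
  qed
  then have "bessel_I 0 s = (\<Sum>m. (s / 2) ^ (2 * m) / (fact m)\<^sup>2)"
    by (simp only: bessel_I_def)
  then show ?thesis
    by (simp only: sums)
qed

lemma bessel_I0_nonneg: "s > 0 \<Longrightarrow> 0 \<le> bessel_I 0 s"
  by (rule sums_le[OF _ sums_zero bessel_I0_sums]) auto

lemma measurable_bessel_I [measurable]: "bessel_I \<nu> \<in> borel_measurable borel"
  unfolding bessel_I_def[abs_def] by measurable

abbreviation hyp_term :: "real \<Rightarrow> real \<Rightarrow> real \<Rightarrow> nat \<Rightarrow> real" where
  "hyp_term a b z m \<equiv> pochhammer a m * pochhammer b m / pochhammer 1 m * z ^ m / fact m"

text \<open>
  The quotient of consecutive terms tends to \<open>z < 1\<close>.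
\<close>

lemma summable_hypergeo:
  fixes a b z :: real
  assumes "a > 0" "b > 0" "0 \<le> z" "z < 1"
  shows "summable (hyp_term a b z)"
proof -
  define r where "r m = (a + real m) * (b + real m) / ((1 + real m) * (1 + real m)) * z" for m
  have "(\<lambda>m. (a + real m) * (b + real m) / ((1 + real m) * (1 + real m))) \<longlonglongrightarrow> 1"
    by real_asymp
  then have "r \<longlonglongrightarrow> 1 * z"
    unfolding r_def by (intro tendsto_mult tendsto_const)
  moreover have "z < (1 + z) / 2" using assms by simp
  ultimately have "\<forall>\<^sub>F m in sequentially. r m < (1 + z) / 2"
    using order_tendstoD(2)[of r z sequentially "(1 + z) / 2"] by simp
  then obtain N where N: "\<And>m. m \<ge> N \<Longrightarrow> r m < (1 + z) / 2"
    by (auto simp: eventually_sequentially)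
  show ?thesis
  proof (rule summable_ratio_test[where c = "(1 + z) / 2" and N = N])
    fix m assume m: "N \<le> m"
    have nn: "hyp_term a b z m \<ge> 0"
      using assms by (auto intro!: divide_nonneg_nonneg mult_nonneg_nonneg simp: pochhammer_nonneg)
    have eq: "hyp_term a b z (Suc m) = r m * hyp_term a b z m"
      by (simp add: r_def pochhammer_Suc field_simps del: of_nat_Suc)
         (simp add: algebra_simps)
    have "0 \<le> r m" using assms by (simp add: r_def)
    then have "norm (r m * hyp_term a b z m) = r m * hyp_term a b z m"
      using nn by (simp only: real_norm_def abs_mult abs_of_nonneg)
    also have "\<dots> \<le> (1 + z) / 2 * hyp_term a b z m"
      using N[OF m] nn by (intro mult_right_mono) auto
    finally have "norm (r m * hyp_term a b z m) \<le> (1 + z) / 2 * hyp_term a b z m" .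
    moreover have "norm (hyp_term a b z m) = hyp_term a b z m"
      using nn by (simp only: real_norm_def abs_of_nonneg)
    ultimately show "norm (hyp_term a b z (Suc m)) \<le> (1 + z) / 2 * norm (hyp_term a b z m)"
      by (simp only: eq)
  qed (use assms in auto)
qed

lemma hyp_term_nonneg: "a > 0 \<Longrightarrow> b > 0 \<Longrightarrow> 0 \<le> z \<Longrightarrow> 0 \<le> hyp_term a b z m"
  by (auto intro!: divide_nonneg_nonneg mult_nonneg_nonneg simp: pochhammer_nonneg)

lemma hypergeo_2F1_mono:
  assumes "a > 0" "b > 0" "0 \<le> z" "z \<le> z'" "z' < 1"
  shows "hypergeo_2F1 a b 1 z \<le> hypergeo_2F1 a b 1 z'"
  unfolding hypergeo_2F1_def
  using assms
  by (intro suminf_le summable_hypergeo mult_left_mono divide_right_mono power_mono)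
     (auto intro!: divide_nonneg_nonneg mult_nonneg_nonneg simp: pochhammer_nonneg)

lemma hypergeo_2F1_nonneg:
  assumes "a > 0" "b > 0" "0 \<le> z" "z < 1"
  shows "0 \<le> hypergeo_2F1 a b 1 z"
  unfolding hypergeo_2F1_def
  using assms by (intro suminf_nonneg summable_hypergeo hyp_term_nonneg)

lemma hypergeo_2F1_at_0: "hypergeo_2F1 a b 1 0 = 1"
  unfolding hypergeo_2F1_def by (subst suminf_finite[of "{0}"]) auto

lemma isCont_hypergeo_2F1_0:
  assumes "a > 0" "b > 0"
  shows "isCont (hypergeo_2F1 a b 1) 0"
proof -
  let ?c = "\<lambda>m. pochhammer a m * pochhammer b m / pochhammer 1 m / fact m"
  have "hypergeo_2F1 a b 1 = (\<lambda>z. \<Sum>m. ?c m * z ^ m)"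
    by (simp add: hypergeo_2F1_def fun_eq_iff)
  moreover have "isCont (\<lambda>z. \<Sum>m. ?c m * z ^ m) 0"
    using summable_hypergeo[OF assms, of "1/2"]
    by (intro isCont_powser[where K = "1/2"]) auto
  ultimately show ?thesis by simp
qed

lemma measurable_hypergeo_2F1 [measurable]: "hypergeo_2F1 a b c \<in> borel_measurable borel"
  unfolding hypergeo_2F1_def[abs_def] by measurable

text \<open>
  Integrating the series of \<open>I\<^sub>0\<close> term by term gives \<open>\<Gamma>(n + 2 m) = \<Gamma>(n) (n)\<^sub>2\<^sub>m\<close>, and the duplication
  formula \<open>(n)\<^sub>2\<^sub>m = 4 ^ m (n / 2)\<^sub>m ((n + 1) / 2)\<^sub>m\<close> produces the two parameters of the hypergeometric series.
\<close>

lemma nn_integral_power_exp_bessel_I0: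
  fixes a :: real
  assumes "n \<ge> 1" "a > 1"
  shows "(\<integral>\<^sup>+s. ennreal (s ^ (n - 1) * exp (- (a * s)) * bessel_I 0 s) * indicator {0<..} s \<partial>lborel)
     = ennreal (Gamma (real n) / a ^ n * hypergeo_2F1 (real n / 2) ((real n + 1) / 2) 1 (1 / a\<^sup>2))"
proof -
  let ?t = "\<lambda>m s. ennreal (1 / (4 ^ m * (fact m)\<^sup>2)) *
      (ennreal (s ^ (n + 2 * m - 1) * exp (- (a * s))) * indicator {0<..} s)"
  let ?h = "hyp_term (real n / 2) ((real n + 1) / 2) (1 / a\<^sup>2)"
  have "(\<integral>\<^sup>+s. ennreal (s ^ (n - 1) * exp (- (a * s)) * bessel_I 0 s) * indicator {0<..} s \<partial>lborel)
      = (\<integral>\<^sup>+s. (\<Sum>m. ?t m s) \<partial>lborel)"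
  proof (intro nn_integral_cong)
    fix s :: real
    show "ennreal (s ^ (n - 1) * exp (- (a * s)) * bessel_I 0 s) * indicator {0<..} s = (\<Sum>m. ?t m s)"
    proof (cases "s > 0")
      case True
      have "(\<Sum>m. ennreal (s ^ (n - 1) * exp (- (a * s)) * ((s / 2) ^ (2 * m) / (fact m)\<^sup>2)))
          = ennreal (s ^ (n - 1) * exp (- (a * s)) * bessel_I 0 s)"
        using True by (intro suminf_ennreal_eq sums_mult bessel_I0_sums) auto
      moreover have "ennreal (s ^ (n - 1) * exp (- (a * s)) * ((s / 2) ^ (2 * m) / (fact m)\<^sup>2)) = ?t m s" for m
      proof -
        have "s ^ (n + 2 * m - 1) = s ^ (n - 1) * s ^ (2 * m)"
          using assms by (simp flip: power_add)
        moreover have "(s / 2) ^ (2 * m) = s ^ (2 * m) / 4 ^ m"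
          by (simp add: power_divide power_mult)
        ultimately show ?thesis
          using True by (auto simp: field_simps simp flip: ennreal_mult')
      qed
      ultimately show ?thesis using True by simp
    qed simp
  qed
  also have "\<dots> = (\<Sum>m. \<integral>\<^sup>+s. ?t m s \<partial>lborel)"
    by (rule nn_integral_suminf) measurable
  also have "\<dots> = (\<Sum>m. ennreal (Gamma (real n) / a ^ n * ?h m))"
  proof (intro suminf_cong)
    fix m
    have "(\<integral>\<^sup>+s. ?t m s \<partial>lborel) = ennreal (1 / (4 ^ m * (fact m)\<^sup>2)) *
        ennreal (Gamma (real (n + 2 * m)) / a ^ (n + 2 * m))"
      using assms by (subst nn_integral_cmult, simp, subst nn_integral_power_exp) auto
    also have "\<dots> = ennreal (1 / (4 ^ m * (fact m)\<^sup>2) * (Gamma (real (n + 2 * m)) / a ^ (n + 2 * m)))"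
      by (rule ennreal_mult'[symmetric]) simp
    also have "Gamma (real (n + 2 * m)) = Gamma (real n) * pochhammer (real n) (2 * m)"
    proof -
      have "real n \<notin> \<int>\<^sub>\<le>\<^sub>0" using assms by (auto elim!: nonpos_Ints_cases)
      moreover have "Gamma (real n) > 0" using assms by (intro Gamma_real_pos) auto
      then have "Gamma (real n) \<noteq> 0" by linarith
      ultimately show ?thesis using pochhammer_Gamma[of "real n" "2 * m"] by simp
    qed
    also have "pochhammer (real n) (2 * m) =
        4 ^ m * pochhammer (real n / 2) m * pochhammer ((real n + 1) / 2) m"
      using pochhammer_double[of "real n / 2" m] by (simp add: power_mult add_divide_distrib)
    also have "1 / (4 ^ m * (fact m)\<^sup>2) * (Gamma (real n) *
          (4 ^ m * pochhammer (real n / 2) m * pochhammer ((real n + 1) / 2) m) / a ^ (n + 2 * m))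
        = Gamma (real n) / a ^ n * ?h m"
      by (simp add: power_add power_mult power_one_over power2_eq_square pochhammer_fact[symmetric])
    finally show "(\<integral>\<^sup>+s. ?t m s \<partial>lborel) = ennreal (Gamma (real n) / a ^ n * ?h m)" .
  qed
  also have "\<dots> = ennreal (Gamma (real n) / a ^ n * (\<Sum>m. ?h m))"
  proof (rule suminf_ennreal_eq)
    have z: "1 / a\<^sup>2 < 1" using assms by (simp add: one_less_power)
    show "(\<lambda>m. Gamma (real n) / a ^ n * ?h m) sums (Gamma (real n) / a ^ n * (\<Sum>m. ?h m))"
      using assms z by (intro sums_mult summable_sums summable_hypergeo) auto
    show "0 \<le> Gamma (real n) / a ^ n * ?h m" for m
      using assms by (intro mult_nonneg_nonneg hyp_term_nonneg) (auto intro!: divide_nonneg_pos Gamma_real_nonneg)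
  qed
  finally show ?thesis
    by (simp only: hypergeo_2F1_def)
qed

lemma hypergeo_2F1_half_one:
  assumes "0 \<le> z" "z < 1"
  shows "hypergeo_2F1 (1 / 2) 1 1 z = 1 / sqrt (1 - z)"
proof -
  have "(\<lambda>m. ((- 1 / 2 :: real) gchoose m) * (- z) ^ m) sums (1 + - z) powr (- 1 / 2)"
    using assms by (intro gen_binomial_real) auto
  moreover have "((- 1 / 2 :: real) gchoose m) * (- z) ^ m = hyp_term (1 / 2) 1 z m" for m
  proof -
    have "(-1 :: real) ^ m * (-1) ^ m = 1"
      by (simp flip: power_mult_distrib)
    moreover have "((- 1 / 2 :: real) gchoose m) * (- z) ^ m
        = ((-1) ^ m * (-1) ^ m) * (pochhammer (1 / 2) m * z ^ m / fact m)"
      by (simp add: gbinomial_pochhammer power_minus[of z])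
    ultimately show ?thesis
      by (simp add: pochhammer_fact[symmetric])
  qed
  ultimately have "hypergeo_2F1 (1 / 2) 1 1 z = (1 - z) powr (- 1 / 2)"
    by (simp add: hypergeo_2F1_def sums_iff)
  then show ?thesis
    using assms by (simp add: powr_minus powr_half_sqrt inverse_eq_divide)
qed

section \<open>Derivatives of Laplace transforms\<close>

lemma times_exp_neg_le:
  fixes x c :: real
  assumes "0 \<le> x" "0 < c"
  shows "x * exp (- (c * x)) \<le> 2 / c * exp (- (c / 2 * x))"
proof -
  have "c / 2 * x \<le> exp (c / 2 * x)"
    using exp_ge_add_one_self[of "c / 2 * x"] by linarith
  then have "x \<le> 2 / c * exp (c / 2 * x)"
    using assms by (simp add: field_simps)
  then have "x * exp (- (c * x)) \<le> 2 / c * exp (c / 2 * x) * exp (- (c * x))"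
    by (intro mult_right_mono) auto
  also have "\<dots> = 2 / c * exp (- (c / 2 * x))"
    by (simp add: field_simps flip: exp_add)
  finally show ?thesis .
qed

text \<open>
  Differentiation under the integral sign. Integrability at every \<open>u > 0\<close> suffices, because part of the
  exponential decay absorbs an extra factor \<open>X\<close>.
\<close>

lemma laplace_transform_derivative:
  fixes W X :: "'a \<Rightarrow> real"
  assumes [measurable]: "W \<in> borel_measurable M" "X \<in> borel_measurable M"
    and X: "AE x in M. 0 \<le> X x"
    and int: "\<And>u. u > 0 \<Longrightarrow> integrable M (\<lambda>x. W x * exp (- (u * X x)))"
    and u: "u > 0"
  shows "integrable M (\<lambda>x. W x * X x * exp (- (u * X x)))"
    and "((\<lambda>u. \<integral>x. W x * exp (- (u * X x)) \<partial>M) has_real_derivative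
           - (\<integral>x. W x * X x * exp (- (u * X x)) \<partial>M)) (at u)"
proof -
  let ?f = "\<lambda>u. \<integral>x. W x * exp (- (u * X x)) \<partial>M"
  have bound: "\<bar>W x * X x * exp (- (c * X x))\<bar> \<le> \<bar>2 / c * (W x * exp (- (c / 2 * X x)))\<bar>"
    if "0 \<le> X x" "c > 0" for x c
  proof -
    have "\<bar>W x\<bar> * (X x * exp (- (c * X x))) \<le> \<bar>W x\<bar> * (2 / c * exp (- (c / 2 * X x)))"
      using times_exp_neg_le[OF that] by (rule mult_left_mono) simp
    then show ?thesis using that by (simp add: abs_mult mult_ac)
  qed
  show "integrable M (\<lambda>x. W x * X x * exp (- (u * X x)))"
  proof (rule Bochner_Integration.integrable_bound)
    show "integrable M (\<lambda>x. 2 / u * (W x * exp (- (u / 2 * X x))))"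
      using u by (intro integrable_mult_right int) auto
    show "AE x in M. norm (W x * X x * exp (- (u * X x)))
        \<le> norm (2 / u * (W x * exp (- (u / 2 * X x))))"
      using X by eventually_elim (use bound[OF _ u] in auto)
  qed simp
  show "(?f has_real_derivative - (\<integral>x. W x * X x * exp (- (u * X x)) \<partial>M)) (at u)"
    unfolding has_field_derivative_iff
  proof -
    let ?S = "{u / 2<..}"
    have "((\<lambda>v. (?f v - ?f u) / (v - u)) \<longlongrightarrow> - (\<integral>x. W x * X x * exp (- (u * X x)) \<partial>M))
        (at u within ?S)"
      unfolding tendsto_at_iff_sequentially comp_def
    proof (intro allI impI)
      fix h :: "nat \<Rightarrow> real"
      assume h: "\<forall>i. h i \<in> ?S - {u}" and lim: "h \<longlonglongrightarrow> u"
      let ?q = "\<lambda>i x. W x * ((exp (- (h i * X x)) - exp (- (u * X x))) / (h i - u))"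
      have "(\<lambda>i. \<integral>x. ?q i x \<partial>M) \<longlonglongrightarrow> (\<integral>x. - (W x * X x * exp (- (u * X x))) \<partial>M)"
      proof (rule integral_dominated_convergence)
        show "integrable M (\<lambda>x. \<bar>2 / (u / 2) * (W x * exp (- (u / 2 / 2 * X x)))\<bar>)"
          using u by (intro integrable_abs integrable_mult_right int) auto
        have "(\<lambda>i. ?q i x) \<longlonglongrightarrow> W x * (- X x * exp (- (u * X x)))" for x
        proof (intro tendsto_mult tendsto_const)
          have "((\<lambda>v. exp (- (v * X x))) has_real_derivative - X x * exp (- (u * X x))) (at u)"
            by (auto intro!: derivative_eq_intros)
          then have "((\<lambda>v. (exp (- (v * X x)) - exp (- (u * X x))) / (v - u)) \<longlongrightarrow>
              - X x * exp (- (u * X x))) (at u)"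
            by (simp add: has_field_derivative_iff)
          then show "(\<lambda>i. (exp (- (h i * X x)) - exp (- (u * X x))) / (h i - u)) \<longlonglongrightarrow>
              - X x * exp (- (u * X x))"
            using h lim by (simp add: tendsto_at_iff_sequentially comp_def)
        qed
        then show "AE x in M. (\<lambda>i. ?q i x) \<longlonglongrightarrow> - (W x * X x * exp (- (u * X x)))"
          by (simp add: mult_ac)
        fix i
        show "AE x in M. norm (?q i x) \<le> \<bar>2 / (u / 2) * (W x * exp (- (u / 2 / 2 * X x)))\<bar>"
          using X
        proof eventually_elim
          fix x assume x: "0 \<le> X x"
          let ?e = "\<lambda>v. exp (- (v * X x))"
          have hi: "h i > u / 2" "h i \<noteq> u" using h by auto
          have "norm (?e (h i) - ?e u) \<le> X x * ?e (u / 2) * norm (h i - u)"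
          proof (rule field_differentiable_bound[where S = ?S])
            fix v assume v: "v \<in> ?S"
            show "(?e has_field_derivative - X x * ?e v) (at v within ?S)"
              by (auto intro!: derivative_eq_intros)
            have "u / 2 * X x \<le> v * X x"
              using v x by (intro mult_right_mono) auto
            then show "norm (- X x * ?e v) \<le> X x * ?e (u / 2)"
              using x by (simp add: abs_mult mult_left_mono)
          qed (use hi u in auto)
          then have "\<bar>?e (h i) - ?e u\<bar> / \<bar>h i - u\<bar> \<le> X x * ?e (u / 2)"
            using hi by (simp add: divide_le_eq)
          then have "\<bar>W x\<bar> * (\<bar>?e (h i) - ?e u\<bar> / \<bar>h i - u\<bar>) \<le> \<bar>W x\<bar> * (X x * ?e (u / 2))"
            by (intro mult_left_mono) auto
          also have "\<dots> = \<bar>W x * X x * ?e (u / 2)\<bar>"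
            using x by (simp add: abs_mult)
          also have "\<dots> \<le> \<bar>2 / (u / 2) * (W x * exp (- (u / 2 / 2 * X x)))\<bar>"
            using bound[OF x, of "u / 2"] u by simp
          finally show "norm (?q i x) \<le> \<bar>2 / (u / 2) * (W x * exp (- (u / 2 / 2 * X x)))\<bar>"
            by (simp only: real_norm_def abs_mult abs_divide)
        qed
      qed measurable
      moreover have "(\<integral>x. ?q i x \<partial>M) = (?f (h i) - ?f u) / (h i - u)" for i
      proof -
        have pos: "h i > 0" using h u by (auto dest: spec[of _ i])
        have "?q i = (\<lambda>x. (W x * exp (- (h i * X x)) - W x * exp (- (u * X x))) / (h i - u))"
          by (simp add: fun_eq_iff right_diff_distrib)
        then show ?thesis
          using int[OF pos] int[OF u] by simp
      qed
      ultimately show "(\<lambda>i. (?f (h i) - ?f u) / (h i - u)) \<longlonglongrightarrow>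
          - (\<integral>x. W x * X x * exp (- (u * X x)) \<partial>M)"
        by (simp only: integral_minus)
    qed
    moreover have "at u within ?S = at u"
      using u by (intro at_within_open) auto
    ultimately show "((\<lambda>v. (?f v - ?f u) / (v - u)) \<longlongrightarrow>
        - (\<integral>x. W x * X x * exp (- (u * X x)) \<partial>M)) (at u)"
      by simp
  qed
qed

section \<open>Exponent and moments of the Bessel intensity\<close>

text \<open>
  The Laplace exponent of the intensity, that is, the integral of \<open>1 - exp (- u s)\<close>
  (see \<open>nn_integral_bessel_exponent\<close>), in closed form.
\<close>

definition bessel_exponent :: "real \<Rightarrow> real \<Rightarrow> real \<Rightarrow> real" where
  "bessel_exponent \<omega> \<kappa> u =
     \<kappa> * ln ((\<omega> + u + sqrt ((\<omega> + u)\<^sup>2 - 1)) / (\<omega> + sqrt (\<omega>\<^sup>2 - 1)))"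

text \<open>
  The integral of \<open>s ^ n exp (- u s)\<close> against the intensity
  (see \<open>nn_integral_power_exp_bessel_intensity\<close>), for \<open>n \<ge> 1\<close>.
\<close>

definition bessel_moment :: "real \<Rightarrow> real \<Rightarrow> nat \<Rightarrow> real \<Rightarrow> real" where
  "bessel_moment \<omega> \<kappa> n u = \<kappa> * (Gamma (real n) / (u + \<omega>) ^ n *
     hypergeo_2F1 (real n / 2) ((real n + 1) / 2) 1 (1 / (u + \<omega>)\<^sup>2))"

lemma measurable_bessel_moment [measurable]: "bessel_moment \<omega> \<kappa> n \<in> borel_measurable borel"
  unfolding bessel_moment_def[abs_def] by measurable

lemma measurable_bessel_exponent [measurable]: "bessel_exponent \<omega> \<kappa> \<in> borel_measurable borel"
  unfolding bessel_exponent_def[abs_def] by measurable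

lemma measurable_bessel_rho [measurable]: "bessel_rho \<omega> \<in> borel_measurable borel"
  unfolding bessel_rho_def[abs_def] by measurable

lemma sets_bessel_intensity [measurable_cong, simp]: "sets (bessel_intensity \<omega> \<kappa>) = sets borel"
  by (simp add: bessel_intensity_def)

lemma space_bessel_intensity [simp]: "space (bessel_intensity \<omega> \<kappa>) = UNIV"
  by (simp add: bessel_intensity_def)

lemma nn_integral_bessel_intensity:
  assumes [measurable]: "g \<in> borel_measurable borel"
  shows "(\<integral>\<^sup>+s. g s \<partial>bessel_intensity \<omega> \<kappa>) =
    (\<integral>\<^sup>+s. ennreal (\<kappa> * bessel_rho \<omega> s) * indicator {0<..} s * g s \<partial>lborel)"
  unfolding bessel_intensity_def by (rule nn_integral_density) measurable

lemma nn_integral_power_exp_bessel_intensity: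
  assumes "n \<ge> 1" "\<kappa> > 0" "\<omega> + u > 1"
  shows "(\<integral>\<^sup>+s. ennreal (s ^ n * exp (- (u * s))) \<partial>bessel_intensity \<omega> \<kappa>)
    = ennreal (bessel_moment \<omega> \<kappa> n u)"
proof -
  have "(\<integral>\<^sup>+s. ennreal (s ^ n * exp (- (u * s))) \<partial>bessel_intensity \<omega> \<kappa>)
      = (\<integral>\<^sup>+s. ennreal \<kappa> * (ennreal (s ^ (n - 1) * exp (- ((u + \<omega>) * s)) * bessel_I 0 s)
           * indicator {0<..} s) \<partial>lborel)"
  proof (subst nn_integral_bessel_intensity, simp, intro nn_integral_cong)
    fix s :: real
    show "ennreal (\<kappa> * bessel_rho \<omega> s) * indicator {0<..} s * ennreal (s ^ n * exp (- (u * s))) =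
        ennreal \<kappa> * (ennreal (s ^ (n - 1) * exp (- ((u + \<omega>) * s)) * bessel_I 0 s) * indicator {0<..} s)"
    proof (cases "s > 0")
      case True
      have I: "0 \<le> bessel_I 0 s" by (rule bessel_I0_nonneg[OF True])
      have "exp (- ((u + \<omega>) * s)) = exp (- \<omega> * s) * exp (- (u * s))"
        by (simp add: algebra_simps flip: exp_add)
      moreover have "s ^ n = s * s ^ (n - 1)"
        using assms(1) by (simp add: power_eq_if)
      ultimately have "\<kappa> * bessel_rho \<omega> s * (s ^ n * exp (- (u * s))) =
          \<kappa> * (s ^ (n - 1) * exp (- ((u + \<omega>) * s)) * bessel_I 0 s)"
        using True by (simp add: bessel_rho_def)
      moreover have "ennreal (\<kappa> * bessel_rho \<omega> s) * ennreal (s ^ n * exp (- (u * s)))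
          = ennreal (\<kappa> * bessel_rho \<omega> s * (s ^ n * exp (- (u * s))))"
        using True I assms by (intro ennreal_mult[symmetric]) (auto simp: bessel_rho_def)
      moreover have "ennreal \<kappa> * ennreal (s ^ (n - 1) * exp (- ((u + \<omega>) * s)) * bessel_I 0 s)
          = ennreal (\<kappa> * (s ^ (n - 1) * exp (- ((u + \<omega>) * s)) * bessel_I 0 s))"
        using True I assms by (intro ennreal_mult[symmetric]) auto
      moreover have "indicator {0<..} s = (1::ennreal)" using True by simp
      ultimately show ?thesis by (simp only: mult_1_right)
    next
      case False
      then have "indicator {0<..} s = (0::ennreal)" by simp
      then show ?thesis by (simp only: mult_zero_left mult_zero_right)
    qed
  qed
  also have "\<dots> = ennreal \<kappa> * ennreal (Gamma (real n) / (u + \<omega>) ^ n *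
      hypergeo_2F1 (real n / 2) ((real n + 1) / 2) 1 (1 / (u + \<omega>)\<^sup>2))"
    using assms by (subst nn_integral_cmult, simp, subst nn_integral_power_exp_bessel_I0) auto
  also have "\<dots> = ennreal (bessel_moment \<omega> \<kappa> n u)"
    using assms(2) unfolding bessel_moment_def by (intro ennreal_mult'[symmetric]) simp
  finally show ?thesis .
qed

lemma bessel_moment_1:
  assumes "\<omega> + u > 1"
  shows "bessel_moment \<omega> \<kappa> 1 u = \<kappa> / sqrt ((\<omega> + u)\<^sup>2 - 1)"
proof -
  define a where "a = u + \<omega>"
  have a: "a > 1" using assms by (simp add: a_def)
  then have "a\<^sup>2 > 1" by (simp add: one_less_power)
  then have "hypergeo_2F1 (1 / 2) 1 1 (1 / a\<^sup>2) = 1 / sqrt (1 - 1 / a\<^sup>2)"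
    using a by (intro hypergeo_2F1_half_one) (auto simp: divide_less_eq)
  also have "1 - 1 / a\<^sup>2 = (a\<^sup>2 - 1) / a\<^sup>2"
    using a by (simp add: field_simps)
  also have "sqrt \<dots> = sqrt (a\<^sup>2 - 1) / a"
    using a by (simp add: real_sqrt_divide)
  finally show ?thesis
    using a by (simp add: bessel_moment_def a_def[symmetric] add.commute[of \<omega>])
qed

lemma bessel_exponent_deriv:
  assumes "\<omega> \<ge> 1" "\<omega> + u > 1"
  shows "(bessel_exponent \<omega> \<kappa> has_real_derivative \<kappa> / sqrt ((\<omega> + u)\<^sup>2 - 1)) (at u)"
proof -
  define a where "a = \<omega> + u"
  have a: "a > 1" using assms by (simp add: a_def)
  then have a2: "a\<^sup>2 - 1 > 0" by (simp add: one_less_power)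
  define r where "r = sqrt (a\<^sup>2 - 1)"
  have r: "r > 0" using a2 by (simp add: r_def)
  define b where "b = \<omega> + sqrt (\<omega>\<^sup>2 - 1)"
  have b: "b > 0" using assms(1) by (auto simp: b_def intro!: add_pos_nonneg)
  have "((\<lambda>u. \<kappa> * ln ((\<omega> + u + sqrt ((\<omega> + u)\<^sup>2 - 1)) / b)) has_real_derivative
      \<kappa> * (((1 + 2 * a * inverse r / 2) / b) / ((a + r) / b))) (at u)"
    using a a2 r b unfolding a_def r_def
    by (auto intro!: derivative_eq_intros simp: add_pos_pos power2_eq_square divide_simps)
  also have "\<kappa> * (((1 + 2 * a * inverse r / 2) / b) / ((a + r) / b)) = \<kappa> / r"
  proof -
    have "1 + 2 * a * inverse r / 2 = (a + r) / r" using r by (simp add: field_simps)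
    moreover have "a + r > 0" using a r by simp
    ultimately show ?thesis using b by simp
  qed
  finally show ?thesis
    unfolding bessel_exponent_def[abs_def] by (simp add: a_def b_def r_def)
qed

lemma bessel_exponent_continuous:
  assumes "\<omega> \<ge> 1"
  shows "continuous_on {0..} (bessel_exponent \<omega> \<kappa>)"
proof -
  have b: "\<omega> + sqrt (\<omega>\<^sup>2 - 1) > 0"
    using assms by (intro add_pos_nonneg) auto
  have "\<omega> + u + sqrt ((\<omega> + u)\<^sup>2 - 1) \<noteq> 0" if "u \<ge> 0" for u
  proof -
    have "(\<omega> + u)\<^sup>2 \<ge> 1" using assms that by (intro one_le_power) auto
    then have "sqrt ((\<omega> + u)\<^sup>2 - 1) \<ge> 0" by simp
    then show ?thesis using assms that by linarith
  qed
  then show ?thesis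
    unfolding bessel_exponent_def[abs_def] using b
    by (intro continuous_intros) auto
qed

lemma bessel_exponent_0: "\<omega> \<ge> 1 \<Longrightarrow> bessel_exponent \<omega> \<kappa> 0 = 0"
proof -
  assume "\<omega> \<ge> 1"
  then have "\<omega> + sqrt (\<omega>\<^sup>2 - 1) > 0" by (intro add_pos_nonneg) auto
  then show ?thesis by (simp add: bessel_exponent_def)
qed

text \<open>
  \<open>1 - exp (- u s)\<close> is the integral of \<open>s exp (- v s)\<close> over \<open>v\<close> between 0 and \<open>u\<close>. After
  swapping the integrals, the inner one is the first moment, whose primitive is the exponent.
\<close>

lemma nn_integral_bessel_exponent:
  assumes "\<omega> \<ge> 1" "\<kappa> > 0" "u \<ge> 0"
  shows "(\<integral>\<^sup>+s. ennreal (1 - exp (- (u * s))) \<partial>bessel_intensity \<omega> \<kappa>)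
    = ennreal (bessel_exponent \<omega> \<kappa> u)"
proof -
  let ?k = "\<lambda>v s. ennreal (\<kappa> * bessel_rho \<omega> s) * indicator {0<..} s *
     (ennreal (s ^ 1 * exp (- (v * s))) * indicator {0..u} v)"
  have "(\<integral>\<^sup>+s. ennreal (1 - exp (- (u * s))) \<partial>bessel_intensity \<omega> \<kappa>)
      = (\<integral>\<^sup>+s. \<integral>\<^sup>+v. ?k v s \<partial>lborel \<partial>lborel)"
  proof (subst nn_integral_bessel_intensity, simp, intro nn_integral_cong)
    fix s :: real
    show "ennreal (\<kappa> * bessel_rho \<omega> s) * indicator {0<..} s * ennreal (1 - exp (- (u * s))) =
        (\<integral>\<^sup>+v. ?k v s \<partial>lborel)"
    proof (cases "s > 0")
      case True
      have "(\<integral>\<^sup>+v. ennreal (s ^ 1 * exp (- (v * s))) * indicator {0..u} v \<partial>lborel)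
          = - exp (- (u * s)) - (- exp (- (0 * s)))"
        using assms True by (intro nn_integral_FTC_Icc) (auto intro!: derivative_eq_intros)
      then have "ennreal (1 - exp (- (u * s))) =
          (\<integral>\<^sup>+v. ennreal (s ^ 1 * exp (- (v * s))) * indicator {0..u} v \<partial>lborel)"
        by simp
      then show ?thesis by (subst nn_integral_cmult) simp_all
    next
      case False
      then have "indicator {0<..} s = (0::ennreal)" by simp
      then show ?thesis by (simp only: mult_zero_left mult_zero_right nn_integral_const)
    qed
  qed
  also have "\<dots> = (\<integral>\<^sup>+v. \<integral>\<^sup>+s. ?k v s \<partial>lborel \<partial>lborel)"
    by (rule lborel_pair.Fubini') measurable
  also have "\<dots> = (\<integral>\<^sup>+v. ennreal (\<kappa> / sqrt ((\<omega> + v)\<^sup>2 - 1)) * indicator {0..u} v \<partial>lborel)"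
  proof (rule nn_integral_cong_AE)
    \<comment> \<open>For \<open>\<omega> = 1\<close> the first moment is infinite at \<open>v = 0\<close>.\<close>
    have "AE v in lborel. v \<noteq> (0::real)" by (rule AE_lborel_singleton)
    then show "AE v in lborel. (\<integral>\<^sup>+s. ?k v s \<partial>lborel) =
        ennreal (\<kappa> / sqrt ((\<omega> + v)\<^sup>2 - 1)) * indicator {0..u} v"
    proof eventually_elim
      fix v :: real assume "v \<noteq> 0"
      show "(\<integral>\<^sup>+s. ?k v s \<partial>lborel) = ennreal (\<kappa> / sqrt ((\<omega> + v)\<^sup>2 - 1)) * indicator {0..u} v"
      proof (cases "v \<in> {0..u}")
        case True
        then have v: "\<omega> + v > 1" using assms \<open>v \<noteq> 0\<close> by auto
        have "(\<integral>\<^sup>+s. ?k v s \<partial>lborel) = (\<integral>\<^sup>+s. ennreal (s ^ 1 * exp (- (v * s))) \<partial>bessel_intensity \<omega> \<kappa>)"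
          using True by (subst nn_integral_bessel_intensity) auto
        also have "\<dots> = ennreal (bessel_moment \<omega> \<kappa> 1 v)"
          using assms v by (intro nn_integral_power_exp_bessel_intensity) auto
        also have "\<dots> = ennreal (\<kappa> / sqrt ((\<omega> + v)\<^sup>2 - 1))"
          by (simp only: bessel_moment_1[OF v])
        finally show ?thesis using True by simp
      qed simp
    qed
  qed
  also have "\<dots> = ennreal (bessel_exponent \<omega> \<kappa> u - bessel_exponent \<omega> \<kappa> 0)"
  proof (rule nn_integral_has_integral_lebesgue')
    fix v assume "v \<in> {0..u}"
    then have "(\<omega> + v)\<^sup>2 \<ge> 1" using assms by (intro one_le_power) auto
    then show "0 \<le> \<kappa> / sqrt ((\<omega> + v)\<^sup>2 - 1)" using assms by simp
  next
    show "((\<lambda>v. \<kappa> / sqrt ((\<omega> + v)\<^sup>2 - 1)) has_integral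
        bessel_exponent \<omega> \<kappa> u - bessel_exponent \<omega> \<kappa> 0) {0..u}"
    proof (rule fundamental_theorem_of_calculus_interior)
      show "continuous_on {0..u} (bessel_exponent \<omega> \<kappa>)"
        by (rule continuous_on_subset[OF bessel_exponent_continuous]) (use assms in auto)
      fix v assume "v \<in> {0<..<u}"
      then show "(bessel_exponent \<omega> \<kappa> has_vector_derivative \<kappa> / sqrt ((\<omega> + v)\<^sup>2 - 1)) (at v)"
        using assms bessel_exponent_deriv[of \<omega> v \<kappa>]
        by (simp add: has_real_derivative_iff_has_vector_derivative)
    qed fact
  qed
  finally show ?thesis
    using assms(1) by (simp add: bessel_exponent_0)
qed

lemma exp_bessel_exponent:
  assumes "\<omega> \<ge> 1" "u \<ge> 0"
  shows "exp (- bessel_exponent \<omega> \<kappa> u) =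
    ((\<omega> + sqrt (\<omega>\<^sup>2 - 1)) / (\<omega> + u + sqrt ((\<omega> + u)\<^sup>2 - 1))) powr \<kappa>"
proof -
  have "(\<omega> + u)\<^sup>2 \<ge> 1" using assms by (intro one_le_power) auto
  then have pos: "\<omega> + u + sqrt ((\<omega> + u)\<^sup>2 - 1) > 0" "\<omega> + sqrt (\<omega>\<^sup>2 - 1) > 0"
    using assms by (auto intro!: add_pos_nonneg)
  then show ?thesis
    by (simp add: bessel_exponent_def powr_def ln_div algebra_simps)
qed

lemma sigma_finite_bessel_intensity: "sigma_finite_measure (bessel_intensity \<omega> \<kappa>)"
  unfolding bessel_intensity_def
  by (subst sigma_finite_measure.sigma_finite_iff_density_finite[OF sigma_finite_lborel]) (auto simp: indicator_def)

lemma AE_bessel_intensity_pos: "AE s in bessel_intensity \<omega> \<kappa>. 0 < s"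
  unfolding bessel_intensity_def by (subst AE_density) (auto simp: indicator_def)

lemma bessel_moment_deriv:
  assumes "\<omega> \<ge> 1" "\<kappa> > 0" "n \<ge> 1" "u > 0"
  shows "(bessel_moment \<omega> \<kappa> n has_real_derivative - bessel_moment \<omega> \<kappa> (Suc n) u) (at u)"
proof -
  let ?L = "bessel_intensity \<omega> \<kappa>"
  note pos = AE_bessel_intensity_pos[of \<omega> \<kappa>]
  have nn: "0 \<le> bessel_moment \<omega> \<kappa> m v" if "v > 0" "m \<ge> 1" for v m
  proof -
    have "(u + \<omega>)\<^sup>2 > 1" if "u > 0" for u
      using assms that by (intro one_less_power) auto
    then show ?thesis using that assms unfolding bessel_moment_def
      by (intro mult_nonneg_nonneg divide_nonneg_nonneg hypergeo_2F1_nonneg) (auto simp: Gamma_real_nonneg)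
  qed
  have eq: "has_bochner_integral ?L (\<lambda>s. s ^ m * exp (- (v * s))) (bessel_moment \<omega> \<kappa> m v)"
    if "v > 0" "m \<ge> 1" for v m
  proof (rule has_bochner_integral_nn_integral)
    show "AE s in ?L. 0 \<le> s ^ m * exp (- (v * s))"
      using pos by eventually_elim simp
    show "(\<integral>\<^sup>+s. ennreal (s ^ m * exp (- (v * s))) \<partial>?L) = ennreal (bessel_moment \<omega> \<kappa> m v)"
      using assms that by (intro nn_integral_power_exp_bessel_intensity) auto
  qed (use nn[OF that] in auto)
  have "((\<lambda>u. \<integral>s. s ^ n * exp (- (u * s)) \<partial>?L) has_real_derivative
      - (\<integral>s. s ^ n * s * exp (- (u * s)) \<partial>?L)) (at u)"
  proof (rule laplace_transform_derivative(2))
    show "AE s in ?L. 0 \<le> s" using pos by eventually_elim simp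
    show "integrable ?L (\<lambda>s. s ^ n * exp (- (v * s)))" if "v > 0" for v
      using eq[OF that assms(3)] by (simp add: has_bochner_integral_iff)
  qed (use assms in auto)
  moreover have "(\<integral>s. s ^ n * s * exp (- (u * s)) \<partial>?L) = bessel_moment \<omega> \<kappa> (Suc n) u"
    using eq[OF assms(4), of "Suc n"] by (simp add: has_bochner_integral_iff mult_ac)
  moreover have "\<forall>\<^sub>F v in nhds u. (\<integral>s. s ^ n * exp (- (v * s)) \<partial>?L) = bessel_moment \<omega> \<kappa> n v"
    using eventually_nhds_in_open[of "{0<..}" u] assms(4)
    by (auto elim!: eventually_mono dest!: eq[OF _ assms(3)] simp: has_bochner_integral_iff)
  ultimately show ?thesis
    by (simp add: DERIV_cong_ev[OF refl _ refl])
qed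

section \<open>The Laplace functional of a marked Poisson process\<close>

text \<open>
  \<open>exp (- x)\<close> for extended \<open>x\<close>, continuous at \<open>\<infinity>\<close>; it turns sums that may diverge into products.
\<close>

definition nexp :: "ennreal \<Rightarrow> real" where
  "nexp x = (if x = \<top> then 0 else exp (- enn2real x))"

lemma nexp_ennreal [simp]: "0 \<le> x \<Longrightarrow> nexp (ennreal x) = exp (- x)"
  by (simp add: nexp_def)

lemma nexp_0 [simp]: "nexp 0 = 1"
  by (simp add: nexp_def)

lemma nexp_top [simp]: "nexp \<top> = 0"
  by (simp add: nexp_def)

lemma nexp_nonneg [simp]: "0 \<le> nexp x"
  by (simp add: nexp_def)

lemma nexp_le_1 [simp]: "nexp x \<le> 1"
  by (simp add: nexp_def)

lemma nexp_add: "nexp (x + y) = nexp x * nexp y"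
  by (cases x; cases y) (auto simp: exp_add[symmetric] simp flip: ennreal_plus)

lemma nexp_sum: "nexp (\<Sum>i\<in>I. f i) = (\<Prod>i\<in>I. nexp (f i))"
  by (induction I rule: infinite_finite_induct) (auto simp: nexp_add)

lemma nexp_antimono: "x \<le> y \<Longrightarrow> nexp y \<le> nexp x"
  by (cases x; cases y) (auto simp: top_unique)

lemma measurable_nexp [measurable]: "nexp \<in> borel_measurable borel"
  unfolding nexp_def[abs_def] by measurable

lemma tendsto_nexp:
  assumes "(f \<longlongrightarrow> l) F"
  shows "((\<lambda>x. nexp (f x)) \<longlongrightarrow> nexp l) F"
proof (cases l)
  case (real r)
  have "\<forall>\<^sub>F x in F. f x < \<top>"
    using order_tendstoD(2)[OF assms, of \<top>] real by simp
  then have "\<forall>\<^sub>F x in F. exp (- enn2real (f x)) = nexp (f x)"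
    by eventually_elim (auto simp: nexp_def)
  moreover have "((\<lambda>x. exp (- enn2real (f x))) \<longlongrightarrow> exp (- r)) F"
    using assms real by (intro tendsto_intros tendsto_enn2real) auto
  ultimately show ?thesis
    using real by (simp add: tendsto_cong)
next
  case top
  show ?thesis
  proof (rule order_tendstoI)
    fix e assume "e > nexp l"
    then have e: "e > 0" using top by simp
    have "\<forall>\<^sub>F x in F. ennreal (\<bar>ln e\<bar> + 1) < f x"
      using order_tendstoD(1)[OF assms, of "ennreal (\<bar>ln e\<bar> + 1)"] top by simp
    then show "\<forall>\<^sub>F x in F. nexp (f x) < e"
    proof eventually_elim
      fix x assume "ennreal (\<bar>ln e\<bar> + 1) < f x"
      then have "nexp (f x) \<le> nexp (ennreal (\<bar>ln e\<bar> + 1))"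
        by (intro nexp_antimono) simp
      also have "\<dots> = exp (- (\<bar>ln e\<bar> + 1))" by (subst nexp_ennreal) auto
      also have "\<dots> < exp (ln e)" by simp
      finally show "nexp (f x) < e" using e by simp
    qed
  next
    fix e assume "e < nexp l"
    then have "e < 0" using top by simp
    then have "e < nexp (f x)" for x using nexp_nonneg[of "f x"] by linarith
    then show "\<forall>\<^sub>F x in F. e < nexp (f x)" by simp
  qed
qed

lemma num_points_eq_suminf: "num_points J A x = (\<Sum>j. indicator A (J j x))"
proof -
  have "num_points J A x = (\<integral>\<^sup>+j. indicator {j. J j x \<in> A} j \<partial>count_space UNIV)"
    by (simp add: num_points_def)
  also have "\<dots> = (\<Sum>j. indicator {j. J j x \<in> A} j)"
    by (rule nn_integral_count_space_nat)
  also have "\<dots> = (\<Sum>j. indicator A (J j x))"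
    by (intro suminf_cong) (auto simp: indicator_def)
  finally show ?thesis .
qed

text \<open>
  As \<open>a > 0\<close>, the event of infinitely many points contributes 0, and the identity behind the series
  holds pointwise.
\<close>

lemma poisson_count_laplace:
  assumes J: "poisson_points M \<Lambda> J" and A: "A \<in> sets borel" "emeasure \<Lambda> A < \<infinity>" and a: "a > 0"
  shows "(\<integral>\<^sup>+x. ennreal (nexp (ennreal a * num_points J A x)) \<partial>M)
    = ennreal (exp (- ((1 - exp (- a)) * measure \<Lambda> A)))"
proof -
  interpret prob_space M using J by (simp add: poisson_points_def)
  have [measurable]: "J j \<in> borel_measurable M" for j
    using J by (simp add: poisson_points_def)
  note A(1)[measurable]
  have [measurable]: "num_points J A \<in> borel_measurable M"
    unfolding num_points_eq_suminf[abs_def] by measurable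
  define l where "l = measure \<Lambda> A"
  let ?E = "\<lambda>i. {x \<in> space M. num_points J A x = of_nat i}"
  have "(\<integral>\<^sup>+x. ennreal (nexp (ennreal a * num_points J A x)) \<partial>M)
      = (\<integral>\<^sup>+x. (\<Sum>i. ennreal (exp (- a * real i)) * indicator (?E i) x) \<partial>M)"
  proof (intro nn_integral_cong)
    fix x assume x: "x \<in> space M"
    show "ennreal (nexp (ennreal a * num_points J A x)) =
        (\<Sum>i. ennreal (exp (- a * real i)) * indicator (?E i) x)"
    proof (cases "finite {j. J j x \<in> A}")
      case True
      define k where "k = card {j. J j x \<in> A}"
      have N: "num_points J A x = of_nat k"
        using True by (simp add: num_points_def k_def)
      have "(\<Sum>i. ennreal (exp (- a * real i)) * indicator (?E i) x)
          = (\<Sum>i\<in>{k}. ennreal (exp (- a * real i)) * indicator (?E i) x)"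
        by (rule suminf_finite) (auto simp: N)
      also have "\<dots> = ennreal (exp (- a * real k))" using x by (simp add: N)
      also have "ennreal a * of_nat k = ennreal (a * real k)"
        using a by (simp add: ennreal_mult ennreal_of_nat_eq_real_of_nat)
      then have "nexp (ennreal a * num_points J A x) = exp (- a * real k)"
        using a by (simp add: N)
      ultimately show ?thesis by simp
    next
      case False
      then have N: "num_points J A x = \<top>" by (simp add: num_points_def)
      have "num_points J A x \<noteq> of_nat i" for i
        unfolding N by (metis ennreal_of_nat_eq_real_of_nat ennreal_neq_top)
      then show ?thesis using a by (simp add: N ennreal_mult_top)
    qed
  qed
  also have "\<dots> = (\<Sum>i. \<integral>\<^sup>+x. ennreal (exp (- a * real i)) * indicator (?E i) x \<partial>M)"
    by (rule nn_integral_suminf) measurable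
  also have "\<dots> = (\<Sum>i. ennreal (exp (- a * real i) * (l ^ i / fact i * exp (- l))))"
  proof (intro suminf_cong)
    fix i
    have "emeasure M (?E i) = ennreal (l ^ i / fact i * exp (- l))"
      unfolding emeasure_eq_measure using J A by (simp add: poisson_points_def l_def)
    then have "(\<integral>\<^sup>+x. ennreal (exp (- a * real i)) * indicator (?E i) x \<partial>M) =
        ennreal (exp (- a * real i)) * ennreal (l ^ i / fact i * exp (- l))"
      by (subst nn_integral_cmult_indicator) auto
    also have "\<dots> = ennreal (exp (- a * real i) * (l ^ i / fact i * exp (- l)))"
      by (rule ennreal_mult[symmetric]) (simp_all add: l_def)
    finally show "(\<integral>\<^sup>+x. ennreal (exp (- a * real i)) * indicator (?E i) x \<partial>M) =
        ennreal (exp (- a * real i) * (l ^ i / fact i * exp (- l)))" .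
  qed
  also have "\<dots> = ennreal (exp (l * exp (- a)) * exp (- l))"
  proof (rule suminf_ennreal_eq)
    have "(\<lambda>i. (l * exp (- a)) ^ i /\<^sub>R fact i * exp (- l)) sums (exp (l * exp (- a)) * exp (- l))"
      by (intro sums_mult2 exp_converges)
    moreover have "(l * exp (- a)) ^ i /\<^sub>R fact i * exp (- l) =
        exp (- a * real i) * (l ^ i / fact i * exp (- l))" for i
      by (simp add: power_mult_distrib exp_of_nat_mult[symmetric] field_simps)
    ultimately show "(\<lambda>i. exp (- a * real i) * (l ^ i / fact i * exp (- l))) sums
        (exp (l * exp (- a)) * exp (- l))"
      by simp
  qed (simp add: l_def)
  also have "exp (l * exp (- a)) * exp (- l) = exp (- ((1 - exp (- a)) * l))"
    by (simp add: algebra_simps flip: exp_add)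
  finally show ?thesis by (simp only: l_def)
qed

text \<open>
  For a simple function the sum over the points is a linear combination of the counts of its level
  sets, which are independent.
\<close>

lemma poisson_laplace_simple:
  assumes J: "poisson_points M \<Lambda> J" and sets: "sets \<Lambda> = sets borel"
    and f: "simple_function borel f" "\<And>s. f s < \<top>"
    and C: "C \<in> sets borel" "emeasure \<Lambda> C < \<infinity>" "\<And>s. s \<notin> C \<Longrightarrow> f s = 0"
  shows "(\<integral>\<^sup>+x. ennreal (nexp (\<Sum>j. f (J j x))) \<partial>M)
    = ennreal (nexp (\<integral>\<^sup>+s. ennreal (1 - nexp (f s)) \<partial>\<Lambda>))"
proof -
  interpret prob_space M using J by (simp add: poisson_points_def)
  note sets[measurable_cong]
  define R where "R = range f - {0}"
  let ?A = "\<lambda>y. f -` {y}"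
  define \<A> where "\<A> = ?A ` R"
  define a where "a A = enn2real (f (SOME s. s \<in> A))" for A
  have fin: "finite R" "finite \<A>"
    using f(1) by (auto simp: simple_function_def R_def \<A>_def)
  have inj: "inj_on ?A R"
    by (auto simp: inj_on_def R_def)
  have a: "ennreal (a (?A y)) = y" "a (?A y) > 0" "nexp y = exp (- a (?A y))" if y: "y \<in> R" for y
  proof -
    from y obtain s where "f s = y" by (auto simp: R_def)
    then have "f (SOME s. s \<in> ?A y) = y" by (metis someI vimage_singleton_eq)
    moreover have "y < \<top>" "y \<noteq> 0" using f(2)[of s] \<open>f s = y\<close> y by (auto simp: R_def)
    ultimately show "ennreal (a (?A y)) = y" "a (?A y) > 0" "nexp y = exp (- a (?A y))"
      by (auto simp: a_def enn2real_positive_iff nexp_def zero_less_iff_neq_zero)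
  qed
  have [measurable]: "f \<in> borel_measurable borel"
    using f(1) by (rule borel_measurable_simple_function)
  have meas: "?A y \<in> sets borel" for y
    using measurable_sets[of f borel borel "{y}"] by simp
  have finA: "emeasure \<Lambda> (?A y) < \<infinity>" if "y \<in> R" for y
  proof -
    have "?A y \<subseteq> C" using that C(3) by (auto simp: R_def)
    then have "emeasure \<Lambda> (?A y) \<le> emeasure \<Lambda> C"
      using C(1) by (intro emeasure_mono) (auto simp: sets)
    then show ?thesis using C(2) by simp
  qed
  have repr: "g (f s) = (\<Sum>y\<in>R. g y * indicator (?A y) s)" if "g 0 = 0" for g :: "ennreal \<Rightarrow> ennreal" and s
  proof (cases "f s = 0")
    case True
    then have "(\<Sum>y\<in>R. g y * indicator (?A y) s) = 0"
      by (intro sum.neutral) (auto simp: R_def)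
    then show ?thesis using True that by simp
  next
    case False
    then have "(\<Sum>y\<in>R. g y * indicator (?A y) s) = (\<Sum>y\<in>{f s}. g y * indicator (?A y) s)"
      by (intro sum.mono_neutral_right fin) (auto simp: R_def)
    then show ?thesis by simp
  qed
  have "(\<Sum>j. f (J j x)) = (\<Sum>A\<in>\<A>. ennreal (a A) * num_points J A x)" for x
  proof -
    have "(\<Sum>j. f (J j x)) = (\<Sum>j. \<Sum>y\<in>R. y * indicator (?A y) (J j x))"
      by (intro suminf_cong repr[of "\<lambda>y. y"]) simp
    also have "\<dots> = (\<Sum>y\<in>R. \<Sum>j. y * indicator (?A y) (J j x))"
      by (rule suminf_sum) simp
    also have "\<dots> = (\<Sum>y\<in>R. ennreal (a (?A y)) * num_points J (?A y) x)"
      by (intro sum.cong refl) (simp add: num_points_eq_suminf a)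
    also have "\<dots> = (\<Sum>A\<in>\<A>. ennreal (a A) * num_points J A x)"
      unfolding \<A>_def by (subst sum.reindex[OF inj]) simp
    finally show ?thesis .
  qed
  then have "(\<integral>\<^sup>+x. ennreal (nexp (\<Sum>j. f (J j x))) \<partial>M)
      = (\<integral>\<^sup>+x. (\<Prod>A\<in>\<A>. ennreal (nexp (ennreal (a A) * num_points J A x))) \<partial>M)"
    by (simp add: nexp_sum prod_ennreal)
  also have "\<dots> = (\<Prod>A\<in>\<A>. \<integral>\<^sup>+x. ennreal (nexp (ennreal (a A) * num_points J A x)) \<partial>M)"
  proof (rule indep_vars_nn_integral)
    have "disjoint \<A>"
      by (auto simp: disjoint_def \<A>_def)
    moreover have "\<forall>A\<in>\<A>. A \<in> sets borel \<and> emeasure \<Lambda> A < \<infinity>"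
      using meas finA by (auto simp: \<A>_def)
    ultimately have "indep_vars (\<lambda>_. borel) (num_points J) \<A>"
      using J fin(2) by (simp add: poisson_points_def)
    then show "indep_vars (\<lambda>_. borel) (\<lambda>A x. ennreal (nexp (ennreal (a A) * num_points J A x))) \<A>"
      by (rule indep_vars_compose2[where Y = "\<lambda>A y. ennreal (nexp (ennreal (a A) * y))"]) measurable
  qed (use fin in auto)
  also have "\<dots> = (\<Prod>y\<in>R. ennreal (exp (- ((1 - exp (- a (?A y))) * measure \<Lambda> (?A y)))))"
    unfolding \<A>_def
    by (subst prod.reindex[OF inj]) (simp add: poisson_count_laplace[OF J meas finA a(2)])
  also have "\<dots> = (\<Prod>y\<in>R. ennreal (nexp (ennreal (1 - nexp y) * emeasure \<Lambda> (?A y))))"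
  proof (intro prod.cong refl)
    fix y assume y: "y \<in> R"
    have "emeasure \<Lambda> (?A y) = ennreal (measure \<Lambda> (?A y))"
      using finA[OF y] by (intro emeasure_eq_ennreal_measure) auto
    then have "ennreal (1 - nexp y) * emeasure \<Lambda> (?A y) = ennreal ((1 - nexp y) * measure \<Lambda> (?A y))"
      by (simp add: ennreal_mult')
    moreover have "0 \<le> (1 - nexp y) * measure \<Lambda> (?A y)" by simp
    ultimately show "ennreal (exp (- ((1 - exp (- a (?A y))) * measure \<Lambda> (?A y)))) =
        ennreal (nexp (ennreal (1 - nexp y) * emeasure \<Lambda> (?A y)))"
      by (simp only: nexp_ennreal a(3)[OF y, symmetric])
  qed
  also have "\<dots> = ennreal (nexp (\<Sum>y\<in>R. ennreal (1 - nexp y) * emeasure \<Lambda> (?A y)))"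
    by (simp add: nexp_sum prod_ennreal)
  also have "(\<Sum>y\<in>R. ennreal (1 - nexp y) * emeasure \<Lambda> (?A y)) =
      (\<integral>\<^sup>+s. (\<Sum>y\<in>R. ennreal (1 - nexp y) * indicator (?A y) s) \<partial>\<Lambda>)"
    using meas by (subst nn_integral_sum) (auto simp: nn_integral_cmult_indicator sets)
  also have "\<dots> = (\<integral>\<^sup>+s. ennreal (1 - nexp (f s)) \<partial>\<Lambda>)"
    by (intro nn_integral_cong repr[of "\<lambda>y. ennreal (1 - nexp y)", symmetric]) simp
  finally show ?thesis .
qed

text \<open>
  Approximate \<open>f\<close> from below by simple functions, cut off to sets of finite intensity.
\<close>

lemma poisson_laplace_functional:
  assumes J: "poisson_points M \<Lambda> J" and sets: "sets \<Lambda> = sets borel"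
    and sf: "sigma_finite_measure \<Lambda>" and f [measurable]: "f \<in> borel_measurable borel"
  shows "(\<integral>\<^sup>+x. ennreal (nexp (\<Sum>j. f (J j x))) \<partial>M)
    = ennreal (nexp (\<integral>\<^sup>+s. ennreal (1 - nexp (f s)) \<partial>\<Lambda>))"
proof -
  interpret prob_space M using J by (simp add: poisson_points_def)
  interpret L: sigma_finite_measure \<Lambda> by (rule sf)
  note sets[measurable_cong]
  have [measurable]: "J j \<in> borel_measurable M" for j
    using J by (simp add: poisson_points_def)
  have sp: "space \<Lambda> = UNIV" using sets_eq_imp_space_eq[OF sets] by simp
  obtain g where g: "\<And>i. simple_function borel (g i)" "incseq g" "\<And>i x. g i x < top"
      "\<And>x. (SUP i. g i x) = f x"
    using borel_measurable_implies_simple_function_sequence'[OF f] by metis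
  obtain C where C: "range C \<subseteq> sets \<Lambda>" "(\<Union>i. C i) = space \<Lambda>" "\<And>i. emeasure \<Lambda> (C i) \<noteq> \<infinity>" "incseq C"
    using L.sigma_finite_incseq by metis
  have CS: "C i \<in> sets borel" for i using C(1) sets by auto
  define h where "h i s = g i s * indicator (C i) s" for i s
  have h_simple: "simple_function borel (h i)" for i
    unfolding h_def using g(1) CS by (intro simple_function_mult simple_function_indicator) auto
  have [measurable]: "h i \<in> borel_measurable borel" for i
    using h_simple by (rule borel_measurable_simple_function)
  have h_mono: "h i s \<le> h (Suc i) s" for i s
    unfolding h_def using g(2) C(4)
    by (intro mult_mono) (auto simp: incseq_Suc_iff le_fun_def indicator_def)
  have h_lim: "(\<lambda>i. h i s) \<longlonglongrightarrow> f s" for s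
  proof -
    obtain k where k: "s \<in> C k" using C(2) sp by auto
    have "(\<lambda>i. g i s) \<longlonglongrightarrow> f s"
      unfolding g(4)[of s, symmetric] using g(2) by (intro LIMSEQ_SUP) (auto simp: incseq_def le_fun_def)
    moreover have "\<forall>\<^sub>F i in sequentially. g i s = h i s"
      using eventually_ge_at_top[of k]
    proof eventually_elim
      fix i assume "k \<le> i"
      then have "s \<in> C i" using k C(4) by (auto simp: incseq_def)
      then show "g i s = h i s" by (simp add: h_def)
    qed
    ultimately show ?thesis by (rule Lim_transform_eventually)
  qed
  have eq: "(\<integral>\<^sup>+x. ennreal (nexp (\<Sum>j. h i (J j x))) \<partial>M)
    = ennreal (nexp (\<integral>\<^sup>+s. ennreal (1 - nexp (h i s)) \<partial>\<Lambda>))" for i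
  proof (rule poisson_laplace_simple[OF J sets h_simple, where C = "C i"])
    show "h i s < \<top>" for s using g(3)[of i s] by (simp add: h_def indicator_def)
    show "C i \<in> sets borel" "emeasure \<Lambda> (C i) < \<infinity>" using CS C(3) by (auto simp: less_top)
  qed (simp add: h_def)
  have lim1: "(\<lambda>i. \<integral>\<^sup>+x. ennreal (nexp (\<Sum>j. h i (J j x))) \<partial>M) \<longlonglongrightarrow>
      (\<integral>\<^sup>+x. ennreal (nexp (\<Sum>j. f (J j x))) \<partial>M)"
  proof (rule nn_integral_dominated_convergence[where w = "\<lambda>_. 1"])
    have "(\<lambda>i. \<Sum>j. h i (J j x)) \<longlonglongrightarrow> (\<Sum>j. f (J j x))" for x
      unfolding nn_integral_count_space_nat[symmetric]
      using h_mono h_lim by (intro nn_integral_LIMSEQ) (auto simp: incseq_Suc_iff le_fun_def)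
    then show "AE x in M. (\<lambda>i. ennreal (nexp (\<Sum>j. h i (J j x)))) \<longlonglongrightarrow>
        ennreal (nexp (\<Sum>j. f (J j x)))"
      by (intro AE_I2 tendsto_ennrealI tendsto_nexp)
  qed (auto simp: emeasure_space_1)
  have lim2: "(\<lambda>i. ennreal (nexp (\<integral>\<^sup>+s. ennreal (1 - nexp (h i s)) \<partial>\<Lambda>))) \<longlonglongrightarrow>
      ennreal (nexp (\<integral>\<^sup>+s. ennreal (1 - nexp (f s)) \<partial>\<Lambda>))"
  proof (rule tendsto_ennrealI, rule tendsto_nexp, rule nn_integral_LIMSEQ)
    show "incseq (\<lambda>i s. ennreal (1 - nexp (h i s)))"
      using h_mono by (auto simp: incseq_Suc_iff le_fun_def intro!: ennreal_leI nexp_antimono)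
    show "(\<lambda>i. ennreal (1 - nexp (h i s))) \<longlonglongrightarrow> ennreal (1 - nexp (f s))" for s
      by (intro tendsto_ennrealI tendsto_diff tendsto_const tendsto_nexp h_lim)
  qed measurable
  show ?thesis
    using lim1[unfolded eq] lim2 by (rule LIMSEQ_unique)
qed

text \<open>
  Only finitely many coordinates of the infinite product enter, so the finite product measure decides.
\<close>

lemma nn_integral_PiM_prod_coordinates:
  assumes P: "prob_space P" and [measurable]: "\<And>j. j < N \<Longrightarrow> k j \<in> borel_measurable P"
  shows "(\<integral>\<^sup>+t. (\<Prod>j<N. k j (t j)) \<partial>(\<Pi>\<^sub>M j\<in>(UNIV :: nat set). P)) = (\<Prod>j<N. \<integral>\<^sup>+t. k j t \<partial>P)"
proof -
  interpret product_prob_space "\<lambda>_::nat. P" UNIV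
    by (intro product_prob_spaceI) (rule P)
  have "(\<integral>\<^sup>+t. (\<Prod>j<N. k j (t j)) \<partial>(\<Pi>\<^sub>M j\<in>(UNIV :: nat set). P))
      = (\<integral>\<^sup>+t. (\<Prod>j<N. k j (restrict t {..<N} j)) \<partial>(\<Pi>\<^sub>M j\<in>UNIV. P))"
    by (intro nn_integral_cong prod.cong refl) auto
  also have "\<dots> = (\<integral>\<^sup>+t. (\<Prod>j<N. k j (t j)) \<partial>distr (\<Pi>\<^sub>M j\<in>UNIV. P) (\<Pi>\<^sub>M j\<in>{..<N}. P) (\<lambda>t. restrict t {..<N}))"
    by (subst nn_integral_distr) auto
  also have "\<dots> = (\<integral>\<^sup>+t. (\<Prod>j<N. k j (t j)) \<partial>(\<Pi>\<^sub>M j\<in>{..<N}. P))"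
    by (subst distr_PiM_restrict_finite) auto
  also have "\<dots> = (\<Prod>j<N. \<integral>\<^sup>+t. k j t \<partial>P)"
    by (rule product_nn_integral_prod) auto
  finally show ?thesis .
qed

text \<open>
  Given the points, integrating out the first \<open>N\<close> marks replaces each factor by its mean over the marks.
  Letting \<open>N\<close> tend to infinity leaves a functional of the points alone.
\<close>

lemma marked_poisson_laplace_functional:
  assumes J: "poisson_points M \<Lambda> J" and sets: "sets \<Lambda> = sets borel"
    and sf: "sigma_finite_measure \<Lambda>" and P: "prob_space P"
    and \<tau> [measurable]: "\<And>j. \<tau> j \<in> measurable M P"
    and indep: "distr M ((\<Pi>\<^sub>M j\<in>UNIV. borel) \<Otimes>\<^sub>M (\<Pi>\<^sub>M j\<in>UNIV. P)) (\<lambda>x. (\<lambda>j. J j x, \<lambda>j. \<tau> j x)) =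
       distr M (\<Pi>\<^sub>M j\<in>UNIV. borel) (\<lambda>x j. J j x) \<Otimes>\<^sub>M (\<Pi>\<^sub>M j\<in>UNIV. P)"
    and f [measurable]: "(\<lambda>(t, s). f t s) \<in> borel_measurable (P \<Otimes>\<^sub>M borel)"
  shows "(\<integral>\<^sup>+x. ennreal (nexp (\<Sum>j. f (\<tau> j x) (J j x))) \<partial>M)
    = ennreal (nexp (\<integral>\<^sup>+s. ennreal (1 - (\<integral>t. nexp (f t s) \<partial>P)) \<partial>\<Lambda>))"
proof -
  interpret prob_space M using J by (simp add: poisson_points_def)
  interpret P: prob_space P by fact
  interpret PP: prob_space "\<Pi>\<^sub>M j\<in>(UNIV :: nat set). P" by (rule prob_space_PiM) (rule P)
  have [measurable]: "J j \<in> borel_measurable M" for j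
    using J by (simp add: poisson_points_def)
  define G where "G s = (\<integral>t. nexp (f t s) \<partial>P)" for s
  have [measurable]: "G \<in> borel_measurable borel"
    unfolding G_def[abs_def] by measurable
  have int: "integrable P (\<lambda>t. nexp (f t s))" for s
    by (rule P.integrable_const_bound[where B = 1]) auto
  have G: "0 \<le> G s" "G s \<le> 1" for s
    unfolding G_def using P.integral_le_const[OF int[of s], of 1] by (auto intro!: integral_nonneg)
  have G_nn: "(\<integral>\<^sup>+t. ennreal (nexp (f t s)) \<partial>P) = ennreal (G s)" for s
    unfolding G_def by (rule nn_integral_eq_integral[OF int]) simp
  \<comment> \<open>\<open>l\<close> is \<open>- ln G\<close> with values in \<open>[0, \<infinity>]\<close>, so that the unmarked functional applies to it.\<close>
  define l where "l s = (if G s = 0 then \<top> else ennreal (- ln (G s)))" for s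
  have [measurable]: "l \<in> borel_measurable borel"
    unfolding l_def[abs_def] by measurable
  have l: "nexp (l s) = G s" for s
    using G[of s] by (auto simp: l_def ln_le_zero_iff)
  have fin: "(\<integral>\<^sup>+x. ennreal (nexp (\<Sum>j<N. f (\<tau> j x) (J j x))) \<partial>M)
      = (\<integral>\<^sup>+x. ennreal (nexp (\<Sum>j<N. l (J j x))) \<partial>M)" for N
  proof -
    let ?F = "\<lambda>(y, t). \<Prod>j<N. ennreal (nexp (f (t j) (y j)))"
    let ?S = "\<Pi>\<^sub>M j\<in>(UNIV :: nat set). (borel :: real measure)"
    let ?T = "\<Pi>\<^sub>M j\<in>(UNIV :: nat set). P"
    have [measurable]: "?F \<in> borel_measurable (?S \<Otimes>\<^sub>M ?T)"
      by measurable
    have "(\<integral>\<^sup>+x. ennreal (nexp (\<Sum>j<N. f (\<tau> j x) (J j x))) \<partial>M)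
        = (\<integral>\<^sup>+x. ?F (\<lambda>j. J j x, \<lambda>j. \<tau> j x) \<partial>M)"
      by (simp add: nexp_sum prod_ennreal)
    also have "\<dots> = (\<integral>\<^sup>+z. ?F z \<partial>distr M (?S \<Otimes>\<^sub>M ?T) (\<lambda>x. (\<lambda>j. J j x, \<lambda>j. \<tau> j x)))"
      by (subst nn_integral_distr) (auto intro!: measurable_Pair measurable_abs_UNIV)
    also have "\<dots> = (\<integral>\<^sup>+z. ?F z \<partial>(distr M ?S (\<lambda>x j. J j x) \<Otimes>\<^sub>M ?T))"
      by (simp only: indep)
    also have "\<dots> = (\<integral>\<^sup>+y. \<integral>\<^sup>+t. ?F (y, t) \<partial>?T \<partial>distr M ?S (\<lambda>x j. J j x))"
      by (rule PP.nn_integral_fst[symmetric]) measurable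
    also have "\<dots> = (\<integral>\<^sup>+x. \<integral>\<^sup>+t. ?F (\<lambda>j. J j x, t) \<partial>?T \<partial>M)"
      by (subst nn_integral_distr) (auto intro!: measurable_abs_UNIV PP.borel_measurable_nn_integral)
    also have "\<dots> = (\<integral>\<^sup>+x. (\<Prod>j<N. ennreal (G (J j x))) \<partial>M)"
    proof (intro nn_integral_cong)
      fix x
      have "(\<lambda>t. ennreal (nexp (f t (J j x)))) \<in> borel_measurable P" for j by measurable
      then show "(\<integral>\<^sup>+t. ?F (\<lambda>j. J j x, t) \<partial>?T) = (\<Prod>j<N. ennreal (G (J j x)))"
        using nn_integral_PiM_prod_coordinates[OF P, of N "\<lambda>j t. ennreal (nexp (f t (J j x)))"]
        by (simp add: G_nn)
    qed
    also have "\<dots> = (\<integral>\<^sup>+x. ennreal (nexp (\<Sum>j<N. l (J j x))) \<partial>M)"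
      by (simp add: nexp_sum l prod_ennreal G)
    finally show ?thesis .
  qed
  have lim: "(\<lambda>N. \<integral>\<^sup>+x. ennreal (nexp (\<Sum>j<N. g j x)) \<partial>M) \<longlonglongrightarrow>
      (\<integral>\<^sup>+x. ennreal (nexp (\<Sum>j. g j x)) \<partial>M)"
    if [measurable]: "\<And>j. g j \<in> borel_measurable M" for g :: "nat \<Rightarrow> _ \<Rightarrow> ennreal"
  proof (rule nn_integral_dominated_convergence[where w = "\<lambda>_. 1"])
    show "AE x in M. (\<lambda>N. ennreal (nexp (\<Sum>j<N. g j x))) \<longlonglongrightarrow> ennreal (nexp (\<Sum>j. g j x))"
      by (intro AE_I2 tendsto_ennrealI tendsto_nexp summable_LIMSEQ) simp
  qed (auto simp: emeasure_space_1)
  have "(\<integral>\<^sup>+x. ennreal (nexp (\<Sum>j. f (\<tau> j x) (J j x))) \<partial>M) =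
      (\<integral>\<^sup>+x. ennreal (nexp (\<Sum>j. l (J j x))) \<partial>M)"
  proof (rule LIMSEQ_unique)
    show "(\<lambda>N. \<integral>\<^sup>+x. ennreal (nexp (\<Sum>j<N. f (\<tau> j x) (J j x))) \<partial>M) \<longlonglongrightarrow>
        (\<integral>\<^sup>+x. ennreal (nexp (\<Sum>j. f (\<tau> j x) (J j x))) \<partial>M)"
      by (rule lim) measurable
    show "(\<lambda>N. \<integral>\<^sup>+x. ennreal (nexp (\<Sum>j<N. f (\<tau> j x) (J j x))) \<partial>M) \<longlonglongrightarrow>
        (\<integral>\<^sup>+x. ennreal (nexp (\<Sum>j. l (J j x))) \<partial>M)"
      unfolding fin by (rule lim) measurable
  qed
  also have "\<dots> = ennreal (nexp (\<integral>\<^sup>+s. ennreal (1 - nexp (l s)) \<partial>\<Lambda>))"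
    by (rule poisson_laplace_functional[OF J sets sf]) measurable
  finally show ?thesis
    unfolding l G_def .
qed

section \<open>Moments from Laplace transforms\<close>

text \<open>
  Each differentiation in one argument of a factorized joint Laplace transform brings down a factor
  \<open>- X c\<close> on one side and touches a single factor on the other. The induction is on the total number
  of differentiations.
\<close>

lemma laplace_moments_product:
  fixes X :: "'c \<Rightarrow> 'w \<Rightarrow> real" and L :: "'c \<Rightarrow> nat \<Rightarrow> real \<Rightarrow> real"
  assumes "prob_space M" and C: "finite C"
    and X [measurable]: "\<And>c. X c \<in> borel_measurable M" and X_nn: "\<And>c x. 0 \<le> X c x"
    and base: "\<And>u. (\<And>c. 0 < u c) \<Longrightarrow>
       (\<integral>x. exp (- (\<Sum>c\<in>C. u c * X c x)) \<partial>M) = (\<Prod>c\<in>C. L c 0 (u c))"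
    and deriv: "\<And>c n v. c \<in> C \<Longrightarrow> 0 < v \<Longrightarrow> (L c n has_real_derivative - L c (Suc n) v) (at v)"
    and u: "\<And>c. 0 < u c"
  shows "has_bochner_integral M (\<lambda>x. (\<Prod>c\<in>C. X c x ^ n c) * exp (- (\<Sum>c\<in>C. u c * X c x)))
           (\<Prod>c\<in>C. L c (n c) (u c))"
  using u
proof (induction "\<Sum>c\<in>C. n c" arbitrary: n u)
  case 0
  interpret prob_space M by fact
  have "\<And>c. c \<in> C \<Longrightarrow> n c = 0" using 0(1) C by simp
  moreover have "integrable M (\<lambda>x. exp (- (\<Sum>c\<in>C. u c * X c x)))"
    using 0(2) by (intro integrable_const_bound[where B = 1])
      (auto intro!: sum_nonneg mult_nonneg_nonneg X_nn simp: less_imp_le)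
  ultimately show ?case
    using base[OF 0(2)] by (simp add: has_bochner_integral_iff)
next
  case (Suc s)
  obtain c0 where c0: "c0 \<in> C" "n c0 \<noteq> 0"
    using Suc(2) by (metis sum.neutral nat.distinct(1))
  then obtain m where m: "n c0 = Suc m" using not0_implies_Suc by blast
  define n' where "n' = n(c0 := m)"
  have C_eq: "C = insert c0 (C - {c0})" and fin: "finite (C - {c0})" using c0 C by auto
  have "s = (\<Sum>c\<in>C. n' c)"
  proof -
    have "(\<Sum>c\<in>C. n c) = Suc m + (\<Sum>c\<in>C - {c0}. n c)"
      using C c0 by (simp add: sum.remove m)
    moreover have "(\<Sum>c\<in>C. n' c) = m + (\<Sum>c\<in>C - {c0}. n c)"
      using C c0 by (simp add: sum.remove n'_def)
    ultimately show ?thesis using Suc(2) by simp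
  qed
  note IH = Suc(1)[OF this]
  define W where "W x = (\<Prod>c\<in>C. X c x ^ n' c) * exp (- (\<Sum>c\<in>C - {c0}. u c * X c x))" for x
  define K where "K = (\<Prod>c\<in>C - {c0}. L c (n c) (u c))"
  have split: "(\<Prod>c\<in>C. X c x ^ n' c) * exp (- (\<Sum>c\<in>C. (u(c0 := v)) c * X c x)) =
      W x * exp (- (v * X c0 x))" for x v
    unfolding W_def using C c0 by (simp add: sum.remove flip: exp_add)
  have val: "has_bochner_integral M (\<lambda>x. W x * exp (- (v * X c0 x))) (K * L c0 m v)"
    if "v > 0" for v
  proof -
    have "(\<Prod>c\<in>C. L c (n' c) ((u(c0 := v)) c)) = K * L c0 m v"
      unfolding K_def using C c0 by (simp add: prod.remove n'_def)
    then show ?thesis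
      using IH[of "u(c0 := v)"] Suc(3) that unfolding split by simp
  qed
  have [measurable]: "W \<in> borel_measurable M" unfolding W_def by measurable
  have int: "integrable M (\<lambda>x. W x * exp (- (v * X c0 x)))" if "v > 0" for v
    using val[OF that] by (simp add: has_bochner_integral_iff)
  have "((\<lambda>v. \<integral>x. W x * exp (- (v * X c0 x)) \<partial>M) has_real_derivative
           - (\<integral>x. W x * X c0 x * exp (- (u c0 * X c0 x)) \<partial>M)) (at (u c0))"
    using int Suc(3) X_nn by (intro laplace_transform_derivative) auto
  moreover have "\<forall>\<^sub>F v in nhds (u c0). (\<integral>x. W x * exp (- (v * X c0 x)) \<partial>M) = K * L c0 m v"
    using eventually_nhds_in_open[of "{0<..}" "u c0"] Suc(3)[of c0]
    by (auto elim!: eventually_mono dest!: val simp: has_bochner_integral_iff)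
  ultimately have "((\<lambda>v. K * L c0 m v) has_real_derivative
           - (\<integral>x. W x * X c0 x * exp (- (u c0 * X c0 x)) \<partial>M)) (at (u c0))"
    by (simp add: DERIV_cong_ev[OF refl _ refl])
  moreover have "((\<lambda>v. K * L c0 m v) has_real_derivative K * - L c0 (Suc m) (u c0)) (at (u c0))"
    by (intro DERIV_cmult deriv c0 Suc(3))
  ultimately have "(\<integral>x. W x * X c0 x * exp (- (u c0 * X c0 x)) \<partial>M) = K * L c0 (Suc m) (u c0)"
    using DERIV_unique by fastforce
  moreover have "integrable M (\<lambda>x. W x * X c0 x * exp (- (u c0 * X c0 x)))"
    using int Suc(3) X_nn by (intro laplace_transform_derivative) auto
  moreover have "W x * X c0 x * exp (- (u c0 * X c0 x)) =
      (\<Prod>c\<in>C. X c x ^ n c) * exp (- (\<Sum>c\<in>C. u c * X c x))" for x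
  proof -
    have "(\<Prod>c\<in>C. X c x ^ n' c) * X c0 x = (\<Prod>c\<in>C. X c x ^ n c)"
      using C c0 by (simp add: prod.remove n'_def m)
    then have "(\<Prod>c\<in>C. X c x ^ n c) * exp (- (\<Sum>c\<in>C. u c * X c x)) =
        (\<Prod>c\<in>C. X c x ^ n' c) * X c0 x * exp (- (\<Sum>c\<in>C. u c * X c x))"
      by (simp only:)
    also have "\<dots> = ((\<Prod>c\<in>C. X c x ^ n' c) * exp (- (\<Sum>c\<in>C. u c * X c x))) * X c0 x"
      by (simp only: mult_ac)
    also have "\<dots> = W x * exp (- (u c0 * X c0 x)) * X c0 x"
      using split[of x "u c0"] by simp
    finally show ?thesis by (simp only: mult_ac)
  qed
  moreover have "(\<Prod>c\<in>C. L c (n c) (u c)) = K * L c0 (Suc m) (u c0)"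
    using C c0 by (simp add: K_def prod.remove m)
  ultimately show ?case by (simp add: has_bochner_integral_iff)
qed

text \<open>
  A class of functions that contains every \<open>r\<close> that occurs when the \<open>n\<close>-th derivative of \<open>exp (- p \<psi>(u))\<close>
  is written, up to sign, as \<open>exp (- p \<psi>(u)) (p \<beta>\<^sub>n(u) + p\<^sup>2 r(p, u))\<close>: polynomials in \<open>p\<close> and the \<open>\<beta>\<^sub>n\<close>. What counts
  is that they are closed under differentiation in \<open>u\<close> and bounded in \<open>p \<in> [0, 1]\<close>.
\<close>

inductive_set remainders :: "(nat \<Rightarrow> real \<Rightarrow> real) \<Rightarrow> (real \<Rightarrow> real \<Rightarrow> real) set"
  for \<beta> :: "nat \<Rightarrow> real \<Rightarrow> real" where
  const: "(\<lambda>p u. c) \<in> remainders \<beta>"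
| param: "(\<lambda>p u. p) \<in> remainders \<beta>"
| mom: "n \<ge> 1 \<Longrightarrow> (\<lambda>p u. \<beta> n u) \<in> remainders \<beta>"
| add: "f \<in> remainders \<beta> \<Longrightarrow> g \<in> remainders \<beta> \<Longrightarrow> (\<lambda>p u. f p u + g p u) \<in> remainders \<beta>"
| mult: "f \<in> remainders \<beta> \<Longrightarrow> g \<in> remainders \<beta> \<Longrightarrow> (\<lambda>p u. f p u * g p u) \<in> remainders \<beta>"

lemma remainders_deriv:
  assumes \<beta>: "\<And>n u. n \<ge> 1 \<Longrightarrow> u > 0 \<Longrightarrow> (\<beta> n has_real_derivative - \<beta> (Suc n) u) (at u)"
    and "g \<in> remainders \<beta>"
  shows "\<exists>g'\<in>remainders \<beta>. \<forall>p. \<forall>u>0. (g p has_real_derivative g' p u) (at u)"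
  using assms(2)
proof induction
  case (const c)
  then show ?case by (intro bexI[OF _ remainders.const[of 0]]) auto
next
  case param
  then show ?case by (intro bexI[OF _ remainders.const[of 0]]) auto
next
  case (mom n)
  have "(\<lambda>p u. - 1 * \<beta> (Suc n) u) \<in> remainders \<beta>"
    by (intro remainders.mult[OF remainders.const remainders.mom]) simp
  then show ?case using \<beta>[OF mom] by (intro bexI[rotated]) auto
next
  case (add f g)
  then obtain f' g' where *: "f' \<in> remainders \<beta>" "g' \<in> remainders \<beta>"
    "\<And>p u. u > 0 \<Longrightarrow> (f p has_real_derivative f' p u) (at u)"
    "\<And>p u. u > 0 \<Longrightarrow> (g p has_real_derivative g' p u) (at u)" by blast
  show ?case
    by (rule bexI[OF _ remainders.add[OF *(1,2)]]) (auto intro!: DERIV_add *(3,4))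
next
  case (mult f g)
  then obtain f' g' where *: "f' \<in> remainders \<beta>" "g' \<in> remainders \<beta>"
    "\<And>p u. u > 0 \<Longrightarrow> (f p has_real_derivative f' p u) (at u)"
    "\<And>p u. u > 0 \<Longrightarrow> (g p has_real_derivative g' p u) (at u)" by blast
  have "(\<lambda>p u. f' p u * g p u + g' p u * f p u) \<in> remainders \<beta>"
    by (intro remainders.add remainders.mult * mult.hyps)
  then show ?case
    by (intro bexI[rotated]) (auto intro!: DERIV_mult *(3,4))
qed

lemma remainders_bounded:
  assumes "g \<in> remainders \<beta>"
  shows "\<exists>C. \<forall>p\<in>{0..1}. \<bar>g p u\<bar> \<le> C"
  using assms
proof induction
  case (add f g)
  then obtain C D where CD: "\<forall>p\<in>{0..1}. \<bar>f p u\<bar> \<le> C" "\<forall>p\<in>{0..1}. \<bar>g p u\<bar> \<le> D" by blast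
  show ?case
  proof (intro exI ballI)
    fix p :: real assume "p \<in> {0..1}"
    then show "\<bar>f p u + g p u\<bar> \<le> C + D" using CD by (meson abs_triangle_ineq add_mono order_trans)
  qed
next
  case (mult f g)
  then obtain C D where CD: "\<forall>p\<in>{0..1}. \<bar>f p u\<bar> \<le> C" "\<forall>p\<in>{0..1}. \<bar>g p u\<bar> \<le> D" by blast
  show ?case
  proof (intro exI ballI)
    fix p :: real assume p: "p \<in> {0..1}"
    then have "0 \<le> C" using CD(1) abs_ge_zero order_trans by blast
    then show "\<bar>f p u * g p u\<bar> \<le> C * D"
      using CD p by (auto simp: abs_mult intro!: mult_mono)
  qed
qed (auto intro: exI[of _ 1])

text \<open>
  \<open>L n p\<close> is \<open>(- 1) ^ n\<close> times the \<open>n\<close>-th derivative of \<open>exp (- p \<psi>)\<close>. Differentiating the form above, the term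
  of first order in \<open>p\<close> moves from \<open>\<beta>\<^sub>n\<close> to \<open>\<beta>\<^sub>n\<^sub>+\<^sub>1\<close>, since \<open>\<psi>' = \<beta>\<^sub>1\<close> carries another factor \<open>p\<close>; everything
  else is collected in the next remainder.
\<close>

lemma exponential_family_expansion:
  fixes \<psi> :: "real \<Rightarrow> real" and \<beta> :: "nat \<Rightarrow> real \<Rightarrow> real"
  assumes \<psi>: "\<And>u. u > 0 \<Longrightarrow> (\<psi> has_real_derivative \<beta> 1 u) (at u)"
    and \<beta>: "\<And>n u. n \<ge> 1 \<Longrightarrow> u > 0 \<Longrightarrow> (\<beta> n has_real_derivative - \<beta> (Suc n) u) (at u)"
  obtains L :: "nat \<Rightarrow> real \<Rightarrow> real \<Rightarrow> real" where
    "\<And>p u. L 0 p u = exp (- (p * \<psi> u))"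
    "\<And>n p u. u > 0 \<Longrightarrow> (L n p has_real_derivative - L (Suc n) p u) (at u)"
    "\<And>n u. n \<ge> 1 \<Longrightarrow> u > 0 \<Longrightarrow>
       \<exists>C. \<forall>p\<in>{0..1}. \<bar>exp (p * \<psi> u) * L n p u - \<beta> n u * p\<bar> \<le> C * p\<^sup>2"
proof -
  \<comment> \<open>\<open>r k\<close> belongs to the derivative of order \<open>k + 1\<close>; in order 1 there is no remainder.\<close>
  let ?P = "\<lambda>(n :: nat) r. r \<in> remainders \<beta> \<and> (n = 0 \<longrightarrow> r = (\<lambda>p u. 0))"
  let ?Q = "\<lambda>(k :: nat) r r'. \<forall>p. \<forall>u>0. (r p has_real_derivative
     (\<beta> 1 u * \<beta> (Suc k) u + p * \<beta> 1 u * r p u - r' p u)) (at u)"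
  have "\<exists>r. \<forall>k. ?P k (r k) \<and> ?Q k (r k) (r (Suc k))"
  proof (rule dependent_nat_choice)
    show "\<exists>r. ?P 0 r" using remainders.const[of 0 \<beta>] by auto
    fix r k assume "?P k r"
    then have r: "r \<in> remainders \<beta>" by simp
    then obtain r' where r': "r' \<in> remainders \<beta>"
      "\<And>p u. u > 0 \<Longrightarrow> (r p has_real_derivative r' p u) (at u)"
      using remainders_deriv[where \<beta> = \<beta> and g = r, OF \<beta> r] by blast
    have "(\<lambda>p u. (\<beta> 1 u * \<beta> (Suc k) u + p * \<beta> 1 u * r p u) + (- 1) * r' p u) \<in> remainders \<beta>"
      by (intro remainders.intros r r') auto
    then show "\<exists>r''. ?P (Suc k) r'' \<and> ?Q k r r''"
      using r'(2)
      by (intro exI[of _ "\<lambda>p u. (\<beta> 1 u * \<beta> (Suc k) u + p * \<beta> 1 u * r p u) + (- 1) * r' p u"]) auto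
  qed
  then obtain r where r: "\<And>k. r k \<in> remainders \<beta>" "r 0 = (\<lambda>p u. 0)"
    "\<And>k p u. u > 0 \<Longrightarrow> (r k p has_real_derivative
     (\<beta> 1 u * \<beta> (Suc k) u + p * \<beta> 1 u * r k p u - r (Suc k) p u)) (at u)" by metis
  define L where "L n p u = exp (- (p * \<psi> u)) *
     (case n of 0 \<Rightarrow> 1 | Suc k \<Rightarrow> p * \<beta> (Suc k) u + p\<^sup>2 * r k p u)" for n p u
  show thesis
  proof
    show "L 0 p u = exp (- (p * \<psi> u))" for p u by (simp add: L_def)
    show "(L n p has_real_derivative - L (Suc n) p u) (at u)" if u: "u > 0" for n p u
    proof (cases n)
      case 0
      show ?thesis
        unfolding 0 L_def[abs_def] using r(2)
        by (auto intro!: derivative_eq_intros \<psi>[OF u])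
    next
      case (Suc k)
      show ?thesis
        unfolding Suc L_def[abs_def] nat.case
        by (rule derivative_eq_intros \<psi>[OF u] \<beta> r(3) u refl | simp)+
           (simp add: algebra_simps power2_eq_square)
    qed
    show "\<exists>C. \<forall>p\<in>{0..1}. \<bar>exp (p * \<psi> u) * L n p u - \<beta> n u * p\<bar> \<le> C * p\<^sup>2"
      if n: "n \<ge> 1" and "u > 0" for n u
    proof -
      obtain k where k: "n = Suc k" using n by (cases n) auto
      obtain C where C: "\<forall>p\<in>{0..1}. \<bar>r k p u\<bar> \<le> C" using remainders_bounded[OF r(1)] by blast
      have "exp (p * \<psi> u) * L n p u - \<beta> n u * p = r k p u * p\<^sup>2" for p
      proof -
        have "exp (p * \<psi> u) * exp (- (p * \<psi> u)) = 1" by (simp flip: exp_add)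
        then have "exp (p * \<psi> u) * L n p u = p * \<beta> (Suc k) u + p\<^sup>2 * r k p u"
          unfolding L_def k by (simp flip: mult.assoc)
        then show ?thesis by (simp add: k algebra_simps)
      qed
      then show ?thesis using C by (auto intro!: exI[of _ C] mult_right_mono simp: abs_mult)
    qed
  qed
qed

section \<open>Sums over injective labellings\<close>

lemma sum_PiE_coincident:
  fixes p :: "'c \<Rightarrow> real"
  assumes A: "finite A" "B \<in> A" "B' \<in> A" "B \<noteq> B'" and N: "finite N" "(\<Sum>c\<in>N. p c) = 1"
  shows "(\<Sum>c\<in>{c \<in> A \<rightarrow>\<^sub>E N. c B = c B'}. \<Prod>D\<in>A. p (c D)) = (\<Sum>z\<in>N. (p z)\<^sup>2)"
proof -
  let ?F = "\<lambda>z D. if D \<in> {B, B'} then {z} else N"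
  have "{c \<in> A \<rightarrow>\<^sub>E N. c B = c B'} = (\<Union>z\<in>N. PiE A (?F z))"
    using A(2,3) by (auto simp: PiE_iff extensional_def split: if_splits) metis+
  also have "(\<Sum>c\<in>\<dots>. \<Prod>D\<in>A. p (c D)) = (\<Sum>z\<in>N. \<Sum>c\<in>PiE A (?F z). \<Prod>D\<in>A. p (c D))"
  proof (rule sum.UNION_disjoint)
    show "\<forall>z\<in>N. finite (PiE A (?F z))" using A N by (auto intro!: finite_PiE)
    show "\<forall>z\<in>N. \<forall>z'\<in>N. z \<noteq> z' \<longrightarrow> PiE A (?F z) \<inter> PiE A (?F z') = {}"
      using A(2) by (auto simp: PiE_iff split: if_splits) metis+
  qed fact
  also have "\<dots> = (\<Sum>z\<in>N. \<Prod>D\<in>A. \<Sum>c\<in>?F z D. p c)"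
    using A N by (subst prod_sum_PiE) auto
  also have "\<dots> = (\<Sum>z\<in>N. (p z)\<^sup>2)"
  proof (intro sum.cong refl)
    fix z
    have "(\<Prod>D\<in>A. \<Sum>c\<in>?F z D. p c) = (\<Prod>D\<in>{B, B'}. \<Sum>c\<in>?F z D. p c)"
      using A N by (intro prod.mono_neutral_right) auto
    then show "(\<Prod>D\<in>A. \<Sum>c\<in>?F z D. p c) = (p z)\<^sup>2"
      using A by (simp add: power2_eq_square)
  qed
  finally show ?thesis .
qed

text \<open>
  The sum over all labellings factorizes and tends to the product of the \<open>\<beta> B\<close>. A labelling
  that is not injective gives two blocks the same value, and by \<open>sum_PiE_coincident\<close> these labellings
  contribute at most a constant times the sum of the squared masses.
\<close>

lemma injective_sum_limit:
  fixes p :: "nat \<Rightarrow> 'c \<Rightarrow> real" and h :: "'b \<Rightarrow> real \<Rightarrow> real"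
  assumes A: "finite A" and N: "\<And>m. finite (N m)"
    and p: "\<And>m c. 0 \<le> p m c" "\<And>m. (\<Sum>c\<in>N m. p m c) = 1"
    and sq: "(\<lambda>m. \<Sum>c\<in>N m. (p m c)\<^sup>2) \<longlonglongrightarrow> 0"
    and h: "\<And>B. B \<in> A \<Longrightarrow> \<exists>C. \<forall>q\<in>{0..1}. \<bar>h B q - \<beta> B * q\<bar> \<le> C * q\<^sup>2"
  shows "(\<lambda>m. \<Sum>c\<in>{c \<in> A \<rightarrow>\<^sub>E N m. inj_on c A}. \<Prod>B\<in>A. h B (p m (c B))) \<longlonglongrightarrow> (\<Prod>B\<in>A. \<beta> B)"
proof -
  obtain C where C: "\<And>B q. B \<in> A \<Longrightarrow> q \<in> {0..1} \<Longrightarrow> \<bar>h B q - \<beta> B * q\<bar> \<le> C B * q\<^sup>2"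
    using h by metis
  let ?s = "\<lambda>m. \<Sum>c\<in>N m. (p m c)\<^sup>2"
  have p1: "p m c \<in> {0..1}" if "c \<in> N m" for m c
    using member_le_sum[of c "N m" "p m"] p N that by auto
  let ?all = "\<lambda>m. \<Sum>c\<in>A \<rightarrow>\<^sub>E N m. \<Prod>B\<in>A. h B (p m (c B))"
  let ?non = "\<lambda>m. \<Sum>c\<in>{c \<in> A \<rightarrow>\<^sub>E N m. \<not> inj_on c A}. \<Prod>B\<in>A. h B (p m (c B))"
  have finPi: "finite (A \<rightarrow>\<^sub>E N m)" for m using A N by (intro finite_PiE) auto
  have all: "?all \<longlonglongrightarrow> (\<Prod>B\<in>A. \<beta> B)"
  proof -
    have "(\<lambda>m. \<Prod>B\<in>A. \<Sum>c\<in>N m. h B (p m c)) \<longlonglongrightarrow> (\<Prod>B\<in>A. \<beta> B)"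
    proof (rule tendsto_prod)
      fix B assume B: "B \<in> A"
      have b: "\<bar>(\<Sum>c\<in>N m. h B (p m c)) - \<beta> B\<bar> \<le> C B * ?s m" for m
      proof -
        have "(\<Sum>c\<in>N m. h B (p m c)) - \<beta> B = (\<Sum>c\<in>N m. h B (p m c) - \<beta> B * p m c)"
          by (simp add: sum_subtractf p(2) flip: sum_distrib_left)
        also have "\<bar>\<dots>\<bar> \<le> (\<Sum>c\<in>N m. \<bar>h B (p m c) - \<beta> B * p m c\<bar>)"
          by (rule sum_abs)
        also have "\<dots> \<le> (\<Sum>c\<in>N m. C B * (p m c)\<^sup>2)"
          by (intro sum_mono C B p1)
        finally show ?thesis by (simp add: sum_distrib_left)
      qed
      have "(\<lambda>m. C B * ?s m) \<longlonglongrightarrow> 0"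
        using tendsto_mult_right_zero[OF sq] .
      then have "(\<lambda>m. (\<Sum>c\<in>N m. h B (p m c)) - \<beta> B) \<longlonglongrightarrow> 0"
        by (rule Lim_null_comparison[rotated])
           (intro always_eventually allI, unfold real_norm_def, rule b)
      then show "(\<lambda>m. \<Sum>c\<in>N m. h B (p m c)) \<longlonglongrightarrow> \<beta> B"
        by (simp add: LIM_zero_iff)
    qed
    then show ?thesis using A N by (simp add: prod_sum_PiE)
  qed
  define K where "K = (\<Prod>B\<in>A. \<bar>\<beta> B\<bar> + \<bar>C B\<bar>)"
  have prod_bound: "\<bar>\<Prod>B\<in>A. h B (p m (c B))\<bar> \<le> K * (\<Prod>B\<in>A. p m (c B))"
    if "c \<in> A \<rightarrow>\<^sub>E N m" for m c
  proof -
    have "\<bar>h B (p m (c B))\<bar> \<le> (\<bar>\<beta> B\<bar> + \<bar>C B\<bar>) * p m (c B)" if B: "B \<in> A" for B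
    proof -
      let ?q = "p m (c B)"
      have q: "?q \<in> {0..1}" using p1 B \<open>c \<in> A \<rightarrow>\<^sub>E N m\<close> by (auto simp: PiE_iff)
      have "\<bar>h B ?q - \<beta> B * ?q\<bar> \<le> C B * ?q\<^sup>2" by (rule C[OF B q])
      also have "\<dots> \<le> \<bar>C B\<bar> * ?q\<^sup>2" by (intro mult_right_mono) auto
      also have "\<dots> \<le> \<bar>C B\<bar> * ?q"
        using q by (intro mult_left_mono) (auto simp: power2_eq_square mult_left_le)
      finally have "\<bar>h B ?q - \<beta> B * ?q\<bar> \<le> \<bar>C B\<bar> * ?q" .
      moreover have "\<bar>\<beta> B * ?q\<bar> = \<bar>\<beta> B\<bar> * ?q" using q by (simp add: abs_mult)
      ultimately show ?thesis by (simp add: distrib_right)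
    qed
    then have "(\<Prod>B\<in>A. \<bar>h B (p m (c B))\<bar>) \<le> (\<Prod>B\<in>A. (\<bar>\<beta> B\<bar> + \<bar>C B\<bar>) * p m (c B))"
      by (intro prod_mono) auto
    then show ?thesis by (simp add: abs_prod prod.distrib K_def)
  qed
  have K: "0 \<le> K" unfolding K_def by (intro prod_nonneg) auto
  have b: "\<bar>?non m\<bar> \<le> K * (real (card (A \<times> A)) * ?s m)" for m
  proof -
    let ?pairs = "{(B, B') \<in> A \<times> A. B \<noteq> B'}"
    let ?S = "\<lambda>(B, B'). {c \<in> A \<rightarrow>\<^sub>E N m. c B = c B'}"
    have fin: "finite ?pairs" by (rule finite_subset[of _ "A \<times> A"]) (use A in auto)
    have "\<bar>?non m\<bar> \<le> (\<Sum>c\<in>{c \<in> A \<rightarrow>\<^sub>E N m. \<not> inj_on c A}. K * (\<Prod>B\<in>A. p m (c B)))"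
      by (intro order.trans[OF sum_abs] sum_mono prod_bound) auto
    also have "\<dots> \<le> (\<Sum>c\<in>(\<Union>x\<in>?pairs. ?S x). K * (\<Prod>B\<in>A. p m (c B)))"
    proof (rule sum_mono2)
      show "finite (\<Union>x\<in>?pairs. ?S x)"
        by (rule finite_subset[OF _ finPi[of m]]) auto
      show "{c \<in> A \<rightarrow>\<^sub>E N m. \<not> inj_on c A} \<subseteq> (\<Union>x\<in>?pairs. ?S x)"
        by (auto simp: inj_on_def)
    qed (auto intro!: mult_nonneg_nonneg prod_nonneg K p)
    also have "\<dots> \<le> (\<Sum>x\<in>?pairs. \<Sum>c\<in>?S x. K * (\<Prod>B\<in>A. p m (c B)))"
    proof -
      have finS: "finite (?S x)" for x
        by (rule finite_subset[OF _ finPi[of m]]) auto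
      have "(\<Union>x\<in>?pairs. ?S x) = snd ` (SIGMA x:?pairs. ?S x)" by force
      also have "(\<Sum>c\<in>\<dots>. K * (\<Prod>B\<in>A. p m (c B))) \<le>
          (\<Sum>y\<in>(SIGMA x:?pairs. ?S x). K * (\<Prod>B\<in>A. p m (snd y B)))"
        using sum_image_le[of "SIGMA x:?pairs. ?S x" "\<lambda>c. K * (\<Prod>B\<in>A. p m (c B))" snd] fin finS K p
        by (simp add: comp_def prod_nonneg finite_SigmaI)
      also have "\<dots> = (\<Sum>x\<in>?pairs. \<Sum>c\<in>?S x. K * (\<Prod>B\<in>A. p m (c B)))"
        using fin finS by (subst sum.Sigma) (auto simp: case_prod_beta)
      finally show ?thesis .
    qed
    also have "\<dots> = (\<Sum>x\<in>?pairs. K * ?s m)"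
      using A N p by (intro sum.cong refl) (auto simp: sum_PiE_coincident simp flip: sum_distrib_left)
    also have "\<dots> = K * (real (card ?pairs) * ?s m)"
      by simp
    also have "\<dots> \<le> K * (real (card (A \<times> A)) * ?s m)"
      using A by (intro mult_left_mono mult_right_mono of_nat_mono card_mono K sum_nonneg) auto
    finally show ?thesis .
  qed
  have "(\<lambda>m. K * (real (card (A \<times> A)) * ?s m)) \<longlonglongrightarrow> 0"
    by (intro tendsto_mult_right_zero sq)
  then have non: "?non \<longlonglongrightarrow> 0"
    by (rule Lim_null_comparison[rotated])
       (intro always_eventually allI, unfold real_norm_def, rule b)
  have "?all m = (\<Sum>c\<in>{c \<in> A \<rightarrow>\<^sub>E N m. inj_on c A}. \<Prod>B\<in>A. h B (p m (c B))) + ?non m" for m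
  proof -
    have "A \<rightarrow>\<^sub>E N m = {c \<in> A \<rightarrow>\<^sub>E N m. inj_on c A} \<union> {c \<in> A \<rightarrow>\<^sub>E N m. \<not> inj_on c A}" by auto
    then show ?thesis
      using finPi[of m] by (subst sum.union_disjoint[symmetric]) auto
  qed
  then have "(\<Sum>c\<in>{c \<in> A \<rightarrow>\<^sub>E N m. inj_on c A}. \<Prod>B\<in>A. h B (p m (c B))) = ?all m - ?non m" for m
    by simp
  then show ?thesis
    using tendsto_diff[OF all non] by simp
qed

text \<open>
  \<open>(\<kappa> q)\<^sub>n\<close> is \<open>\<kappa> q\<close> times a polynomial in \<open>q\<close> with constant term \<open>(n - 1)! = \<Gamma>(n)\<close>.
\<close>

lemma pochhammer_linear_expansion:
  fixes \<kappa> :: real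
  assumes "n \<ge> 1"
  shows "\<exists>C. \<forall>q\<in>{0..1}. \<bar>pochhammer (\<kappa> * q) n - \<kappa> * Gamma (real n) * q\<bar> \<le> C * q\<^sup>2"
  using assms
proof (induction n rule: dec_induct)
  case base
  show ?case by (intro exI[of _ 0]) simp
next
  case (step n)
  then obtain C where C: "\<And>q. q \<in> {0..1} \<Longrightarrow> \<bar>pochhammer (\<kappa> * q) n - \<kappa> * Gamma (real n) * q\<bar> \<le> C * q\<^sup>2"
    by blast
  have G: "Gamma (real (Suc n)) = real n * Gamma (real n)"
  proof -
    have "real n \<notin> \<int>\<^sub>\<le>\<^sub>0" using step.hyps(1) by (auto elim!: nonpos_Ints_cases)
    then show ?thesis by (simp add: Gamma_plus1[symmetric] add.commute)
  qed
  show ?case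
  proof (intro exI ballI)
    fix q :: real assume q: "q \<in> {0..1}"
    let ?d = "pochhammer (\<kappa> * q) n - \<kappa> * Gamma (real n) * q"
    have "pochhammer (\<kappa> * q) (Suc n) - \<kappa> * Gamma (real (Suc n)) * q =
        ?d * (\<kappa> * q + real n) + \<kappa>\<^sup>2 * Gamma (real n) * q\<^sup>2"
      unfolding G by (simp add: pochhammer_Suc algebra_simps power2_eq_square)
    also have "\<bar>\<dots>\<bar> \<le> \<bar>?d * (\<kappa> * q + real n)\<bar> + \<bar>\<kappa>\<^sup>2 * Gamma (real n) * q\<^sup>2\<bar>"
      by (rule abs_triangle_ineq)
    also have "\<bar>?d * (\<kappa> * q + real n)\<bar> \<le> (C * q\<^sup>2) * (\<bar>\<kappa>\<bar> + real n)"
    proof -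
      have "\<bar>\<kappa> * q + real n\<bar> \<le> \<bar>\<kappa>\<bar> * 1 + real n"
        using q by (intro order.trans[OF abs_triangle_ineq] add_mono) (auto simp: abs_mult mult_left_le)
      then show ?thesis
        unfolding abs_mult using C[OF q] by (intro mult_mono) (auto intro: order.trans[OF abs_ge_zero])
    qed
    also have "\<bar>\<kappa>\<^sup>2 * Gamma (real n) * q\<^sup>2\<bar> = \<bar>\<kappa>\<^sup>2 * Gamma (real n)\<bar> * q\<^sup>2"
      by (simp add: abs_mult)
    finally show "\<bar>pochhammer (\<kappa> * q) (Suc n) - \<kappa> * Gamma (real (Suc n)) * q\<bar>
        \<le> (C * (\<bar>\<kappa>\<bar> + real n) + \<bar>\<kappa>\<^sup>2 * Gamma (real n)\<bar>) * q\<^sup>2"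
      by (simp add: algebra_simps)
  qed
qed

section \<open>Tie patterns and codes of points\<close>

lemma tie_partition_eq_iff:
  assumes "partition_on {1..n} \<A>"
  shows "tie_partition n \<theta> = \<A> \<longleftrightarrow>
    (\<forall>i\<in>{1..n}. \<forall>j\<in>{1..n}. \<theta> i = \<theta> j \<longleftrightarrow> (\<exists>B\<in>\<A>. i \<in> B \<and> j \<in> B))"
proof -
  define R where "R = {(i, j). i \<in> {1..n} \<and> j \<in> {1..n} \<and> \<theta> i = \<theta> j}"
  define S where "S = {(i, j). \<exists>B\<in>\<A>. i \<in> B \<and> j \<in> B}"
  have R: "equiv {1..n} R"
    by (rule equivI) (auto simp: R_def refl_on_def sym_def trans_def)
  have S: "equiv {1..n} S" and SA: "{1..n} // S = \<A>"
    using equiv_partition_on[OF assms] partition_on_eq_quotient[OF assms] by (simp_all add: S_def)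
  have "R = S" if "{1..n} // R = {1..n} // S"
  proof -
    have "(i, j) \<in> E \<longleftrightarrow> (\<exists>X\<in>{1..n} // E. i \<in> X \<and> j \<in> X)" if "equiv {1..n} E" for E and i j
    proof
      assume ij: "(i, j) \<in> E"
      then have i: "i \<in> {1..n}" using equiv_type[OF \<open>equiv {1..n} E\<close>] by blast
      then have "i \<in> E `` {i}" by (rule equiv_class_self[OF \<open>equiv {1..n} E\<close>])
      then show "\<exists>X\<in>{1..n} // E. i \<in> X \<and> j \<in> X" using ij quotientI[OF i, of E] by blast
    next
      assume "\<exists>X\<in>{1..n} // E. i \<in> X \<and> j \<in> X"
      then show "(i, j) \<in> E" using in_quotient_imp_in_rel[OF \<open>equiv {1..n} E\<close>] by blast
    qed
    note this[OF R] this[OF S]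
    then have "(i, j) \<in> R \<longleftrightarrow> (i, j) \<in> S" for i j
      using \<open>{1..n} // R = {1..n} // S\<close> by simp
    then show ?thesis by auto
  qed
  then have "tie_partition n \<theta> = \<A> \<longleftrightarrow> R = S"
    unfolding tie_partition_def using SA by (auto simp: R_def)
  also have "\<dots> \<longleftrightarrow> (\<forall>i\<in>{1..n}. \<forall>j\<in>{1..n}. (i, j) \<in> R \<longleftrightarrow> (i, j) \<in> S)"
    using R S by (auto simp: equiv_def refl_on_def)
  finally show ?thesis by (simp add: R_def S_def)
qed

lemma partition_block:
  assumes "partition_on I \<A>"
  obtains blk where "\<And>i. i \<in> I \<Longrightarrow> blk i \<in> \<A>" "\<And>i B. i \<in> B \<Longrightarrow> B \<in> \<A> \<Longrightarrow> blk i = B"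
    "\<And>i. i \<in> I \<Longrightarrow> i \<in> blk i"
proof -
  have ex: "\<exists>!B. B \<in> \<A> \<and> i \<in> B" if "i \<in> I" for i
  proof -
    have "i \<in> \<Union>\<A>" using assms that by (simp add: partition_on_def)
    then obtain B where B: "B \<in> \<A>" "i \<in> B" by (rule UnionE)
    have "disjoint \<A>" using assms by (simp add: partition_on_def)
    then have "B' = B" if "B' \<in> \<A>" "i \<in> B'" for B'
      using B that by (metis disjointD disjoint_iff)
    then show ?thesis using B by blast
  qed
  show thesis
  proof (rule that[of "\<lambda>i. THE B. B \<in> \<A> \<and> i \<in> B"])
    fix i assume "i \<in> I"
    then show "(THE B. B \<in> \<A> \<and> i \<in> B) \<in> \<A>" "i \<in> (THE B. B \<in> \<A> \<and> i \<in> B)"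
      using theI'[OF ex] by blast+
  next
    fix i B assume "i \<in> B" "B \<in> \<A>"
    moreover then have "i \<in> I" using assms by (auto simp: partition_on_def)
    ultimately show "(THE B. B \<in> \<A> \<and> i \<in> B) = B"
      using ex by (intro the1_equality) auto
  qed
qed

text \<open>
  A function on \<open>{1..n}\<close> with tie pattern \<open>\<A>\<close> is the same as an injective labelling of the blocks of \<open>\<A>\<close>.
\<close>

lemma sum_tie_functions:
  fixes w :: "'c \<Rightarrow> real"
  assumes \<A>: "partition_on {1..n} \<A>"
  shows "(\<Sum>g\<in>{g \<in> {1..n} \<rightarrow>\<^sub>E N. tie_partition n g = \<A>}. \<Prod>i\<in>{1..n}. w (g i))
    = (\<Sum>c\<in>{c \<in> \<A> \<rightarrow>\<^sub>E N. inj_on c \<A>}. \<Prod>B\<in>\<A>. w (c B) ^ card B)"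
proof -
  obtain blk where blk: "\<And>i. i \<in> {1..n} \<Longrightarrow> blk i \<in> \<A>" "\<And>i B. i \<in> B \<Longrightarrow> B \<in> \<A> \<Longrightarrow> blk i = B"
    "\<And>i. i \<in> {1..n} \<Longrightarrow> i \<in> blk i"
    using partition_block[OF \<A>] by metis
  have union: "\<Union>\<A> = {1..n}" and dis: "disjoint \<A>" and ne: "\<And>B. B \<in> \<A> \<Longrightarrow> B \<noteq> {}"
    using \<A> by (auto simp: partition_on_def)
  have sub: "i \<in> {1..n}" if "i \<in> B" "B \<in> \<A>" for i B using that union by blast
  have rep: "(SOME i. i \<in> B) \<in> B" if "B \<in> \<A>" for B using ne[OF that] by (simp add: some_in_eq)
  have same: "(\<exists>B\<in>\<A>. i \<in> B \<and> j \<in> B) \<longleftrightarrow> blk i = blk j" if "i \<in> {1..n}" "j \<in> {1..n}" for i j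
    using blk that by metis
  show ?thesis
  proof (rule sum.reindex_bij_witness[where
        i = "\<lambda>c. \<lambda>i\<in>{1..n}. c (blk i)" and j = "\<lambda>g. \<lambda>B\<in>\<A>. g (SOME i. i \<in> B)"])
    fix g assume "g \<in> {g \<in> {1..n} \<rightarrow>\<^sub>E N. tie_partition n g = \<A>}"
    then have g: "g \<in> {1..n} \<rightarrow>\<^sub>E N"
      and "\<forall>i\<in>{1..n}. \<forall>j\<in>{1..n}. g i = g j \<longleftrightarrow> (\<exists>B\<in>\<A>. i \<in> B \<and> j \<in> B)"
      unfolding mem_Collect_eq tie_partition_eq_iff[OF \<A>] by blast+
    then have tie: "g i = g j \<longleftrightarrow> blk i = blk j" if "i \<in> {1..n}" "j \<in> {1..n}" for i j
      using same[OF that] that by blast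
    have gb: "g (SOME j. j \<in> blk i) = g i" if "i \<in> {1..n}" for i
    proof -
      have "(SOME j. j \<in> blk i) \<in> blk i" using rep blk that by blast
      then show ?thesis using tie blk that sub by metis
    qed
    show "(\<lambda>i\<in>{1..n}. (\<lambda>B\<in>\<A>. g (SOME i. i \<in> B)) (blk i)) = g"
      using g gb blk by (intro ext) (auto simp: PiE_iff extensional_def restrict_def)
    show "(\<lambda>B\<in>\<A>. g (SOME i. i \<in> B)) \<in> {c \<in> \<A> \<rightarrow>\<^sub>E N. inj_on c \<A>}"
    proof (intro CollectI conjI)
      show "(\<lambda>B\<in>\<A>. g (SOME i. i \<in> B)) \<in> \<A> \<rightarrow>\<^sub>E N"
        using g rep sub by (fastforce simp: PiE_iff)
      show "inj_on (\<lambda>B\<in>\<A>. g (SOME i. i \<in> B)) \<A>"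
      proof (rule inj_onI)
        fix B B' assume B: "B \<in> \<A>" "B' \<in> \<A>"
          and eq: "(\<lambda>B\<in>\<A>. g (SOME i. i \<in> B)) B = (\<lambda>B\<in>\<A>. g (SOME i. i \<in> B)) B'"
        then have "blk (SOME i. i \<in> B) = blk (SOME i. i \<in> B')"
          using tie rep sub by (metis restrict_apply')
        then show "B = B'" using blk(2)[OF rep] B by metis
      qed
    qed
    have "(\<Prod>i\<in>{1..n}. w (g i)) = (\<Prod>B\<in>\<A>. \<Prod>i\<in>B. w (g i))"
      unfolding union[symmetric] using dis sub
      by (subst prod.Union_disjoint) (auto simp: disjoint_def intro: finite_subset[of _ "{1..n}"])
    also have "\<dots> = (\<Prod>B\<in>\<A>. w ((\<lambda>B\<in>\<A>. g (SOME i. i \<in> B)) B) ^ card B)"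
    proof (intro prod.cong refl)
      fix B assume B: "B \<in> \<A>"
      have "g i = g (SOME i. i \<in> B)" if "i \<in> B" for i
        using gb[of i] blk(2)[OF that B] sub[OF that B] by simp
      then show "(\<Prod>i\<in>B. w (g i)) = w ((\<lambda>B\<in>\<A>. g (SOME i. i \<in> B)) B) ^ card B"
        using B by simp
    qed
    finally show "(\<Prod>B\<in>\<A>. w ((\<lambda>B\<in>\<A>. g (SOME i. i \<in> B)) B) ^ card B) = (\<Prod>i\<in>{1..n}. w (g i))" ..
  next
    fix c assume c: "c \<in> {c \<in> \<A> \<rightarrow>\<^sub>E N. inj_on c \<A>}"
    have "(SOME i. i \<in> B) \<in> {1..n}" "blk (SOME i. i \<in> B) = B" if "B \<in> \<A>" for B
      using rep[OF that] sub that blk(2) by auto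
    then show "(\<lambda>B\<in>\<A>. (\<lambda>i\<in>{1..n}. c (blk i)) (SOME i. i \<in> B)) = c"
      using c by (intro ext) (auto simp: PiE_iff extensional_def restrict_def)
    have "tie_partition n (\<lambda>i\<in>{1..n}. c (blk i)) = \<A>"
      unfolding tie_partition_eq_iff[OF \<A>]
      using c blk(1) by (simp add: same inj_on_eq_iff[of c \<A>] del: atLeastAtMost_iff)
    then show "(\<lambda>i\<in>{1..n}. c (blk i)) \<in> {g \<in> {1..n} \<rightarrow>\<^sub>E N. tie_partition n g = \<A>}"
      using c blk(1) by (auto simp: PiE_iff)
  qed
qed

lemma measure_tendsto_pointwise:
  assumes "finite_measure M" and S: "\<And>m. S m \<in> sets M" "T \<in> sets M"
    and ev: "\<And>x. x \<in> space M \<Longrightarrow> \<forall>\<^sub>F m in sequentially. x \<in> S m \<longleftrightarrow> x \<in> T"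
  shows "(\<lambda>m. measure M (S m)) \<longlonglongrightarrow> measure M T"
proof -
  interpret finite_measure M by fact
  have "(\<lambda>m. \<integral>x. indicator (S m) x \<partial>M) \<longlonglongrightarrow> (\<integral>x. indicator T x \<partial>M :: real)"
  proof (rule integral_dominated_convergence[where w = "\<lambda>_. 1"])
    show "AE x in M. (\<lambda>m. indicator (S m) x :: real) \<longlonglongrightarrow> indicator T x"
    proof (rule AE_I2)
      fix x assume "x \<in> space M"
      from ev[OF this] have "\<forall>\<^sub>F m in sequentially. indicator (S m) x = (indicator T x :: real)"
        by eventually_elim (auto simp: indicator_def)
      then show "(\<lambda>m. indicator (S m) x :: real) \<longlonglongrightarrow> indicator T x"
        by (rule tendsto_eventually)
    qed
  qed (use S in \<open>auto simp: indicator_def\<close>)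
  moreover have "S m \<inter> space M = S m" "T \<inter> space M = T" for m
    using S sets.sets_into_space by (auto simp: Int_absorb2)
  ultimately show ?thesis by simp
qed

text \<open>
  The binary number whose digits record membership in \<open>U 0\<close>, \<dots>, \<open>U (m - 1)\<close>. Appending digits keeps
  different codes different, so the codes define finer and finer partitions.
\<close>

primrec set_code :: "(nat \<Rightarrow> 'a set) \<Rightarrow> nat \<Rightarrow> 'a \<Rightarrow> nat" where
  "set_code U 0 x = 0"
| "set_code U (Suc m) x = 2 * set_code U m x + (if x \<in> U m then 1 else 0)"

lemma set_code_less: "set_code U m x < 2 ^ m"
  by (induction m) auto

lemma set_code_persist:
  assumes "set_code U m x \<noteq> set_code U m y" "m \<le> k"
  shows "set_code U k x \<noteq> set_code U k y"
  using assms(2)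
proof (induction k rule: dec_induct)
  case (step k)
  show ?case
  proof
    assume "set_code U (Suc k) x = set_code U (Suc k) y"
    then have "set_code U (Suc k) x div 2 = set_code U (Suc k) y div 2" by simp
    then show False using step.IH by (auto split: if_splits)
  qed
qed (use assms in auto)

lemma set_code_separates:
  assumes "x \<in> U i" "y \<notin> U i"
  shows "\<forall>\<^sub>F m in sequentially. set_code U m x \<noteq> set_code U m y"
proof -
  have "set_code U (Suc i) x \<noteq> set_code U (Suc i) y"
    using assms by simp presburger
  then have "set_code U m x \<noteq> set_code U m y" if "Suc i \<le> m" for m
    using that by (rule set_code_persist)
  then show ?thesis
    unfolding eventually_sequentially by blast
qed

lemma measurable_set_code:
  assumes [measurable]: "\<And>i. U i \<in> sets M"
  shows "set_code U m \<in> measurable M (count_space UNIV)"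
proof (induction m)
  case (Suc m)
  note Suc[measurable]
  show ?case unfolding set_code.simps by measurable
qed simp

section \<open>Ties in samples from a random measure\<close>

text \<open>
  A non-atomic probability measure \<open>P\<close> together with finite partitions of its space, the \<open>m\<close>-th one
  into the level sets of \<open>q m\<close>, which separate points in the limit. All random measures below have
  the sigma-algebra of \<open>P\<close>.
\<close>

locale coded_space = prob_space P for P :: "'a :: euclidean_space measure" +
  fixes q :: "nat \<Rightarrow> 'a \<Rightarrow> nat"
  assumes into_borel [measurable]: "(\<lambda>x. x) \<in> borel_measurable P"
    and measurable_code [measurable]: "\<And>m. q m \<in> measurable P (count_space UNIV)"
    and code_less: "\<And>m x. q m x < 2 ^ m"
    and code_separates: "\<And>x y. x \<noteq> y \<Longrightarrow> \<forall>\<^sub>F m in sequentially. q m x \<noteq> q m y"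
    and no_atoms: "\<And>x. x \<in> space P \<Longrightarrow> measure P {x} = 0"
begin

definition cell :: "nat \<Rightarrow> nat \<Rightarrow> 'a set" where
  "cell m c = {x \<in> space P. q m x = c}"

definition labellings :: "nat \<Rightarrow> nat set set \<Rightarrow> (nat set \<Rightarrow> nat) set" where
  "labellings m \<A> = {c \<in> \<A> \<rightarrow>\<^sub>E {..<2 ^ m}. inj_on c \<A>}"

definition tie_prob :: "'a measure \<Rightarrow> nat \<Rightarrow> nat set set \<Rightarrow> real" where
  "tie_prob Q n \<A> = measure (\<Pi>\<^sub>M i\<in>{1..n}. Q)
     {\<theta> \<in> space (\<Pi>\<^sub>M i\<in>{1..n}. Q). tie_partition n \<theta> = \<A>}"

text \<open>
  The probability that the codes of a sample from \<open>Q\<close> have tie pattern \<open>\<A>\<close>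
  (see \<open>measure_coded_tie_event\<close>).
\<close>

definition cell_tie_prob :: "'a measure \<Rightarrow> nat set set \<Rightarrow> nat \<Rightarrow> real" where
  "cell_tie_prob Q \<A> m = (\<Sum>c\<in>labellings m \<A>. \<Prod>B\<in>\<A>. measure Q (cell m (c B)) ^ card B)"

lemma measurable_cell [measurable]: "cell m c \<in> sets P"
  unfolding cell_def by measurable

lemma cells_disjoint: "disjoint_family_on (cell m) I"
  by (auto simp: disjoint_family_on_def cell_def)

lemma cells_cover: "(\<Union>c<2 ^ m. cell m c) = space P"
  using code_less by (auto simp: cell_def)

lemma sum_measure_cell:
  assumes "finite_measure Q" "sets Q = sets P"
  shows "(\<Sum>c<2 ^ m. measure Q (cell m c)) = measure Q (space P)"
proof -
  interpret Q: finite_measure Q by fact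
  have "measure Q (\<Union>c<2 ^ m. cell m c) = (\<Sum>c<2 ^ m. measure Q (cell m c))"
    using assms(2) cells_disjoint by (intro Q.finite_measure_finite_Union) auto
  then show ?thesis by (simp add: cells_cover)
qed

lemma tie_event_measurable:
  assumes "partition_on {1..n} \<A>" and [measurable_cong]: "sets Q = sets P"
  shows "{\<theta> \<in> space (\<Pi>\<^sub>M i\<in>{1..n}. Q). tie_partition n \<theta> = \<A>} \<in> sets (\<Pi>\<^sub>M i\<in>{1..n}. Q)"
proof -
  have [measurable]: "(\<lambda>\<theta>. \<theta> i) \<in> borel_measurable (\<Pi>\<^sub>M i\<in>{1..n}. Q)" if "i \<in> {1..n}" for i
  proof -
    have "(\<lambda>\<theta>. \<theta> i) \<in> measurable (\<Pi>\<^sub>M i\<in>{1..n}. Q) P" using that by measurable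
    then show ?thesis using measurable_compose[OF _ into_borel] by blast
  qed
  have "Measurable.pred (\<Pi>\<^sub>M i\<in>{1..n}. Q) (\<lambda>\<theta>. \<theta> i = \<theta> j)" if "i \<in> {1..n}" "j \<in> {1..n}" for i j
  proof -
    have "Measurable.pred (\<Pi>\<^sub>M i\<in>{1..n}. Q) (\<lambda>\<theta>. norm (\<theta> i - \<theta> j) = 0)"
      using that by measurable
    then show ?thesis by simp
  qed
  then have "Measurable.pred (\<Pi>\<^sub>M i\<in>{1..n}. Q) (\<lambda>\<theta>. tie_partition n \<theta> = \<A>)"
    unfolding tie_partition_eq_iff[OF assms(1)] by measurable
  then show ?thesis by simp
qed

lemma finite_measure_PiM:
  assumes "finite_measure (Q :: 'a measure)" "finite (I :: 'i set)"
  shows "finite_measure (\<Pi>\<^sub>M i\<in>I. Q)"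
proof -
  interpret Q: finite_measure Q by fact
  interpret finite_product_sigma_finite "\<lambda>_. Q" I by standard (rule assms(2))
  show ?thesis
  proof (rule finite_measureI)
    have "emeasure (\<Pi>\<^sub>M i\<in>I. Q) (space (\<Pi>\<^sub>M i\<in>I. Q)) = (\<Prod>i\<in>I. emeasure Q (space Q))"
      unfolding space_PiM using assms(2) by (intro emeasure_PiM) auto
    then show "emeasure (\<Pi>\<^sub>M i\<in>I. Q) (space (\<Pi>\<^sub>M i\<in>I. Q)) \<noteq> \<infinity>"
      by (simp add: power_eq_top_ennreal)
  qed
qed

lemma measure_PiM_box:
  assumes "finite_measure (Q :: 'a measure)" "finite (I :: 'i set)" "\<And>i. i \<in> I \<Longrightarrow> X i \<in> sets Q"
  shows "measure (\<Pi>\<^sub>M i\<in>I. Q) (PiE I X) = (\<Prod>i\<in>I. measure Q (X i))"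
proof -
  interpret Q: finite_measure Q by fact
  interpret finite_product_sigma_finite "\<lambda>_. Q" I by standard (rule assms(2))
  have "emeasure (\<Pi>\<^sub>M i\<in>I. Q) (PiE I X) = (\<Prod>i\<in>I. emeasure Q (X i))"
    using assms(2,3) by (rule emeasure_PiM)
  also have "\<dots> = (\<Prod>i\<in>I. ennreal (measure Q (X i)))"
    by (simp add: Q.emeasure_eq_measure)
  also have "\<dots> = ennreal (\<Prod>i\<in>I. measure Q (X i))"
    by (simp add: prod_ennreal)
  finally show ?thesis
    by (simp add: measure_def prod_nonneg)
qed

text \<open>
  The event is the disjoint union, over the possible sequences of codes, of boxes of cells.
\<close>

lemma measure_coded_tie_event:
  assumes Q: "finite_measure Q" "sets Q = sets P" and \<A>: "partition_on {1..n} \<A>"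
  shows "measure (\<Pi>\<^sub>M i\<in>{1..n}. Q)
     {\<theta> \<in> space (\<Pi>\<^sub>M i\<in>{1..n}. Q). tie_partition n (\<lambda>i. q m (\<theta> i)) = \<A>} = cell_tie_prob Q \<A> m"
proof -
  interpret PQ: finite_measure "\<Pi>\<^sub>M i\<in>{1..n}. Q" by (rule finite_measure_PiM[OF Q(1)]) simp
  have sp: "space Q = space P" using Q(2) by (rule sets_eq_imp_space_eq)
  let ?G = "{g \<in> {1..n} \<rightarrow>\<^sub>E {..<(2 :: nat) ^ m}. tie_partition n g = \<A>}"
  let ?box = "\<lambda>g. PiE {1..n} (\<lambda>i. cell m (g i))"
  have restr: "tie_partition n (\<lambda>i\<in>{1..n}. g i) = \<A> \<longleftrightarrow> tie_partition n g = \<A>" for g :: "nat \<Rightarrow> nat"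
    unfolding tie_partition_eq_iff[OF \<A>] by auto
  have "{\<theta> \<in> space (\<Pi>\<^sub>M i\<in>{1..n}. Q). tie_partition n (\<lambda>i. q m (\<theta> i)) = \<A>} = (\<Union>g\<in>?G. ?box g)"
    (is "?T = _")
  proof (intro equalityI subsetI)
    fix \<theta> assume \<theta>: "\<theta> \<in> {\<theta> \<in> space (\<Pi>\<^sub>M i\<in>{1..n}. Q). tie_partition n (\<lambda>i. q m (\<theta> i)) = \<A>}"
    show "\<theta> \<in> (\<Union>g\<in>?G. ?box g)"
    proof (rule UN_I)
      show "(\<lambda>i\<in>{1..n}. q m (\<theta> i)) \<in> ?G" using \<theta> restr code_less by auto
      show "\<theta> \<in> ?box (\<lambda>i\<in>{1..n}. q m (\<theta> i))"
        using \<theta> by (auto simp: space_PiM PiE_iff cell_def sp)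
    qed
  next
    fix \<theta> assume "\<theta> \<in> (\<Union>g\<in>?G. ?box g)"
    then obtain g where g: "g \<in> ?G" "\<theta> \<in> ?box g" by blast
    then have "q m (\<theta> i) = g i" if "i \<in> {1..n}" for i
      using that by (auto simp: PiE_iff cell_def)
    then have "tie_partition n (\<lambda>i. q m (\<theta> i)) = \<A>"
      using g(1) unfolding tie_partition_eq_iff[OF \<A>] by auto
    then show "\<theta> \<in> {\<theta> \<in> space (\<Pi>\<^sub>M i\<in>{1..n}. Q). tie_partition n (\<lambda>i. q m (\<theta> i)) = \<A>}"
      using g(2) by (auto simp: space_PiM PiE_iff cell_def sp)
  qed
  then have "measure (\<Pi>\<^sub>M i\<in>{1..n}. Q) ?T = measure (\<Pi>\<^sub>M i\<in>{1..n}. Q) (\<Union>g\<in>?G. ?box g)"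
    by (rule arg_cong)
  also have "\<dots> = (\<Sum>g\<in>?G. measure (\<Pi>\<^sub>M i\<in>{1..n}. Q) (?box g))"
  proof (rule PQ.finite_measure_finite_Union)
    show "finite ?G" by (rule finite_subset[of _ "{1..n} \<rightarrow>\<^sub>E {..<(2 :: nat) ^ m}"]) (auto intro!: finite_PiE)
    show "?box ` ?G \<subseteq> sets (\<Pi>\<^sub>M i\<in>{1..n}. Q)" using Q(2) by (auto intro!: sets_PiM_I_finite)
    show "disjoint_family_on ?box ?G"
      unfolding disjoint_family_on_def
    proof (intro ballI impI)
      fix g h assume gh: "g \<in> ?G" "h \<in> ?G" "g \<noteq> h"
      have "g \<in> {1..n} \<rightarrow>\<^sub>E {..<2 ^ m}" "h \<in> {1..n} \<rightarrow>\<^sub>E {..<2 ^ m}"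
        using gh(1,2) by blast+
      then obtain i where i: "i \<in> {1..n}" "g i \<noteq> h i"
        using PiE_ext[of g "{1..n}" "\<lambda>_. {..<2 ^ m}" h] gh(3) by blast
      have val: "q m (\<theta> i) = f i" if "\<theta> \<in> ?box f" for \<theta> f
        using PiE_mem[OF that i(1)] by (simp add: cell_def)
      show "?box g \<inter> ?box h = {}"
      proof (rule equals0I)
        fix \<theta> assume "\<theta> \<in> ?box g \<inter> ?box h"
        then show False using val[of \<theta> g] val[of \<theta> h] i(2) by (metis IntD1 IntD2)
      qed
    qed
  qed
  also have "\<dots> = (\<Sum>g\<in>?G. \<Prod>i\<in>{1..n}. measure Q (cell m (g i)))"
    by (rule sum.cong[OF refl], rule measure_PiM_box[OF Q(1) finite_atLeastAtMost]) (simp add: Q(2))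
  also have "\<dots> = cell_tie_prob Q \<A> m"
    unfolding cell_tie_prob_def labellings_def by (rule sum_tie_functions[OF \<A>])
  finally show ?thesis .
qed

lemma cell_tie_prob_bounds:
  assumes Q: "finite_measure Q" "sets Q = sets P" "measure Q (space Q) \<le> 1" and \<A>: "partition_on {1..n} \<A>"
  shows "0 \<le> cell_tie_prob Q \<A> m" "cell_tie_prob Q \<A> m \<le> 1"
proof -
  interpret Q: finite_measure Q by fact
  interpret PQ: finite_measure "\<Pi>\<^sub>M i\<in>{1..n}. Q" by (rule finite_measure_PiM[OF Q(1)]) simp
  have "measure (\<Pi>\<^sub>M i\<in>{1..n}. Q) (space (\<Pi>\<^sub>M i\<in>{1..n}. Q)) = measure Q (space Q) ^ n"
    unfolding space_PiM by (subst measure_PiM_box) (auto simp: Q(1))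
  also have "\<dots> \<le> 1" using Q(3) by (intro power_le_one) auto
  finally show "cell_tie_prob Q \<A> m \<le> 1"
    unfolding measure_coded_tie_event[OF Q(1,2) \<A>, symmetric]
    using PQ.bounded_measure order_trans by blast
  show "0 \<le> cell_tie_prob Q \<A> m"
    unfolding measure_coded_tie_event[OF Q(1,2) \<A>, symmetric] by simp
qed

text \<open>
  For a given sample, the codes eventually separate its finitely many distinct values, and from then on
  the codes and the sample have the same ties.
\<close>

lemma cell_tie_prob_tendsto:
  assumes Q: "finite_measure Q" "sets Q = sets P" and \<A>: "partition_on {1..n} \<A>"
  shows "cell_tie_prob Q \<A> \<longlonglongrightarrow> tie_prob Q n \<A>"
proof -
  note Q(2)[measurable_cong]
  let ?S = "\<lambda>m. {\<theta> \<in> space (\<Pi>\<^sub>M i\<in>{1..n}. Q). tie_partition n (\<lambda>i. q m (\<theta> i)) = \<A>}"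
  have "(\<lambda>m. measure (\<Pi>\<^sub>M i\<in>{1..n}. Q) (?S m)) \<longlonglongrightarrow> tie_prob Q n \<A>"
    unfolding tie_prob_def
  proof (rule measure_tendsto_pointwise[OF finite_measure_PiM[OF Q(1) finite_atLeastAtMost]])
    show "?S m \<in> sets (\<Pi>\<^sub>M i\<in>{1..n}. Q)" for m
    proof -
      have [measurable]: "(\<lambda>\<theta>. q m (\<theta> i)) \<in> measurable (\<Pi>\<^sub>M i\<in>{1..n}. Q) (count_space UNIV)"
        if "i \<in> {1..n}" for i using that by measurable
      have "Measurable.pred (\<Pi>\<^sub>M i\<in>{1..n}. Q) (\<lambda>\<theta>. tie_partition n (\<lambda>i. q m (\<theta> i)) = \<A>)"
        unfolding tie_partition_eq_iff[OF \<A>] by measurable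
      then show ?thesis by simp
    qed
    show "{\<theta> \<in> space (\<Pi>\<^sub>M i\<in>{1..n}. Q). tie_partition n \<theta> = \<A>} \<in> sets (\<Pi>\<^sub>M i\<in>{1..n}. Q)"
      by (rule tie_event_measurable[OF \<A> Q(2)])
    fix \<theta> assume \<theta>: "\<theta> \<in> space (\<Pi>\<^sub>M i\<in>{1..n}. Q)"
    have "\<forall>\<^sub>F m in sequentially. \<forall>i\<in>{1..n}. \<forall>j\<in>{1..n}. q m (\<theta> i) = q m (\<theta> j) \<longleftrightarrow> \<theta> i = \<theta> j"
    proof (intro eventually_ball_finite ballI finite_atLeastAtMost)
      fix i j
      show "\<forall>\<^sub>F m in sequentially. q m (\<theta> i) = q m (\<theta> j) \<longleftrightarrow> \<theta> i = \<theta> j"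
        by (cases "\<theta> i = \<theta> j") (auto elim!: eventually_mono dest!: code_separates)
    qed
    then show "\<forall>\<^sub>F m in sequentially. \<theta> \<in> ?S m \<longleftrightarrow>
        \<theta> \<in> {\<theta> \<in> space (\<Pi>\<^sub>M i\<in>{1..n}. Q). tie_partition n \<theta> = \<A>}"
    proof eventually_elim
      fix m assume "\<forall>i\<in>{1..n}. \<forall>j\<in>{1..n}. q m (\<theta> i) = q m (\<theta> j) \<longleftrightarrow> \<theta> i = \<theta> j"
      then show "\<theta> \<in> ?S m \<longleftrightarrow> \<theta> \<in> {\<theta> \<in> space (\<Pi>\<^sub>M i\<in>{1..n}. Q). tie_partition n \<theta> = \<A>}"
        unfolding mem_Collect_eq tie_partition_eq_iff[OF \<A>] by auto
    qed
  qed
  then show ?thesis unfolding measure_coded_tie_event[OF Q \<A>] .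
qed

text \<open>
  The sum is the mean, over \<open>x\<close> drawn from \<open>P\<close>, of the mass of the cell of \<open>x\<close>; these cells shrink to \<open>{x}\<close>, a
  null set. This is the only place where non-atomicity enters.
\<close>

lemma sum_measure_cell_squared_tendsto: "(\<lambda>m. \<Sum>c<2 ^ m. (measure P (cell m c))\<^sup>2) \<longlonglongrightarrow> 0"
proof -
  have [measurable]: "(\<lambda>x. measure P (cell m (q m x))) \<in> borel_measurable P" for m
    by (rule measurable_compose[OF measurable_code]) simp
  have "(\<lambda>m. \<integral>x. measure P (cell m (q m x)) \<partial>P) \<longlonglongrightarrow> (\<integral>x. 0 \<partial>P)"
  proof (rule integral_dominated_convergence[where w = "\<lambda>_. 1"])
    show "AE x in P. (\<lambda>m. measure P (cell m (q m x))) \<longlonglongrightarrow> 0"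
    proof (rule AE_I2)
      fix x assume x: "x \<in> space P"
      have "{y \<in> space P. norm (y - x) = 0} \<in> sets P" by measurable
      then have "{x} \<in> sets P" using x by (simp add: conj_commute cong: conj_cong)
      then have "(\<lambda>m. measure P (cell m (q m x))) \<longlonglongrightarrow> measure P {x}"
      proof (intro measure_tendsto_pointwise)
        fix y
        show "\<forall>\<^sub>F m in sequentially. y \<in> cell m (q m x) \<longleftrightarrow> y \<in> {x}"
          using x by (cases "y = x") (auto simp: cell_def elim!: eventually_mono dest!: code_separates)
      qed (auto simp: finite_measure_axioms)
      then show "(\<lambda>m. measure P (cell m (q m x))) \<longlonglongrightarrow> 0"
        using no_atoms[OF x] by simp
    qed
  qed auto
  moreover have "(\<integral>x. measure P (cell m (q m x)) \<partial>P) = (\<Sum>c<2 ^ m. (measure P (cell m c))\<^sup>2)" for m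
  proof -
    have "(\<integral>x. measure P (cell m (q m x)) \<partial>P) =
        (\<integral>x. (\<Sum>c<2 ^ m. measure P (cell m c) * indicator (cell m c) x) \<partial>P)"
    proof (intro Bochner_Integration.integral_cong refl)
      fix x assume x: "x \<in> space P"
      have "(\<Sum>c<2 ^ m. measure P (cell m c) * indicator (cell m c) x) =
          (\<Sum>c\<in>{q m x}. measure P (cell m c) * indicator (cell m c) x)"
        using code_less by (intro sum.mono_neutral_right) (auto simp: cell_def)
      then show "measure P (cell m (q m x)) =
          (\<Sum>c<2 ^ m. measure P (cell m c) * indicator (cell m c) x)"
        using x by (simp add: cell_def)
    qed
    also have "\<dots> = (\<Sum>c<2 ^ m. (measure P (cell m c))\<^sup>2)"
      by (subst Bochner_Integration.integral_sum) (auto simp: power2_eq_square emeasure_eq_measure)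
    finally show ?thesis .
  qed
  ultimately show ?thesis by simp
qed

lemma sum_prob_cell: "(\<Sum>c<2 ^ m. prob (cell m c)) = 1"
  using sum_measure_cell[OF finite_measure_axioms refl] by (simp add: prob_space)

lemma labelling_sum_tendsto:
  assumes "finite \<A>"
    and "\<And>B. B \<in> \<A> \<Longrightarrow> \<exists>C. \<forall>q\<in>{0..1}. \<bar>h B q - \<beta> B * q\<bar> \<le> C * q\<^sup>2"
  shows "(\<lambda>m. \<Sum>c\<in>labellings m \<A>. \<Prod>B\<in>\<A>. h B (prob (cell m (c B)))) \<longlonglongrightarrow> (\<Prod>B\<in>\<A>. \<beta> B)"
  unfolding labellings_def
  by (rule injective_sum_limit)
     (use assms sum_prob_cell sum_measure_cell_squared_tendsto in auto)

text \<open>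
  The boxes generate the product sigma-algebra, and the mass of a box is a finite product of
  measurable functions.
\<close>

lemma product_kernel_measurable:
  assumes [measurable]: "Q \<in> measurable M (subprob_algebra P)" and I: "finite (I :: 'i set)" "I \<noteq> {}"
  shows "(\<lambda>x. \<Pi>\<^sub>M i\<in>I. Q x) \<in> measurable M (subprob_algebra (\<Pi>\<^sub>M i\<in>I. P))"
proof (rule measurable_subprob_algebra_generated[OF sets_PiM Int_stable_prod_algebra prod_algebra_sets_into_space])
  fix x assume x: "x \<in> space M"
  then have sub: "subprob_space (Q x)" and sets: "sets (Q x) = sets P"
    using measurable_space[OF assms(1) x] by (auto simp: space_subprob_algebra)
  interpret Q: subprob_space "Q x" by fact
  interpret finite_product_sigma_finite "\<lambda>_. Q x" I by standard (rule I)
  have sp: "space (Q x) = space P" using sets by (rule sets_eq_imp_space_eq)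
  show "subprob_space (\<Pi>\<^sub>M i\<in>I. Q x)"
  proof (rule subprob_spaceI)
    show "emeasure (\<Pi>\<^sub>M i\<in>I. Q x) (space (\<Pi>\<^sub>M i\<in>I. Q x)) \<le> 1"
      unfolding space_PiM using Q.emeasure_space_le_1 I by (subst emeasure_PiM) (auto intro: power_le_one)
    show "space (\<Pi>\<^sub>M i\<in>I. Q x) \<noteq> {}"
      using Q.subprob_not_empty by (auto simp: space_PiM PiE_eq_empty_iff)
  qed
  show "sets (\<Pi>\<^sub>M i\<in>I. Q x) = sets (\<Pi>\<^sub>M i\<in>I. P)"
    using sets by (intro sets_PiM_cong) auto
next
  have box: "(\<lambda>x. emeasure (\<Pi>\<^sub>M i\<in>I. Q x) (PiE I X)) \<in> borel_measurable M"
    if X: "\<And>i. i \<in> I \<Longrightarrow> X i \<in> sets P" for X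
  proof -
    have "emeasure (\<Pi>\<^sub>M i\<in>I. Q x) (PiE I X) = (\<Prod>i\<in>I. emeasure (Q x) (X i))" if x: "x \<in> space M" for x
    proof -
      have sub: "subprob_space (Q x)" and sets: "sets (Q x) = sets P"
        using measurable_space[OF assms(1) x] by (auto simp: space_subprob_algebra)
      interpret Q: subprob_space "Q x" by fact
      interpret finite_product_sigma_finite "\<lambda>_. Q x" I by standard (rule I)
      show ?thesis using X sets I by (intro emeasure_PiM) auto
    qed
    moreover have "(\<lambda>x. \<Prod>i\<in>I. emeasure (Q x) (X i)) \<in> borel_measurable M"
      using X by measurable
    ultimately show ?thesis by (simp cong: measurable_cong)
  qed
  show "(\<lambda>x. emeasure (\<Pi>\<^sub>M i\<in>I. Q x) A) \<in> borel_measurable M" if "A \<in> prod_algebra I (\<lambda>_. P)" for A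
    using that I(1) by (auto simp: prod_algebra_eq_finite intro!: box)
  show "(\<lambda>x. emeasure (\<Pi>\<^sub>M i\<in>I. Q x) (\<Pi>\<^sub>E i\<in>I. space P)) \<in> borel_measurable M"
    by (rule box) auto
qed

lemma eppf_eq_integral_tie_prob:
  assumes M: "prob_space M" and Q: "Q \<in> measurable M (subprob_algebra P)" and n: "n \<ge> 1"
    and \<A>: "partition_on {1..n} \<A>"
  shows "eppf M Q n \<A> = (\<integral>x. tie_prob (Q x) n \<A> \<partial>M)"
    and "(\<lambda>x. tie_prob (Q x) n \<A>) \<in> borel_measurable M"
proof -
  interpret M: prob_space M by fact
  let ?S = "{\<theta> \<in> space (\<Pi>\<^sub>M i\<in>{1..n}. P). tie_partition n \<theta> = \<A>}"
  have ker: "(\<lambda>x. \<Pi>\<^sub>M i\<in>{1..n}. Q x) \<in> measurable M (subprob_algebra (\<Pi>\<^sub>M i\<in>{1..n}. P))"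
    using n by (intro product_kernel_measurable Q) auto
  have S: "?S \<in> sets (\<Pi>\<^sub>M i\<in>{1..n}. P)" by (rule tie_event_measurable[OF \<A> refl])
  have sp: "space (\<Pi>\<^sub>M i\<in>{1..n}. Q x) = space (\<Pi>\<^sub>M i\<in>{1..n}. P)" if "x \<in> space M" for x
    using measurable_space[OF ker that] sets_eq_imp_space_eq by (auto simp: space_subprob_algebra)
  have spb: "space (sample_law M Q n) = space (\<Pi>\<^sub>M i\<in>{1..n}. P)"
    unfolding sample_law_def
    using measurable_space[OF ker] M.not_empty by (intro space_bind) (auto simp: space_subprob_algebra)
  have "eppf M Q n \<A> = measure (M \<bind> (\<lambda>x. \<Pi>\<^sub>M i\<in>{1..n}. Q x)) ?S"
    unfolding eppf_def spb by (simp add: sample_law_def)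
  also have "\<dots> = (\<integral>x. measure (\<Pi>\<^sub>M i\<in>{1..n}. Q x) ?S \<partial>M)"
    by (rule M.measure_bind[OF ker S])
  also have "\<dots> = (\<integral>x. tie_prob (Q x) n \<A> \<partial>M)"
    by (intro Bochner_Integration.integral_cong refl) (simp only: tie_prob_def sp)
  finally show "eppf M Q n \<A> = (\<integral>x. tie_prob (Q x) n \<A> \<partial>M)" .
  have "(\<lambda>x. measure (\<Pi>\<^sub>M i\<in>{1..n}. Q x) ?S) \<in> borel_measurable M"
    using measurable_emeasure_kernel[OF ker S] unfolding measure_def by measurable
  then show "(\<lambda>x. tie_prob (Q x) n \<A>) \<in> borel_measurable M"
    by (simp only: tie_prob_def sp cong: measurable_cong)
qed

end

section \<open>Gamma and Dirichlet laws\<close>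

text \<open>
  This removes the normalization by a random total mass \<open>G\<close>: the exponential splits over independent
  summands of \<open>G\<close>, the power does not.
\<close>

lemma inverse_power_eq_nn_integral:
  assumes "n \<ge> 1" "G > 0"
  shows "ennreal (1 / G ^ n) = (\<integral>\<^sup>+u. ennreal (u ^ (n - 1) / Gamma (real n) * exp (- (u * G)))
            * indicator {0<..} u \<partial>lborel)"
proof -
  have g: "Gamma (real n) > 0" using assms(1) by (intro Gamma_real_pos) auto
  have "(\<integral>\<^sup>+u. ennreal (u ^ (n - 1) / Gamma (real n) * exp (- (u * G))) * indicator {0<..} u \<partial>lborel)
      = (\<integral>\<^sup>+u. ennreal (1 / Gamma (real n)) * (ennreal (u ^ (n - 1) * exp (- (G * u))) * indicator {0<..} u) \<partial>lborel)"
  proof (intro nn_integral_cong)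
    fix u :: real
    have "ennreal (u ^ (n - 1) / Gamma (real n) * exp (- (u * G))) =
        ennreal (1 / Gamma (real n)) * ennreal (u ^ (n - 1) * exp (- (G * u)))"
      using g by (subst ennreal_mult'[symmetric]) (auto simp: mult.commute)
    then show "ennreal (u ^ (n - 1) / Gamma (real n) * exp (- (u * G))) * indicator {0<..} u =
        ennreal (1 / Gamma (real n)) * (ennreal (u ^ (n - 1) * exp (- (G * u))) * indicator {0<..} u)"
      by (simp only: mult.assoc)
  qed
  also have "\<dots> = ennreal (1 / Gamma (real n)) * ennreal (Gamma (real n) / G ^ n)"
    using assms by (subst nn_integral_cmult, simp, subst nn_integral_power_exp) auto
  also have "\<dots> = ennreal (1 / Gamma (real n) * (Gamma (real n) / G ^ n))"
    using g by (intro ennreal_mult'[symmetric]) simp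
  also have "1 / Gamma (real n) * (Gamma (real n) / G ^ n) = 1 / G ^ n"
    using less_imp_neq[OF g] by simp
  finally show ?thesis ..
qed

text \<open>
  The size of the block with label \<open>i\<close>, and 0 if no block has this label: the exponent of the
  \<open>i\<close>-th cell in the product over the blocks, regarded as a product over all cells.
\<close>

definition block_size :: "'b set set \<Rightarrow> ('b set \<Rightarrow> 'c) \<Rightarrow> 'c \<Rightarrow> nat" where
  "block_size \<A> c i = (if i \<in> c ` \<A> then card (the_inv_into \<A> c i) else 0)"

lemma prod_block_size:
  fixes f :: "'c \<Rightarrow> nat \<Rightarrow> real"
  assumes "finite N" "c \<in> \<A> \<rightarrow>\<^sub>E N" "inj_on c \<A>" and f0: "\<And>i. i \<in> N \<Longrightarrow> f i 0 = 1"
  shows "(\<Prod>i\<in>N. f i (block_size \<A> c i)) = (\<Prod>B\<in>\<A>. f (c B) (card B))"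
proof -
  have sub: "c ` \<A> \<subseteq> N" using assms(2) by auto
  have "(\<Prod>i\<in>N. f i (block_size \<A> c i)) = (\<Prod>i\<in>c ` \<A>. f i (block_size \<A> c i))"
    using sub assms(1) f0 by (intro prod.mono_neutral_right) (auto simp: block_size_def)
  also have "\<dots> = (\<Prod>B\<in>\<A>. f (c B) (card B))"
    using assms(3) by (simp add: prod.reindex block_size_def the_inv_into_f_f)
  finally show ?thesis .
qed

lemma sum_block_size:
  assumes "finite N" "c \<in> \<A> \<rightarrow>\<^sub>E N" "inj_on c \<A>"
  shows "(\<Sum>i\<in>N. block_size \<A> c i) = (\<Sum>B\<in>\<A>. card B)"
proof -
  have sub: "c ` \<A> \<subseteq> N" using assms(2) by auto
  have "(\<Sum>i\<in>N. block_size \<A> c i) = (\<Sum>i\<in>c ` \<A>. block_size \<A> c i)"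
    using sub assms(1) by (intro sum.mono_neutral_right) (auto simp: block_size_def)
  also have "\<dots> = (\<Sum>B\<in>\<A>. card B)"
    using assms(3) by (simp add: sum.reindex block_size_def the_inv_into_f_f)
  finally show ?thesis .
qed

lemma sum_card_partition:
  assumes "partition_on {1..n :: nat} \<A>"
  shows "(\<Sum>B\<in>\<A>. card B) = n"
proof -
  have un: "\<Union>\<A> = {1..n}" and dis: "disjoint \<A>" using assms by (auto simp: partition_on_def)
  have "card (\<Union>\<A>) = (\<Sum>B\<in>\<A>. card B)"
  proof (rule card_Union_disjoint)
    show "pairwise disjnt \<A>" using dis by (simp add: disjoint_def pairwise_def disjnt_def)
    show "finite B" if "B \<in> \<A>" for B
      by (rule finite_subset[of _ "{1..n}"]) (use un that in auto)
  qed
  then show ?thesis using un by simp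
qed

lemma card_block_pos:
  assumes "partition_on {1..n :: nat} \<A>" "B \<in> \<A>"
  shows "1 \<le> card B"
proof -
  have "B \<subseteq> {1..n}" "B \<noteq> {}" using assms by (auto simp: partition_on_def)
  then have "card B > 0" using finite_subset by (auto simp: card_gt_0_iff)
  then show ?thesis by simp
qed

lemma sets_gamma_law [measurable_cong, simp]: "sets (gamma_law a) = sets borel"
  by (simp add: gamma_law_def)

lemma space_gamma_law [simp]: "space (gamma_law a) = UNIV"
  by (simp add: gamma_law_def)

lemma gamma_law_0: "gamma_law 0 = return borel 0"
  by (simp add: gamma_law_def)

lemma gamma_law_nonzero:
  "a \<noteq> 0 \<Longrightarrow> gamma_law a = density lborel
     (\<lambda>x. ennreal (x powr (a - 1) * exp (- x) / Gamma a) * indicator {0<..} x)"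
  by (simp add: gamma_law_def)

lemma gamma_law_AE_pos: "a \<noteq> 0 \<Longrightarrow> AE x in gamma_law a. 0 < x"
  by (subst gamma_law_nonzero, assumption, subst AE_density) (auto simp: indicator_def)

lemma gamma_law_AE_nonneg: "AE x in gamma_law a. 0 \<le> x"
proof (cases "a = 0")
  case True
  then show ?thesis by (simp only: gamma_law_0) (subst AE_return, auto)
next
  case False
  show ?thesis using gamma_law_AE_pos[OF False] by eventually_elim simp
qed

lemma pochhammer_nonneg_real: "0 \<le> x \<Longrightarrow> 0 \<le> pochhammer (x :: real) n"
  unfolding pochhammer_prod by (intro prod_nonneg) auto

lemma gamma_law_laplace_moment:
  assumes "a \<ge> 0" "u \<ge> 0"
  shows "(\<integral>\<^sup>+x. ennreal (x ^ k * exp (- (u * x))) \<partial>gamma_law a)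
    = ennreal (pochhammer a k * (1 + u) powr (- (a + real k)))"
proof (cases "a = 0")
  case True
  have "(\<integral>\<^sup>+x. ennreal (x ^ k * exp (- (u * x))) \<partial>gamma_law a) = ennreal (0 ^ k * exp (- (u * 0)))"
    unfolding True gamma_law_0 by (subst nn_integral_return) auto
  then show ?thesis using True assms by (cases k) (auto simp: pochhammer_rec)
next
  case False
  then have a: "a > 0" using assms(1) by simp
  then have G: "Gamma a > 0" "Gamma (a + real k) > 0" by (auto intro!: Gamma_real_pos add_pos_nonneg)
  have "(\<integral>\<^sup>+x. ennreal (x ^ k * exp (- (u * x))) \<partial>gamma_law a) =
      (\<integral>\<^sup>+x. ennreal (x powr (a - 1) * exp (- x) / Gamma a) * indicator {0<..} x *
         ennreal (x ^ k * exp (- (u * x))) \<partial>lborel)"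
    unfolding gamma_law_nonzero[OF False] by (rule nn_integral_density) measurable
  also have "\<dots> = (\<integral>\<^sup>+x. ennreal (1 / Gamma a) * (ennreal (x powr (a + real k - 1) *
      exp (- ((1 + u) * x))) * indicator {0<..} x) \<partial>lborel)"
  proof (intro nn_integral_cong)
    fix x :: real
    show "ennreal (x powr (a - 1) * exp (- x) / Gamma a) * indicator {0<..} x *
        ennreal (x ^ k * exp (- (u * x))) = ennreal (1 / Gamma a) *
        (ennreal (x powr (a + real k - 1) * exp (- ((1 + u) * x))) * indicator {0<..} x)"
    proof (cases "x > 0")
      case True
      have "x powr (a + real k - 1) = x powr (a - 1) * x ^ k"
        using True by (simp add: algebra_simps flip: powr_realpow powr_add)
      moreover have "exp (- ((1 + u) * x)) = exp (- x) * exp (- (u * x))"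
        by (simp add: algebra_simps flip: exp_add)
      ultimately have e: "x powr (a - 1) * exp (- x) / Gamma a * (x ^ k * exp (- (u * x))) =
          1 / Gamma a * (x powr (a + real k - 1) * exp (- ((1 + u) * x)))"
        by simp
      have "ennreal (x powr (a - 1) * exp (- x) / Gamma a) * ennreal (x ^ k * exp (- (u * x)))
          = ennreal (x powr (a - 1) * exp (- x) / Gamma a * (x ^ k * exp (- (u * x))))"
        using True G by (intro ennreal_mult[symmetric]) auto
      also have "\<dots> = ennreal (1 / Gamma a) * ennreal (x powr (a + real k - 1) * exp (- ((1 + u) * x)))"
        unfolding e using True G by (intro ennreal_mult) auto
      finally show ?thesis using True by simp
    next
      case False
      then have "indicator {0<..} x = (0::ennreal)" by simp
      then show ?thesis by (simp only: mult_zero_left mult_zero_right)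
    qed
  qed
  also have "\<dots> = ennreal (1 / Gamma a) * ennreal (Gamma (a + real k) / (1 + u) powr (a + real k))"
    using a assms by (subst nn_integral_cmult, simp, subst nn_integral_powr_exp) auto
  also have "\<dots> = ennreal (1 / Gamma a * (Gamma (a + real k) / (1 + u) powr (a + real k)))"
    using G by (intro ennreal_mult'[symmetric]) simp
  also have "1 / Gamma a * (Gamma (a + real k) / (1 + u) powr (a + real k)) =
      pochhammer a k * (1 + u) powr (- (a + real k))"
  proof -
    have "a \<notin> \<int>\<^sub>\<le>\<^sub>0" using a by (auto elim!: nonpos_Ints_cases)
    then have "pochhammer a k = Gamma (a + real k) / Gamma a" by (simp add: pochhammer_Gamma)
    then show ?thesis by (simp only: powr_minus_divide) simp
  qed
  finally show ?thesis .
qed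

lemma prob_space_gamma_law: "a \<ge> 0 \<Longrightarrow> prob_space (gamma_law a)"
proof
  assume "a \<ge> 0"
  then show "emeasure (gamma_law a) (space (gamma_law a)) = 1"
    using gamma_law_laplace_moment[of a 0 0] by simp
qed

text \<open>
  With the total mass in the exponent, the gamma variables are independent and the integral over them
  is a product of their Laplace moments; the powers of \<open>1 + u\<close> combine to the integrand of a beta integral.
  A gamma variable of shape 0 vanishes, in agreement with \<open>pochhammer 0 k\<close>, and the total is positive
  because some shape is.
\<close>

lemma dirichlet_law_moment:
  fixes a :: "nat \<Rightarrow> real" and k :: "nat \<Rightarrow> nat"
  assumes a: "\<And>i. 0 \<le> a i" and pos: "0 < (\<Sum>i<r. a i)" and n: "1 \<le> (\<Sum>i<r. k i)"
  shows "(\<integral>\<^sup>+y. ennreal (\<Prod>i<r. y i ^ k i) \<partial>dirichlet_law r a)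
    = ennreal (Gamma (\<Sum>i<r. a i) / Gamma ((\<Sum>i<r. a i) + real (\<Sum>i<r. k i)) *
        (\<Prod>i<r. pochhammer (a i) (k i)))"
proof -
  let ?I = "{..<r}"
  define \<kappa> where "\<kappa> = (\<Sum>i<r. a i)"
  define n where "n = (\<Sum>i<r. k i)"
  define \<Gamma> where "\<Gamma> = (\<Pi>\<^sub>M i\<in>?I. gamma_law (a i))"
  have prob: "prob_space (gamma_law (a i))" for i by (rule prob_space_gamma_law[OF a])
  interpret product_prob_space "\<lambda>i. gamma_law (a i)" ?I by (intro product_prob_spaceI prob)
  interpret G: prob_space \<Gamma> unfolding \<Gamma>_def by (intro prob_space_PiM prob)
  interpret pair_sigma_finite lborel \<Gamma> ..
  have [measurable]: "(\<lambda>g. g i) \<in> borel_measurable \<Gamma>" if "i \<in> ?I" for i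
    unfolding \<Gamma>_def using that by measurable
  have P: "0 \<le> (\<Prod>i<r. pochhammer (a i) (k i))"
    using a by (intro prod_nonneg ballI pochhammer_nonneg_real) auto
  have AE_nn: "AE g in \<Gamma>. \<forall>i\<in>?I. 0 \<le> g i"
    unfolding \<Gamma>_def
    by (intro AE_finite_allI finite_lessThan AE_PiM_component prob gamma_law_AE_nonneg)
  obtain i0 where i0: "i0 \<in> ?I" "a i0 \<noteq> 0"
    using pos by (metis less_irrefl sum.neutral)
  have AE_pos: "AE g in \<Gamma>. 0 < g i0"
    unfolding \<Gamma>_def by (intro AE_PiM_component prob i0(1) gamma_law_AE_pos i0(2))
  let ?w = "\<lambda>u. ennreal (u ^ (n - 1) / Gamma (real n)) * indicator {0<..} u"
  have "(\<integral>\<^sup>+y. ennreal (\<Prod>i<r. y i ^ k i) \<partial>dirichlet_law r a)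
      = (\<integral>\<^sup>+g. ennreal (\<Prod>i<r. (g i / (\<Sum>l<r. g l)) ^ k i) \<partial>\<Gamma>)"
    unfolding dirichlet_law_def \<Gamma>_def[symmetric]
    by (subst nn_integral_distr) (auto intro!: measurable_restrict nn_integral_cong prod.cong arg_cong[of _ _ ennreal])
  also have "\<dots> = (\<integral>\<^sup>+g. \<integral>\<^sup>+u. ?w u * (\<Prod>i<r. ennreal (g i ^ k i * exp (- (u * g i)))) \<partial>lborel \<partial>\<Gamma>)"
  proof (rule nn_integral_cong_AE)
    show "AE g in \<Gamma>. ennreal (\<Prod>i<r. (g i / (\<Sum>l<r. g l)) ^ k i) =
        (\<integral>\<^sup>+u. ?w u * (\<Prod>i<r. ennreal (g i ^ k i * exp (- (u * g i)))) \<partial>lborel)"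
      using AE_nn AE_pos
    proof eventually_elim
      fix g :: "nat \<Rightarrow> real" assume g: "\<forall>i\<in>?I. 0 \<le> g i" "0 < g i0"
      define T where "T = (\<Sum>l<r. g l)"
      have "g i0 \<le> T" unfolding T_def using g(1) i0(1) by (intro member_le_sum) auto
      then have T: "T > 0" using g(2) by simp
      have m: "0 \<le> (\<Prod>i<r. g i ^ k i)" using g(1) by (intro prod_nonneg) auto
      have "(\<Prod>i<r. (g i / T) ^ k i) = (\<Prod>i<r. g i ^ k i) * (1 / T ^ n)"
        by (simp add: power_divide prod_dividef n_def power_sum)
      then have "ennreal (\<Prod>i<r. (g i / T) ^ k i) = ennreal ((\<Prod>i<r. g i ^ k i) * (1 / T ^ n))"
        by (rule arg_cong)
      also have "\<dots> = ennreal (\<Prod>i<r. g i ^ k i) * ennreal (1 / T ^ n)"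
        using m T by (intro ennreal_mult) auto
      also have "\<dots> = (\<integral>\<^sup>+u. ennreal (\<Prod>i<r. g i ^ k i) *
          (ennreal (u ^ (n - 1) / Gamma (real n) * exp (- (u * T))) * indicator {0<..} u) \<partial>lborel)"
        using assms(3) T unfolding n_def
        by (subst inverse_power_eq_nn_integral) (auto simp: nn_integral_cmult)
      also have "\<dots> = (\<integral>\<^sup>+u. ?w u * (\<Prod>i<r. ennreal (g i ^ k i * exp (- (u * g i)))) \<partial>lborel)"
      proof (intro nn_integral_cong)
        fix u :: real
        have "(\<Prod>i<r. ennreal (g i ^ k i * exp (- (u * g i)))) =
            ennreal (\<Prod>i<r. g i ^ k i * exp (- (u * g i)))"
          using g(1) by (intro prod_ennreal) auto
        also have "(\<Prod>i<r. g i ^ k i * exp (- (u * g i))) = (\<Prod>i<r. g i ^ k i) * exp (- (u * T))"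
          by (simp add: prod.distrib T_def sum_distrib_left exp_sum flip: sum_negf)
        also have "ennreal \<dots> = ennreal (\<Prod>i<r. g i ^ k i) * ennreal (exp (- (u * T)))"
          using m by (intro ennreal_mult) auto
        finally have e: "(\<Prod>i<r. ennreal (g i ^ k i * exp (- (u * g i)))) =
          ennreal (\<Prod>i<r. g i ^ k i) * ennreal (exp (- (u * T)))" .
        have "ennreal (u ^ (n - 1) / Gamma (real n) * exp (- (u * T))) =
            ennreal (u ^ (n - 1) / Gamma (real n)) * ennreal (exp (- (u * T)))"
          by (intro ennreal_mult'') simp
        then show "ennreal (\<Prod>i<r. g i ^ k i) *
          (ennreal (u ^ (n - 1) / Gamma (real n) * exp (- (u * T))) * indicator {0<..} u) =
          ?w u * (\<Prod>i<r. ennreal (g i ^ k i * exp (- (u * g i))))"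
          unfolding e by (simp only: mult_ac)
      qed
      finally show "ennreal (\<Prod>i<r. (g i / (\<Sum>l<r. g l)) ^ k i) =
          (\<integral>\<^sup>+u. ?w u * (\<Prod>i<r. ennreal (g i ^ k i * exp (- (u * g i)))) \<partial>lborel)"
        by (simp only: T_def)
    qed
  qed
  also have "\<dots> = (\<integral>\<^sup>+u. \<integral>\<^sup>+g. ?w u * (\<Prod>i<r. ennreal (g i ^ k i * exp (- (u * g i)))) \<partial>\<Gamma> \<partial>lborel)"
    by (rule Fubini') measurable
  also have "\<dots> = (\<integral>\<^sup>+u. ennreal (\<Prod>i<r. pochhammer (a i) (k i)) *
      (ennreal (u ^ (n - 1) / Gamma (real n) * (1 + u) powr (- (\<kappa> + real n))) * indicator {0<..} u) \<partial>lborel)"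
  proof (intro nn_integral_cong)
    fix u :: real
    show "(\<integral>\<^sup>+g. ?w u * (\<Prod>i<r. ennreal (g i ^ k i * exp (- (u * g i)))) \<partial>\<Gamma>) =
      ennreal (\<Prod>i<r. pochhammer (a i) (k i)) *
      (ennreal (u ^ (n - 1) / Gamma (real n) * (1 + u) powr (- (\<kappa> + real n))) * indicator {0<..} u)"
    proof (cases "u > 0")
      case True
      have "(\<integral>\<^sup>+g. (\<Prod>i<r. ennreal (g i ^ k i * exp (- (u * g i)))) \<partial>\<Gamma>) =
          (\<Prod>i<r. \<integral>\<^sup>+x. ennreal (x ^ k i * exp (- (u * x))) \<partial>gamma_law (a i))"
        unfolding \<Gamma>_def
      proof (rule product_nn_integral_prod)
        have "(\<lambda>x. ennreal (x ^ k i * exp (- (u * x)))) \<in> borel_measurable borel" for i by simp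
        then show "(\<lambda>x. ennreal (x ^ k i * exp (- (u * x)))) \<in> borel_measurable (gamma_law (a i))" for i
          by (simp only: measurable_cong_sets[OF sets_gamma_law refl])
      qed simp
      also have "\<dots> = (\<Prod>i<r. ennreal (pochhammer (a i) (k i) * (1 + u) powr (- (a i + real (k i)))))"
        using True a by (simp add: gamma_law_laplace_moment)
      also have "\<dots> = ennreal (\<Prod>i<r. pochhammer (a i) (k i) * (1 + u) powr (- (a i + real (k i))))"
        using a by (intro prod_ennreal mult_nonneg_nonneg pochhammer_nonneg_real) auto
      also have "(\<Prod>i<r. pochhammer (a i) (k i) * (1 + u) powr (- (a i + real (k i)))) =
          (\<Prod>i<r. pochhammer (a i) (k i)) * (1 + u) powr (- (\<kappa> + real n))"
      proof -
        have "- (\<kappa> + real n) = (\<Sum>i<r. - (a i + real (k i)))"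
          by (simp add: \<kappa>_def n_def sum_negf sum.distrib sum_subtractf)
        then show ?thesis using True by (simp add: prod.distrib powr_sum)
      qed
      also have "ennreal \<dots> = ennreal (\<Prod>i<r. pochhammer (a i) (k i)) * ennreal ((1 + u) powr (- (\<kappa> + real n)))"
        using P by (intro ennreal_mult) auto
      finally have e: "(\<integral>\<^sup>+g. (\<Prod>i<r. ennreal (g i ^ k i * exp (- (u * g i)))) \<partial>\<Gamma>) =
        ennreal (\<Prod>i<r. pochhammer (a i) (k i)) * ennreal ((1 + u) powr (- (\<kappa> + real n)))" .
      have "(\<integral>\<^sup>+g. ?w u * (\<Prod>i<r. ennreal (g i ^ k i * exp (- (u * g i)))) \<partial>\<Gamma>) =
          ?w u * (\<integral>\<^sup>+g. (\<Prod>i<r. ennreal (g i ^ k i * exp (- (u * g i)))) \<partial>\<Gamma>)"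
        by (rule nn_integral_cmult) measurable
      moreover have "ennreal (u ^ (n - 1) / Gamma (real n) * (1 + u) powr (- (\<kappa> + real n))) =
          ennreal (u ^ (n - 1) / Gamma (real n)) * ennreal ((1 + u) powr (- (\<kappa> + real n)))"
        by (intro ennreal_mult'') simp
      ultimately show ?thesis unfolding e by (simp only: mult_ac)
    next
      case False
      then have "indicator {0<..} u = (0::ennreal)" by simp
      then show ?thesis by (simp only: mult_zero_left mult_zero_right nn_integral_const)
    qed
  qed
  also have "\<dots> = ennreal (\<Prod>i<r. pochhammer (a i) (k i)) * ennreal (Gamma \<kappa> / Gamma (\<kappa> + real n))"
    using assms by (subst nn_integral_cmult, simp, subst nn_integral_beta_prime) (auto simp: \<kappa>_def n_def)
  also have "\<dots> = ennreal (Gamma \<kappa> / Gamma (\<kappa> + real n) * (\<Prod>i<r. pochhammer (a i) (k i)))"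
    using P by (subst ennreal_mult'[symmetric]) (auto simp: mult.commute)
  finally show ?thesis by (simp only: \<kappa>_def n_def)
qed

section \<open>The Dirichlet process\<close>

context coded_space
begin

lemma measurable_measure_kernel:
  assumes "Q \<in> measurable M (subprob_algebra P)" "A \<in> sets P"
  shows "(\<lambda>x. measure (Q x) A) \<in> borel_measurable M"
  using measurable_emeasure_kernel[OF assms] unfolding measure_def by measurable

lemma measurable_cell_tie_prob:
  assumes "Q \<in> measurable M (subprob_algebra P)"
  shows "(\<lambda>x. cell_tie_prob (Q x) \<A> m) \<in> borel_measurable M"
  unfolding cell_tie_prob_def
  by (intro borel_measurable_sum borel_measurable_prod borel_measurable_power
        measurable_measure_kernel[OF assms] measurable_cell)

lemma kernel_properties:
  assumes "Q \<in> measurable M (subprob_algebra P)" "x \<in> space M"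
  shows "finite_measure (Q x)" "sets (Q x) = sets P" "measure (Q x) (space (Q x)) \<le> 1"
proof -
  have "subprob_space (Q x)" and s: "sets (Q x) = sets P"
    using measurable_space[OF assms] by (auto simp: space_subprob_algebra)
  then interpret subprob_space "Q x" by simp
  show "finite_measure (Q x)" by (rule finite_measure_axioms)
  show "sets (Q x) = sets P" by (rule s)
  show "measure (Q x) (space (Q x)) \<le> 1" by (rule subprob_measure_le_1)
qed

text \<open>
  The weight \<open>W\<close> is 1 for the Dirichlet process; for the Bessel measure it will undo the normalization.
\<close>

lemma integral_tie_prob_limit:
  assumes "finite_measure M" and Q: "Q \<in> measurable M (subprob_algebra P)"
    and \<A>: "partition_on {1..n} \<A>"
    and W: "W \<in> borel_measurable M" "\<And>x. x \<in> space M \<Longrightarrow> \<bar>W x\<bar> \<le> C"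
  shows "(\<lambda>m. \<integral>x. W x * cell_tie_prob (Q x) \<A> m \<partial>M) \<longlonglongrightarrow> (\<integral>x. W x * tie_prob (Q x) n \<A> \<partial>M)"
proof (rule integral_dominated_convergence[where w = "\<lambda>_. \<bar>C\<bar>"])
  interpret finite_measure M by fact
  have lim: "cell_tie_prob (Q x) \<A> \<longlonglongrightarrow> tie_prob (Q x) n \<A>" if "x \<in> space M" for x
    using kernel_properties[OF Q that] \<A> by (intro cell_tie_prob_tendsto)
  note W(1)[measurable] measurable_cell_tie_prob[OF Q, measurable]
  have "(\<lambda>x. tie_prob (Q x) n \<A>) \<in> borel_measurable M"
    by (rule borel_measurable_LIMSEQ_real[OF lim]) measurable
  then show "(\<lambda>x. W x * tie_prob (Q x) n \<A>) \<in> borel_measurable M" by measurable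
  show "(\<lambda>x. W x * cell_tie_prob (Q x) \<A> m) \<in> borel_measurable M" for m by measurable
  show "integrable M (\<lambda>_. \<bar>C\<bar>)" by simp
  show "AE x in M. (\<lambda>m. W x * cell_tie_prob (Q x) \<A> m) \<longlonglongrightarrow> W x * tie_prob (Q x) n \<A>"
    by (intro AE_I2 tendsto_mult tendsto_const lim)
  show "AE x in M. norm (W x * cell_tie_prob (Q x) \<A> m) \<le> \<bar>C\<bar>" for m
  proof (rule AE_I2)
    fix x assume x: "x \<in> space M"
    have "\<bar>cell_tie_prob (Q x) \<A> m\<bar> \<le> 1"
      using cell_tie_prob_bounds[OF kernel_properties[OF Q x] \<A>] by (simp add: abs_le_iff)
    then have "\<bar>W x\<bar> * \<bar>cell_tie_prob (Q x) \<A> m\<bar> \<le> \<bar>C\<bar> * 1"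
      using W(2)[OF x] by (intro mult_mono) auto
    then show "norm (W x * cell_tie_prob (Q x) \<A> m) \<le> \<bar>C\<bar>" by (simp add: abs_mult)
  qed
qed

text \<open>
  The cells form a partition to which the defining property of the process applies, so each labelling
  contributes a moment of a Dirichlet law.
\<close>

lemma eppf_dirichlet_process:
  assumes \<kappa>: "\<kappa> > 0" and Q: "dirichlet_process M (scale_measure (ennreal \<kappa>) P) Q"
    and n: "n \<ge> 1" and \<A>: "partition_on {1..n} \<A>"
  shows "eppf M Q n \<A> = Gamma \<kappa> / Gamma (\<kappa> + real n) * (\<Prod>B\<in>\<A>. \<kappa> * Gamma (real (card B)))"
proof -
  interpret M: prob_space M using Q by (simp add: dirichlet_process_def)
  let ?\<alpha> = "scale_measure (ennreal \<kappa>) P"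
  define D where "D = Gamma \<kappa> / Gamma (\<kappa> + real n)"
  define p where "p m c = measure P (cell m c)" for m c
  have QK: "Q \<in> measurable M (subprob_algebra P)"
    using Q measurable_prob_algebraD[of Q M ?\<alpha>] subprob_algebra_cong[of ?\<alpha> P]
    by (simp add: dirichlet_process_def)
  have fin\<A>: "finite \<A>" using \<A> by (auto intro: finite_elements)
  have sum_p: "(\<Sum>c<2 ^ m. p m c) = 1" for m
    unfolding p_def by (rule sum_prob_cell)
  have p_nn: "0 \<le> p m c" for m c by (simp add: p_def)
  have moment: "(\<integral>x. (\<Prod>B\<in>\<A>. measure (Q x) (cell m (c B)) ^ card B) \<partial>M) =
      D * (\<Prod>B\<in>\<A>. pochhammer (\<kappa> * p m (c B)) (card B))" if c: "c \<in> labellings m \<A>" for m c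
  proof -
    let ?r = "2 ^ m :: nat"
    let ?k = "block_size \<A> c"
    have c': "c \<in> \<A> \<rightarrow>\<^sub>E {..<?r}" "inj_on c \<A>" using c by (auto simp: labellings_def)
    have sk: "(\<Sum>i<?r. ?k i) = n"
      using sum_block_size[OF _ c'] sum_card_partition[OF \<A>] by simp
    have sa: "(\<Sum>i<?r. \<kappa> * p m i) = \<kappa>" using sum_p[of m] by (simp flip: sum_distrib_left)
    have law: "distr M (\<Pi>\<^sub>M i\<in>{..<?r}. borel) (\<lambda>x. \<lambda>i\<in>{..<?r}. measure (Q x) (cell m i)) =
        dirichlet_law ?r (\<lambda>i. \<kappa> * p m i)"
    proof -
      have "disjoint_family_on (cell m) {..<?r} \<and> (\<forall>i<?r. cell m i \<in> sets ?\<alpha>) \<and> (\<Union>i<?r. cell m i) = space ?\<alpha>"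
        using cells_disjoint cells_cover by (simp add: space_scale_measure)
      then have "distr M (\<Pi>\<^sub>M i\<in>{..<?r}. borel) (\<lambda>x. \<lambda>i\<in>{..<?r}. measure (Q x) (cell m i)) =
          dirichlet_law ?r (\<lambda>i. measure ?\<alpha> (cell m i))"
        using Q unfolding dirichlet_process_def by blast
      then show ?thesis using \<kappa> by (simp add: p_def)
    qed
    have [measurable]: "(\<lambda>x. measure (Q x) (cell m i)) \<in> borel_measurable M" for i
      by (rule measurable_measure_kernel[OF QK]) simp
    have pr: "(\<Prod>i<?r. measure (Q x) (cell m i) ^ ?k i) = (\<Prod>B\<in>\<A>. measure (Q x) (cell m (c B)) ^ card B)" for x
      using c' by (intro prod_block_size[where f = "\<lambda>i j. measure (Q x) (cell m i) ^ j"]) auto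
    have "(\<integral>\<^sup>+x. ennreal (\<Prod>B\<in>\<A>. measure (Q x) (cell m (c B)) ^ card B) \<partial>M) =
        (\<integral>\<^sup>+y. ennreal (\<Prod>i<?r. y i ^ ?k i)
          \<partial>distr M (\<Pi>\<^sub>M i\<in>{..<?r}. borel) (\<lambda>x. \<lambda>i\<in>{..<?r}. measure (Q x) (cell m i)))"
      unfolding pr[symmetric] by (subst nn_integral_distr) (auto intro!: measurable_restrict)
    also have "\<dots> = ennreal (D * (\<Prod>i<?r. pochhammer (\<kappa> * p m i) (?k i)))"
      unfolding law using \<kappa> n
      by (subst dirichlet_law_moment) (auto simp: sa sk D_def p_nn)
    also have "(\<Prod>i<?r. pochhammer (\<kappa> * p m i) (?k i)) = (\<Prod>B\<in>\<A>. pochhammer (\<kappa> * p m (c B)) (card B))"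
      using c' by (intro prod_block_size) auto
    finally have "(\<integral>\<^sup>+x. ennreal (\<Prod>B\<in>\<A>. measure (Q x) (cell m (c B)) ^ card B) \<partial>M) =
        ennreal (D * (\<Prod>B\<in>\<A>. pochhammer (\<kappa> * p m (c B)) (card B)))" .
    moreover have "0 \<le> D * (\<Prod>B\<in>\<A>. pochhammer (\<kappa> * p m (c B)) (card B))"
      using \<kappa> p_nn unfolding D_def
      by (intro mult_nonneg_nonneg prod_nonneg ballI pochhammer_nonneg_real divide_nonneg_nonneg Gamma_real_nonneg) auto
    ultimately show ?thesis
      by (subst integral_eq_nn_integral) (auto intro!: prod_nonneg)
  qed
  have "(\<lambda>m. \<integral>x. 1 * cell_tie_prob (Q x) \<A> m \<partial>M) \<longlonglongrightarrow> (\<integral>x. 1 * tie_prob (Q x) n \<A> \<partial>M)"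
    by (rule integral_tie_prob_limit[OF M.finite_measure_axioms QK \<A>, where C = 1]) auto
  moreover have "(\<integral>x. 1 * cell_tie_prob (Q x) \<A> m \<partial>M) =
      D * (\<Sum>c\<in>labellings m \<A>. \<Prod>B\<in>\<A>. pochhammer (\<kappa> * p m (c B)) (card B))" for m
  proof -
    have "integrable M (\<lambda>x. \<Prod>B\<in>\<A>. measure (Q x) (cell m (c B)) ^ card B)" for c
    proof (rule M.integrable_const_bound[where B = 1])
      show "AE x in M. norm (\<Prod>B\<in>\<A>. measure (Q x) (cell m (c B)) ^ card B) \<le> 1"
      proof (rule AE_I2)
        fix x assume x: "x \<in> space M"
        interpret Qx: finite_measure "Q x" by (rule kernel_properties(1)[OF QK x])
        have "measure (Q x) (cell m (c B)) \<le> 1" for B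
          using Qx.bounded_measure kernel_properties(3)[OF QK x] by (meson order_trans)
        then show "norm (\<Prod>B\<in>\<A>. measure (Q x) (cell m (c B)) ^ card B) \<le> 1"
          by (auto simp: abs_prod intro!: prod_le_1 power_le_one)
      qed
      show "(\<lambda>x. \<Prod>B\<in>\<A>. measure (Q x) (cell m (c B)) ^ card B) \<in> borel_measurable M"
        by (intro borel_measurable_prod borel_measurable_power measurable_measure_kernel[OF QK] measurable_cell)
    qed
    then have "(\<integral>x. cell_tie_prob (Q x) \<A> m \<partial>M) =
        (\<Sum>c\<in>labellings m \<A>. \<integral>x. (\<Prod>B\<in>\<A>. measure (Q x) (cell m (c B)) ^ card B) \<partial>M)"
      unfolding cell_tie_prob_def by (intro Bochner_Integration.integral_sum)
    then show ?thesis by (simp add: moment sum_distrib_left)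
  qed
  moreover have "(\<lambda>m. D * (\<Sum>c\<in>labellings m \<A>. \<Prod>B\<in>\<A>. pochhammer (\<kappa> * p m (c B)) (card B)))
      \<longlonglongrightarrow> D * (\<Prod>B\<in>\<A>. \<kappa> * Gamma (real (card B)))"
    unfolding p_def
    by (intro tendsto_mult tendsto_const fin\<A> pochhammer_linear_expansion card_block_pos[OF \<A>]
          labelling_sum_tendsto[where h = "\<lambda>B q. pochhammer (\<kappa> * q) (card B)"])
  ultimately have "(\<integral>x. 1 * tie_prob (Q x) n \<A> \<partial>M) = D * (\<Prod>B\<in>\<A>. \<kappa> * Gamma (real (card B)))"
    by (simp only: LIMSEQ_unique)
  then show ?thesis
    using eppf_eq_integral_tie_prob(1)[OF M.prob_space_axioms QK n \<A>] by (simp add: D_def)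
qed

end

section \<open>The normalized Bessel random measure\<close>

lemma power_times_exp_neg_le:
  assumes "u > 0" "t \<ge> 0"
  shows "t ^ n * exp (- (u * t)) \<le> fact n / (u :: real) ^ n"
proof -
  have "(\<Sum>i\<in>{n}. (u * t) ^ i /\<^sub>R fact i) \<le> (\<Sum>i. (u * t) ^ i /\<^sub>R fact i)"
    using assms by (intro sum_le_suminf summable_exp_generic) auto
  then have "(u * t) ^ n / fact n \<le> exp (u * t)"
    by (simp add: exp_def divide_inverse mult.commute)
  then have "(u * t) ^ n \<le> exp (u * t) * fact n"
    by (simp add: divide_le_eq)
  then have "t ^ n \<le> exp (u * t) * fact n / u ^ n"
    using assms by (simp add: power_mult_distrib field_simps)
  then have "t ^ n * exp (- (u * t)) \<le> exp (u * t) * fact n / u ^ n * exp (- (u * t))"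
    by (intro mult_right_mono) auto
  also have "\<dots> = fact n / u ^ n"
    by (simp add: exp_minus)
  finally show ?thesis .
qed

locale bessel_process = coded_space P q for P :: "'a :: euclidean_space measure" and q +
  fixes M :: "'w measure" and \<omega> \<kappa> :: real and J :: "nat \<Rightarrow> 'w \<Rightarrow> real" and \<tau> :: "nat \<Rightarrow> 'w \<Rightarrow> 'a"
  assumes \<omega>: "1 \<le> \<omega>" and \<kappa>: "0 < \<kappa>" and points: "bessel_points M \<omega> \<kappa> P J \<tau>"
begin

abbreviation "\<psi> \<equiv> bessel_exponent \<omega> \<kappa>"
abbreviation "\<Lambda> \<equiv> bessel_intensity \<omega> \<kappa>"
abbreviation "p m c \<equiv> measure P (cell m c)"
abbreviation "Q \<equiv> normalized_rm P J \<tau>"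

definition total :: "'w \<Rightarrow> ennreal" where
  "total x = (\<Sum>j. ennreal (J j x))"

text \<open>
  \<open>mass A\<close> is the mass of \<open>A\<close> under the random measure before normalization, possibly infinite on a null
  set; \<open>cell_mass\<close> is its real-valued version for cells.
\<close>

definition mass :: "'a set \<Rightarrow> 'w \<Rightarrow> ennreal" where
  "mass A x = (\<Sum>j. ennreal (J j x) * indicator A (\<tau> j x))"

definition cell_mass :: "nat \<Rightarrow> nat \<Rightarrow> 'w \<Rightarrow> real" where
  "cell_mass m c x = enn2real (mass (cell m c) x)"

lemma poisson: "poisson_points M \<Lambda> J"
  using points by (simp add: bessel_points_def)

lemma prob_M: "prob_space M"
  using poisson by (simp add: poisson_points_def)

lemma measurable_J [measurable]: "J j \<in> borel_measurable M"
  using poisson by (simp add: poisson_points_def)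

lemma J_pos: "x \<in> space M \<Longrightarrow> 0 < J j x"
  using poisson by (simp add: poisson_points_def)

lemma measurable_\<tau> [measurable]: "\<tau> j \<in> measurable M P"
  using points by (simp add: bessel_points_def)

lemma measurable_total [measurable]: "total \<in> borel_measurable M"
  unfolding total_def[abs_def] by measurable

lemma measurable_mass [measurable]:
  assumes [measurable]: "A \<in> sets P"
  shows "mass A \<in> borel_measurable M"
  unfolding mass_def[abs_def] by measurable

lemma measurable_cell_mass [measurable]: "cell_mass m c \<in> borel_measurable M"
  unfolding cell_mass_def[abs_def] by measurable

lemma total_pos: "x \<in> space M \<Longrightarrow> 0 < total x"
proof -
  assume x: "x \<in> space M"
  have "(\<Sum>j\<in>{0}. ennreal (J j x)) \<le> total x"
    unfolding total_def by (intro sum_le_suminf) auto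
  then have "ennreal (J 0 x) \<le> total x" by simp
  moreover have "0 < ennreal (J 0 x)" using J_pos[OF x, of 0] by simp
  ultimately show ?thesis by (rule less_le_trans[rotated])
qed

lemma mass_space: "x \<in> space M \<Longrightarrow> mass (space P) x = total x"
  unfolding mass_def total_def
  using measurable_space[OF measurable_\<tau>] by (intro suminf_cong) auto

lemma emeasure_normalized_rm:
  assumes x: "x \<in> space M" and A: "A \<in> sets P"
  shows "emeasure (Q x) A = mass A x / total x"
proof -
  let ?D = "density (count_space UNIV) (\<lambda>j. ennreal (J j x) / (\<Sum>i. ennreal (J i x)))"
  have meas: "(\<lambda>j. \<tau> j x) \<in> measurable ?D P"
    using measurable_space[OF measurable_\<tau> x] by (simp add: measurable_count_space_eq1 cong: measurable_cong_sets)
  have "emeasure (Q x) A = emeasure ?D ((\<lambda>j. \<tau> j x) -` A \<inter> space ?D)"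
    unfolding normalized_rm_def by (rule emeasure_distr[OF meas A])
  also have "\<dots> = (\<integral>\<^sup>+j. ennreal (J j x) / total x * indicator ((\<lambda>j. \<tau> j x) -` A) j \<partial>count_space UNIV)"
    by (subst emeasure_density) (auto simp: total_def)
  also have "\<dots> = (\<Sum>j. ennreal (J j x) / total x * indicator ((\<lambda>j. \<tau> j x) -` A) j)"
    by (rule nn_integral_count_space_nat)
  also have "\<dots> = (\<Sum>j. ennreal (J j x) * indicator A (\<tau> j x) / total x)"
    by (intro suminf_cong) (auto simp: indicator_def)
  also have "\<dots> = mass A x / total x"
    by (simp add: mass_def)
  finally show ?thesis .
qed

lemma normalized_rm_kernel: "Q \<in> measurable M (subprob_algebra P)"
proof (rule measurable_subprob_algebra)
  fix x assume x: "x \<in> space M"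
  show s: "sets (Q x) = sets P" by (simp add: normalized_rm_def)
  have sp: "space (Q x) = space P" by (simp add: normalized_rm_def)
  show "subprob_space (Q x)"
  proof (rule subprob_spaceI)
    show "emeasure (Q x) (space (Q x)) \<le> 1"
      unfolding sp using x total_pos[OF x]
      by (subst emeasure_normalized_rm) (auto simp: mass_space, cases "total x = \<top>", auto simp: less_top)
    show "space (Q x) \<noteq> {}" unfolding sp by (rule not_empty)
  qed
next
  fix A assume A [measurable]: "A \<in> sets P"
  have "(\<lambda>x. mass A x / total x) \<in> borel_measurable M" by measurable
  then show "(\<lambda>x. emeasure (Q x) A) \<in> borel_measurable M"
    using A by (simp add: emeasure_normalized_rm cong: measurable_cong)
qed

lemma sum_over_code:
  fixes f :: "nat \<Rightarrow> 'b :: semiring_1"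
  assumes "t \<in> space P"
  shows "(\<Sum>c<2 ^ m. f c * indicator (cell m c) t) = f (q m t)"
proof -
  have "(\<Sum>c<2 ^ m. f c * indicator (cell m c) t) = (\<Sum>c\<in>{q m t}. f c * indicator (cell m c) t)"
    using code_less by (intro sum.mono_neutral_right) (auto simp: cell_def)
  then show ?thesis using assms by (simp add: cell_def)
qed

lemma sum_mass_cells:
  assumes "x \<in> space M"
  shows "(\<Sum>c<2 ^ m. u c * mass (cell m c) x) = (\<Sum>j. u (q m (\<tau> j x)) * ennreal (J j x))"
proof -
  have "(\<Sum>c<2 ^ m. u c * mass (cell m c) x) =
      (\<Sum>c<2 ^ m. \<Sum>j. u c * (ennreal (J j x) * indicator (cell m c) (\<tau> j x)))"
    by (simp add: mass_def)
  also have "\<dots> = (\<Sum>j. \<Sum>c<2 ^ m. u c * (ennreal (J j x) * indicator (cell m c) (\<tau> j x)))"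
    by (rule suminf_sum[symmetric]) simp
  also have "\<dots> = (\<Sum>j. u (q m (\<tau> j x)) * ennreal (J j x))"
    using sum_over_code[OF measurable_space[OF measurable_\<tau> assms], of "\<lambda>c. u c * ennreal (J _ x)"]
    by (simp add: mult.assoc)
  finally show ?thesis .
qed

lemma sum_mass_total: "x \<in> space M \<Longrightarrow> (\<Sum>c<2 ^ m. mass (cell m c) x) = total x"
  using sum_mass_cells[where u = "\<lambda>_. 1"] by (simp add: total_def)

lemma nn_integral_\<psi>: "u \<ge> 0 \<Longrightarrow> (\<integral>\<^sup>+s. ennreal (1 - exp (- (u * s))) \<partial>\<Lambda>) = ennreal (\<psi> u)"
  by (rule nn_integral_bessel_exponent[OF \<omega> \<kappa>])

lemma \<psi>_nonneg: "u \<ge> 0 \<Longrightarrow> 0 \<le> \<psi> u"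
proof -
  assume u: "u \<ge> 0"
  have "\<omega>\<^sup>2 \<le> (\<omega> + u)\<^sup>2" using \<omega> u by (intro power_mono) auto
  then have "sqrt (\<omega>\<^sup>2 - 1) \<le> sqrt ((\<omega> + u)\<^sup>2 - 1)" by simp
  moreover have "0 < \<omega> + sqrt (\<omega>\<^sup>2 - 1)" using \<omega> by (intro add_pos_nonneg) auto
  ultimately have "1 \<le> (\<omega> + u + sqrt ((\<omega> + u)\<^sup>2 - 1)) / (\<omega> + sqrt (\<omega>\<^sup>2 - 1))"
    using u by (subst le_divide_eq_1_pos) linarith+
  then show ?thesis unfolding bessel_exponent_def using \<kappa> by (intro mult_nonneg_nonneg ln_ge_zero) auto
qed

text \<open>
  Mark each point with the code of its location. A point of size \<open>s\<close> contributes the factor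
  \<open>exp (- u\<^sub>c s)\<close>, where \<open>c\<close> is its code. The mean of this factor over the mark is \<open>\<Sum>\<^sub>c p\<^sub>c exp (- u\<^sub>c s)\<close>, and
  \<open>1\<close> minus the mean is a mixture of the functions \<open>1 - exp (- u\<^sub>c s)\<close>.
\<close>

lemma laplace_cell_masses:
  assumes u: "\<And>c. 0 < u c"
  shows "(\<integral>\<^sup>+x. ennreal (nexp (\<Sum>c<2 ^ m. ennreal (u c) * mass (cell m c) x)) \<partial>M)
    = ennreal (exp (- (\<Sum>c<2 ^ m. p m c * \<psi> (u c))))"
proof -
  let ?f = "\<lambda>t s. ennreal (u (q m t) * s)"
  have "(\<integral>\<^sup>+x. ennreal (nexp (\<Sum>c<2 ^ m. ennreal (u c) * mass (cell m c) x)) \<partial>M) =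
      (\<integral>\<^sup>+x. ennreal (nexp (\<Sum>j. ?f (\<tau> j x) (J j x))) \<partial>M)"
    using u by (intro nn_integral_cong) (simp add: sum_mass_cells ennreal_mult' less_imp_le)
  also have "\<dots> = ennreal (nexp (\<integral>\<^sup>+s. ennreal (1 - (\<integral>t. nexp (?f t s) \<partial>P)) \<partial>\<Lambda>))"
  proof (rule marked_poisson_laplace_functional[OF poisson])
    have [measurable]: "u \<in> borel_measurable (count_space UNIV)" by simp
    show "(\<lambda>(t, s). ?f t s) \<in> borel_measurable (P \<Otimes>\<^sub>M borel)" by measurable
  qed (use points in \<open>auto simp: bessel_points_def sigma_finite_bessel_intensity prob_space_axioms\<close>)
  also have "(\<integral>\<^sup>+s. ennreal (1 - (\<integral>t. nexp (?f t s) \<partial>P)) \<partial>\<Lambda>) =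
      (\<integral>\<^sup>+s. (\<Sum>c<2 ^ m. ennreal (p m c) * ennreal (1 - exp (- (u c * s)))) \<partial>\<Lambda>)"
  proof (rule nn_integral_cong_AE)
    show "AE s in \<Lambda>. ennreal (1 - (\<integral>t. nexp (?f t s) \<partial>P)) =
        (\<Sum>c<2 ^ m. ennreal (p m c) * ennreal (1 - exp (- (u c * s))))"
      using AE_bessel_intensity_pos
    proof eventually_elim
      fix s :: real assume s: "0 < s"
      have "(\<integral>t. nexp (?f t s) \<partial>P) = (\<integral>t. (\<Sum>c<2 ^ m. exp (- (u c * s)) * indicator (cell m c) t) \<partial>P)"
      proof (intro Bochner_Integration.integral_cong refl)
        fix t assume t: "t \<in> space P"
        have "nexp (?f t s) = exp (- (u (q m t) * s))"
          using s u by (intro nexp_ennreal) (simp add: less_imp_le)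
        then show "nexp (?f t s) = (\<Sum>c<2 ^ m. exp (- (u c * s)) * indicator (cell m c) t)"
          by (simp only: sum_over_code[OF t])
      qed
      also have "\<dots> = (\<Sum>c<2 ^ m. exp (- (u c * s)) * p m c)"
        by (subst Bochner_Integration.integral_sum) (auto simp: emeasure_eq_measure)
      finally have "1 - (\<integral>t. nexp (?f t s) \<partial>P) = (\<Sum>c<2 ^ m. p m c) - (\<Sum>c<2 ^ m. exp (- (u c * s)) * p m c)"
        by (simp only: sum_prob_cell)
      also have "\<dots> = (\<Sum>c<2 ^ m. p m c * (1 - exp (- (u c * s))))"
        by (simp add: sum_subtractf algebra_simps)
      finally have e: "1 - (\<integral>t. nexp (?f t s) \<partial>P) = (\<Sum>c<2 ^ m. p m c * (1 - exp (- (u c * s))))" .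
      have "0 \<le> 1 - exp (- (u c * s))" for c using s u[of c] by simp
      then show "ennreal (1 - (\<integral>t. nexp (?f t s) \<partial>P)) =
        (\<Sum>c<2 ^ m. ennreal (p m c) * ennreal (1 - exp (- (u c * s))))"
        unfolding e by (simp add: ennreal_mult flip: sum_ennreal)
    qed
  qed
  also have "\<dots> = (\<Sum>c<2 ^ m. ennreal (p m c) * ennreal (\<psi> (u c)))"
    using u by (subst nn_integral_sum) (simp_all add: nn_integral_cmult nn_integral_\<psi> less_imp_le)
  also have "\<dots> = ennreal (\<Sum>c<2 ^ m. p m c * \<psi> (u c))"
    using u \<psi>_nonneg by (simp add: ennreal_mult less_imp_le flip: sum_ennreal)
  also have "nexp \<dots> = exp (- (\<Sum>c<2 ^ m. p m c * \<psi> (u c)))"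
    using u \<psi>_nonneg by (intro nexp_ennreal sum_nonneg mult_nonneg_nonneg) (auto simp: less_imp_le)
  finally show ?thesis .
qed

text \<open>
  The mean of \<open>exp (- v T)\<close> tends to the probability of \<open>T < \<infinity>\<close> as \<open>v \<rightarrow> 0\<close>, and the exponent tends to 0.
\<close>

lemma total_finite: "AE x in M. total x < \<top>"
proof -
  interpret M: prob_space M by (rule prob_M)
  let ?v = "\<lambda>k. inverse (real (Suc k))"
  have laplace: "(\<integral>\<^sup>+x. ennreal (nexp (ennreal v * total x)) \<partial>M) = ennreal (exp (- \<psi> v))" if "v > 0" for v
  proof -
    have "(\<integral>\<^sup>+x. ennreal (nexp (ennreal v * total x)) \<partial>M) =
        (\<integral>\<^sup>+x. ennreal (nexp (\<Sum>c<2 ^ 0. ennreal v * mass (cell 0 c) x)) \<partial>M)"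
      by (intro nn_integral_cong) (simp only: sum_mass_total flip: sum_distrib_left)
    also have "\<dots> = ennreal (exp (- (\<Sum>c<2 ^ 0. p 0 c * \<psi> v)))"
      using that by (intro laplace_cell_masses) auto
    also have "(\<Sum>c<2 ^ 0. p 0 c * \<psi> v) = \<psi> v"
      by (simp only: sum_prob_cell mult_1 flip: sum_distrib_right)
    finally show ?thesis .
  qed
  have "(\<lambda>k. \<integral>\<^sup>+x. ennreal (nexp (ennreal (?v k) * total x)) \<partial>M) \<longlonglongrightarrow>
      (\<integral>\<^sup>+x. indicator {x \<in> space M. total x < \<top>} x \<partial>M)"
  proof (rule nn_integral_dominated_convergence[where w = "\<lambda>_. 1"])
    have "(\<lambda>k. nexp (ennreal (?v k) * total x)) \<longlonglongrightarrow> indicator {x \<in> space M. total x < \<top>} x"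
      if x: "x \<in> space M" for x
    proof (cases "total x")
      case (real t)
      have "(\<lambda>k. exp (- (?v k * t))) \<longlonglongrightarrow> exp (- (0 * t))"
        by (intro tendsto_intros LIMSEQ_inverse_real_of_nat)
      moreover have "nexp (ennreal (?v k) * total x) = exp (- (?v k * t))" for k
        using real by (simp add: ennreal_mult[symmetric] del: of_nat_Suc)
      ultimately show ?thesis using real x by simp
    next
      case top
      then show ?thesis using x by (simp add: ennreal_mult_top del: of_nat_Suc)
    qed
    then show "AE x in M. (\<lambda>k. ennreal (nexp (ennreal (?v k) * total x))) \<longlonglongrightarrow>
        indicator {x \<in> space M. total x < \<top>} x"
      by (auto intro!: AE_I2 tendsto_ennrealI simp flip: ennreal_indicator)
  qed (auto simp: M.emeasure_space_1)
  moreover have "(\<lambda>k. \<integral>\<^sup>+x. ennreal (nexp (ennreal (?v k) * total x)) \<partial>M) \<longlonglongrightarrow> ennreal (exp (- \<psi> 0))"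
  proof -
    have "(\<lambda>k. \<psi> (?v k)) \<longlonglongrightarrow> \<psi> 0"
      by (rule continuous_on_tendsto_compose[OF bessel_exponent_continuous[OF \<omega>] LIMSEQ_inverse_real_of_nat]) auto
    then have "(\<lambda>k. ennreal (exp (- \<psi> (?v k)))) \<longlonglongrightarrow> ennreal (exp (- \<psi> 0))"
      by (intro tendsto_ennrealI tendsto_intros)
    then show ?thesis by (subst laplace) auto
  qed
  ultimately have "(\<integral>\<^sup>+x. indicator {x \<in> space M. total x < \<top>} x \<partial>M) = ennreal (exp (- \<psi> 0))"
    by (rule LIMSEQ_unique)
  then have "emeasure M {x \<in> space M. total x < \<top>} = 1"
    using \<omega> by (simp add: bessel_exponent_0)
  then show ?thesis
    by (intro M.AE_I_eq_1) auto
qed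

lemma mass_eq_cell_mass:
  assumes "x \<in> space M" "total x < \<top>" "c < 2 ^ m"
  shows "mass (cell m c) x = ennreal (cell_mass m c x)"
proof -
  have "mass (cell m c) x \<le> (\<Sum>c<2 ^ m. mass (cell m c) x)"
    using assms(3) by (intro member_le_sum) auto
  then have "mass (cell m c) x < \<top>" using assms by (simp add: sum_mass_total)
  then show ?thesis by (simp add: cell_mass_def)
qed

lemma cell_mass_nonneg: "0 \<le> cell_mass m c x"
  by (simp add: cell_mass_def)

lemma sum_cell_mass:
  assumes "x \<in> space M" "total x < \<top>"
  shows "(\<Sum>c<2 ^ m. cell_mass m c x) = enn2real (total x)"
proof -
  have "total x = (\<Sum>c<2 ^ m. mass (cell m c) x)"
    by (rule sum_mass_total[OF assms(1), symmetric])
  also have "\<dots> = (\<Sum>c<2 ^ m. ennreal (cell_mass m c x))"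
    using assms by (intro sum.cong refl mass_eq_cell_mass) auto
  also have "\<dots> = ennreal (\<Sum>c<2 ^ m. cell_mass m c x)"
    by (rule sum_ennreal) (simp add: cell_mass_nonneg)
  finally show ?thesis by (simp add: sum_nonneg cell_mass_nonneg)
qed

lemma measure_normalized_rm_cell:
  assumes "x \<in> space M" "total x < \<top>" "c < 2 ^ m"
  shows "measure (Q x) (cell m c) = cell_mass m c x / enn2real (total x)"
proof -
  have T: "total x = ennreal (enn2real (total x))" "0 < enn2real (total x)"
    using assms total_pos[OF assms(1)] by (auto simp: enn2real_positive_iff)
  have "emeasure (Q x) (cell m c) = mass (cell m c) x / total x"
    using assms by (intro emeasure_normalized_rm) auto
  also have "\<dots> = ennreal (cell_mass m c x) / ennreal (enn2real (total x))"
    using T(1) mass_eq_cell_mass[OF assms] by simp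
  also have "\<dots> = ennreal (cell_mass m c x / enn2real (total x))"
    using T(2) by (intro divide_ennreal cell_mass_nonneg)
  finally show ?thesis by (simp add: measure_def cell_mass_nonneg)
qed

lemma laplace_cell_masses_real:
  assumes u: "\<And>c. 0 < u c"
  shows "(\<integral>x. exp (- (\<Sum>c<2 ^ m. u c * cell_mass m c x)) \<partial>M) = (\<Prod>c<2 ^ m. exp (- (p m c * \<psi> (u c))))"
proof -
  have "(\<integral>\<^sup>+x. ennreal (exp (- (\<Sum>c<2 ^ m. u c * cell_mass m c x))) \<partial>M) =
      (\<integral>\<^sup>+x. ennreal (nexp (\<Sum>c<2 ^ m. ennreal (u c) * mass (cell m c) x)) \<partial>M)"
  proof (rule nn_integral_cong_AE)
    show "AE x in M. ennreal (exp (- (\<Sum>c<2 ^ m. u c * cell_mass m c x))) =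
        ennreal (nexp (\<Sum>c<2 ^ m. ennreal (u c) * mass (cell m c) x))"
      using total_finite AE_space
    proof eventually_elim
      fix x assume x: "total x < \<top>" "x \<in> space M"
      have "(\<Sum>c<2 ^ m. ennreal (u c) * mass (cell m c) x) = (\<Sum>c<2 ^ m. ennreal (u c * cell_mass m c x))"
        using u x by (intro sum.cong refl) (simp add: mass_eq_cell_mass ennreal_mult' less_imp_le)
      also have "\<dots> = ennreal (\<Sum>c<2 ^ m. u c * cell_mass m c x)"
        using u by (intro sum_ennreal mult_nonneg_nonneg cell_mass_nonneg less_imp_le)
      finally show "ennreal (exp (- (\<Sum>c<2 ^ m. u c * cell_mass m c x))) =
        ennreal (nexp (\<Sum>c<2 ^ m. ennreal (u c) * mass (cell m c) x))"
        using u by (simp add: sum_nonneg cell_mass_nonneg less_imp_le)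
    qed
  qed
  then have "(\<integral>\<^sup>+x. ennreal (exp (- (\<Sum>c<2 ^ m. u c * cell_mass m c x))) \<partial>M) =
      ennreal (exp (- (\<Sum>c<2 ^ m. p m c * \<psi> (u c))))"
    by (simp only: laplace_cell_masses[OF u])
  then have "(\<integral>x. exp (- (\<Sum>c<2 ^ m. u c * cell_mass m c x)) \<partial>M) = exp (- (\<Sum>c<2 ^ m. p m c * \<psi> (u c)))"
    by (subst integral_eq_nn_integral) auto
  then show ?thesis by (simp add: exp_sum flip: sum_negf)
qed

text \<open>
  The weight \<open>T ^ n\<close> cancels the normalization of the cell masses, since the block sizes sum to \<open>n\<close>. So each
  labelling contributes a mixed moment of the unnormalized masses. The factors \<open>exp (- p\<^sub>c \<psi>(u))\<close> of all
  cells multiply up to \<open>exp (- \<psi>(u))\<close>, leaving for each block a factor that is, up to second order, linear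
  in the \<open>P\<close>-mass of its cell.
\<close>

lemma tie_prob_laplace:
  assumes n: "n \<ge> 1" and \<A>: "partition_on {1..n} \<A>" and u: "u > 0"
  shows "(\<integral>x. enn2real (total x) ^ n * exp (- (u * enn2real (total x))) * tie_prob (Q x) n \<A> \<partial>M)
    = exp (- \<psi> u) * (\<Prod>B\<in>\<A>. bessel_moment \<omega> \<kappa> (card B) u)"
proof -
  interpret M: prob_space M by (rule prob_M)
  let ?T = "\<lambda>x. enn2real (total x)"
  let ?W = "\<lambda>x. ?T x ^ n * exp (- (u * ?T x))"
  let ?\<beta> = "bessel_moment \<omega> \<kappa>"
  have fin\<A>: "finite \<A>" using \<A> by (auto intro: finite_elements)
  have \<psi>': "(\<psi> has_real_derivative ?\<beta> 1 v) (at v)" if "v > 0" for v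
    using bessel_exponent_deriv[of \<omega> v \<kappa>] bessel_moment_1[of \<omega> v \<kappa>] \<omega> that by simp
  obtain L :: "nat \<Rightarrow> real \<Rightarrow> real \<Rightarrow> real" where L:
    "\<And>p u. L 0 p u = exp (- (p * \<psi> u))"
    "\<And>n p u. u > 0 \<Longrightarrow> (L n p has_real_derivative - L (Suc n) p u) (at u)"
    "\<And>n u. n \<ge> 1 \<Longrightarrow> u > 0 \<Longrightarrow>
       \<exists>C. \<forall>p\<in>{0..1}. \<bar>exp (p * \<psi> u) * L n p u - ?\<beta> n u * p\<bar> \<le> C * p\<^sup>2"
    using exponential_family_expansion[where \<psi> = \<psi> and \<beta> = ?\<beta>, OF \<psi>' bessel_moment_deriv[OF \<omega> \<kappa>]]
    by metis
  let ?h = "\<lambda>B p. exp (p * \<psi> u) * L (card B) p u"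
  have moment: "has_bochner_integral M
      (\<lambda>x. (\<Prod>B\<in>\<A>. cell_mass m (c B) x ^ card B) * exp (- (\<Sum>i<2 ^ m. u * cell_mass m i x)))
      (exp (- \<psi> u) * (\<Prod>B\<in>\<A>. ?h B (p m (c B))))" if c: "c \<in> labellings m \<A>" for m c
  proof -
    let ?k = "block_size \<A> c"
    have c': "c \<in> \<A> \<rightarrow>\<^sub>E {..<2 ^ m}" "inj_on c \<A>" using c by (auto simp: labellings_def)
    have "has_bochner_integral M
        (\<lambda>x. (\<Prod>i<2 ^ m. cell_mass m i x ^ ?k i) * exp (- (\<Sum>i<2 ^ m. u * cell_mass m i x)))
        (\<Prod>i<2 ^ m. L (?k i) (p m i) u)"
      using u
      by (intro laplace_moments_product[where L = "\<lambda>i n. L n (p m i)" and u = "\<lambda>_. u"] M.prob_space_axioms)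
         (auto simp: cell_mass_nonneg laplace_cell_masses_real L)
    moreover have "(\<Prod>i<2 ^ m. cell_mass m i x ^ ?k i) = (\<Prod>B\<in>\<A>. cell_mass m (c B) x ^ card B)" for x
      using c' by (intro prod_block_size[where f = "\<lambda>i j. cell_mass m i x ^ j"]) auto
    moreover have "(\<Prod>i<2 ^ m. L (?k i) (p m i) u) = exp (- \<psi> u) * (\<Prod>B\<in>\<A>. ?h B (p m (c B)))"
    proof -
      have "(\<Prod>B\<in>\<A>. ?h B (p m (c B))) = (\<Prod>i<2 ^ m. exp (p m i * \<psi> u) * L (?k i) (p m i) u)"
        using c' by (intro prod_block_size[where f = "\<lambda>i j. exp (p m i * \<psi> u) * L j (p m i) u", symmetric])
          (auto simp: L(1) simp flip: exp_add)
      also have "\<dots> = exp (\<Sum>i<2 ^ m. p m i * \<psi> u) * (\<Prod>i<2 ^ m. L (?k i) (p m i) u)"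
        by (simp add: prod.distrib exp_sum)
      also have "(\<Sum>i<2 ^ m. p m i * \<psi> u) = \<psi> u"
        by (simp only: sum_prob_cell mult_1 flip: sum_distrib_right)
      finally show ?thesis by (simp add: exp_minus)
    qed
    ultimately show ?thesis by simp
  qed
  have cells: "?W x * cell_tie_prob (Q x) \<A> m =
      (\<Sum>c\<in>labellings m \<A>. (\<Prod>B\<in>\<A>. cell_mass m (c B) x ^ card B) * exp (- (\<Sum>i<2 ^ m. u * cell_mass m i x)))"
    if x: "x \<in> space M" "total x < \<top>" for x m
  proof -
    have T: "?T x > 0" using x total_pos[OF x(1)] by (simp add: enn2real_positive_iff)
    have e: "(\<Sum>i<2 ^ m. u * cell_mass m i x) = u * ?T x"
      using sum_cell_mass[OF x] by (simp flip: sum_distrib_left)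
    have "?T x ^ n * (\<Prod>B\<in>\<A>. measure (Q x) (cell m (c B)) ^ card B) = (\<Prod>B\<in>\<A>. cell_mass m (c B) x ^ card B)"
      if c: "c \<in> labellings m \<A>" for c
    proof -
      have "c B < 2 ^ m" if "B \<in> \<A>" for B using c that by (auto simp: labellings_def)
      then have "(\<Prod>B\<in>\<A>. measure (Q x) (cell m (c B)) ^ card B) =
          (\<Prod>B\<in>\<A>. cell_mass m (c B) x ^ card B / ?T x ^ card B)"
        using x by (intro prod.cong refl) (simp add: measure_normalized_rm_cell power_divide)
      also have "\<dots> = (\<Prod>B\<in>\<A>. cell_mass m (c B) x ^ card B) / ?T x ^ n"
        using sum_card_partition[OF \<A>] by (simp add: prod_dividef flip: power_sum)
      finally show ?thesis using T by simp
    qed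
    then show ?thesis
      unfolding cell_tie_prob_def e sum_distrib_left by (intro sum.cong refl) (simp add: mult_ac)
  qed
  have val: "(\<integral>x. ?W x * cell_tie_prob (Q x) \<A> m \<partial>M) =
      exp (- \<psi> u) * (\<Sum>c\<in>labellings m \<A>. \<Prod>B\<in>\<A>. ?h B (p m (c B)))" for m
  proof -
    have "(\<integral>x. ?W x * cell_tie_prob (Q x) \<A> m \<partial>M) =
      (\<integral>x. (\<Sum>c\<in>labellings m \<A>. (\<Prod>B\<in>\<A>. cell_mass m (c B) x ^ card B) *
         exp (- (\<Sum>i<2 ^ m. u * cell_mass m i x))) \<partial>M)"
    proof (rule integral_cong_AE)
      show "AE x in M. ?W x * cell_tie_prob (Q x) \<A> m = (\<Sum>c\<in>labellings m \<A>.
          (\<Prod>B\<in>\<A>. cell_mass m (c B) x ^ card B) * exp (- (\<Sum>i<2 ^ m. u * cell_mass m i x)))"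
        using total_finite AE_space by eventually_elim (rule cells)
      note measurable_cell_tie_prob[OF normalized_rm_kernel, measurable]
      show "(\<lambda>x. ?W x * cell_tie_prob (Q x) \<A> m) \<in> borel_measurable M" by measurable
    qed measurable
    also have "\<dots> = (\<Sum>c\<in>labellings m \<A>. exp (- \<psi> u) * (\<Prod>B\<in>\<A>. ?h B (p m (c B))))"
      using moment by (subst Bochner_Integration.integral_sum) (auto simp: has_bochner_integral_iff)
    finally show ?thesis by (simp add: sum_distrib_left)
  qed
  have "(\<lambda>m. \<integral>x. ?W x * cell_tie_prob (Q x) \<A> m \<partial>M) \<longlonglongrightarrow> (\<integral>x. ?W x * tie_prob (Q x) n \<A> \<partial>M)"
  proof (rule integral_tie_prob_limit[OF M.finite_measure_axioms normalized_rm_kernel \<A>])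
    show "\<bar>?W x\<bar> \<le> fact n / u ^ n" for x
      using power_times_exp_neg_le[OF u, of "?T x" n] by simp
  qed measurable
  moreover have "(\<lambda>m. exp (- \<psi> u) * (\<Sum>c\<in>labellings m \<A>. \<Prod>B\<in>\<A>. ?h B (p m (c B)))) \<longlonglongrightarrow>
      exp (- \<psi> u) * (\<Prod>B\<in>\<A>. ?\<beta> (card B) u)"
    by (intro tendsto_mult tendsto_const fin\<A> labelling_sum_tendsto[where h = ?h]
          L(3)[OF card_block_pos[OF \<A>] u])
  ultimately show ?thesis
    unfolding val by (rule LIMSEQ_unique)
qed

text \<open>
  Insert the integral for \<open>1 / T ^ n\<close> into the mean tie probability, swap the integrals, and apply
  \<open>tie_prob_laplace\<close> for each \<open>u\<close>.
\<close>

lemma eppf_normalized_bessel: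
  assumes n: "n \<ge> 1" and \<A>: "partition_on {1..n} \<A>"
  shows "eppf M Q n \<A> = (LINT u:{0<..}|lborel. u ^ (n - 1) / Gamma (real n) *
     (exp (- \<psi> u) * (\<Prod>B\<in>\<A>. bessel_moment \<omega> \<kappa> (card B) u)))"
proof -
  interpret M: prob_space M by (rule prob_M)
  interpret pair_sigma_finite lborel M ..
  define T where "T x = enn2real (total x)" for x
  define R where "R u = exp (- \<psi> u) * (\<Prod>B\<in>\<A>. bessel_moment \<omega> \<kappa> (card B) u)" for u
  define \<pi> where "\<pi> x = tie_prob (Q x) n \<A>" for x
  have [measurable]: "T \<in> borel_measurable M" "R \<in> borel_measurable borel"
    unfolding T_def R_def by measurable
  have [measurable]: "\<pi> \<in> borel_measurable M"
    unfolding \<pi>_def by (rule eppf_eq_integral_tie_prob(2)[OF prob_M normalized_rm_kernel n \<A>])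
  have T_nn: "0 \<le> T x" for x by (simp add: T_def)
  have tie_nn: "0 \<le> \<pi> x" for x by (simp add: \<pi>_def tie_prob_def)
  have tie_le: "\<pi> x \<le> 1" if "x \<in> space M" for x
    unfolding \<pi>_def using kernel_properties[OF normalized_rm_kernel that] \<A>
    by (intro LIMSEQ_le_const2[OF cell_tie_prob_tendsto] exI[of _ 0] allI impI cell_tie_prob_bounds)
  define w where "w u = ennreal (u ^ (n - 1) / Gamma (real n)) * indicator {0<..} u" for u :: real
  define g where "g u x = ennreal (T x ^ n * exp (- (u * T x)) * \<pi> x)" for u x
  have [measurable]: "w \<in> borel_measurable borel" "(\<lambda>(u, x). g u x) \<in> borel_measurable (borel \<Otimes>\<^sub>M M)"
    unfolding w_def g_def by measurable
  have Gn: "Gamma (real n) > 0" using n by (intro Gamma_real_pos) auto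
  have "(\<integral>\<^sup>+x. ennreal (\<pi> x) \<partial>M) = (\<integral>\<^sup>+x. \<integral>\<^sup>+u. w u * g u x \<partial>lborel \<partial>M)"
  proof (rule nn_integral_cong_AE)
    show "AE x in M. ennreal (\<pi> x) = (\<integral>\<^sup>+u. w u * g u x \<partial>lborel)"
      using total_finite AE_space
    proof eventually_elim
      fix x assume x: "total x < \<top>" "x \<in> space M"
      have T: "T x > 0" using x total_pos[OF x(2)] by (simp add: T_def enn2real_positive_iff)
      have "ennreal (\<pi> x) = ennreal (T x ^ n * \<pi> x * (1 / T x ^ n))"
        using T by simp
      also have "\<dots> = ennreal (T x ^ n * \<pi> x) * ennreal (1 / T x ^ n)"
        using T tie_nn by (intro ennreal_mult) auto
      also have "\<dots> = (\<integral>\<^sup>+u. ennreal (T x ^ n * \<pi> x) *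
          (ennreal (u ^ (n - 1) / Gamma (real n) * exp (- (u * T x))) * indicator {0<..} u) \<partial>lborel)"
        unfolding inverse_power_eq_nn_integral[OF n T] by (rule nn_integral_cmult[symmetric]) measurable
      also have "\<dots> = (\<integral>\<^sup>+u. w u * g u x \<partial>lborel)"
      proof (intro nn_integral_cong)
        fix u :: real
        have "ennreal (u ^ (n - 1) / Gamma (real n) * exp (- (u * T x))) =
            ennreal (u ^ (n - 1) / Gamma (real n)) * ennreal (exp (- (u * T x)))"
          by (intro ennreal_mult'') simp
        moreover have "g u x = ennreal (T x ^ n * \<pi> x) * ennreal (exp (- (u * T x)))"
          unfolding g_def using T tie_nn by (subst ennreal_mult[symmetric]) (auto simp: mult_ac)
        ultimately show "ennreal (T x ^ n * \<pi> x) *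
          (ennreal (u ^ (n - 1) / Gamma (real n) * exp (- (u * T x))) * indicator {0<..} u) = w u * g u x"
          by (simp only: w_def mult_ac)
      qed
      finally show "ennreal (\<pi> x) = (\<integral>\<^sup>+u. w u * g u x \<partial>lborel)" .
    qed
  qed
  also have "\<dots> = (\<integral>\<^sup>+u. \<integral>\<^sup>+x. w u * g u x \<partial>M \<partial>lborel)"
    by (rule Fubini') measurable
  also have "\<dots> = (\<integral>\<^sup>+u. ennreal (indicator {0<..} u * (u ^ (n - 1) / Gamma (real n) * R u)) \<partial>lborel)"
  proof (intro nn_integral_cong)
    fix u :: real
    show "(\<integral>\<^sup>+x. w u * g u x \<partial>M) = ennreal (indicator {0<..} u * (u ^ (n - 1) / Gamma (real n) * R u))"
    proof (cases "u > 0")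
      case True
      have "(\<integral>\<^sup>+x. w u * g u x \<partial>M) = w u * (\<integral>\<^sup>+x. g u x \<partial>M)"
        by (rule nn_integral_cmult) measurable
      also have "(\<integral>\<^sup>+x. g u x \<partial>M) = ennreal (\<integral>x. T x ^ n * exp (- (u * T x)) * \<pi> x \<partial>M)"
        unfolding g_def
      proof (rule nn_integral_eq_integral)
        show "integrable M (\<lambda>x. T x ^ n * exp (- (u * T x)) * \<pi> x)"
        proof (rule M.integrable_const_bound[where B = "fact n / u ^ n * 1"])
          show "AE x in M. norm (T x ^ n * exp (- (u * T x)) * \<pi> x) \<le> fact n / u ^ n * 1"
          proof (rule AE_I2)
            fix x assume x: "x \<in> space M"
            have "T x ^ n * exp (- (u * T x)) * \<pi> x \<le> fact n / u ^ n * 1"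
              using power_times_exp_neg_le[OF True T_nn, of x n] tie_le[OF x] tie_nn True
              by (intro mult_mono) auto
            then show "norm (T x ^ n * exp (- (u * T x)) * \<pi> x) \<le> fact n / u ^ n * 1"
              using tie_nn T_nn by (simp add: abs_mult)
          qed
        qed measurable
      qed (use tie_nn T_nn in auto)
      also have "\<dots> = ennreal (R u)"
        unfolding T_def \<pi>_def R_def tie_prob_laplace[OF n \<A> True] ..
      also have "w u * ennreal (R u) = ennreal (u ^ (n - 1) / Gamma (real n) * R u)"
        using True Gn unfolding w_def by (subst ennreal_mult') auto
      finally show ?thesis using True by simp
    qed (simp add: w_def)
  qed
  finally have "(\<integral>\<^sup>+x. ennreal (\<pi> x) \<partial>M) =
      (\<integral>\<^sup>+u. ennreal (indicator {0<..} u * (u ^ (n - 1) / Gamma (real n) * R u)) \<partial>lborel)" .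
  moreover have "(\<integral>x. \<pi> x \<partial>M) = enn2real (\<integral>\<^sup>+x. ennreal (\<pi> x) \<partial>M)"
    using tie_nn by (intro integral_eq_nn_integral) auto
  moreover have "(LINT u:{0<..}|lborel. u ^ (n - 1) / Gamma (real n) * R u) =
      enn2real (\<integral>\<^sup>+u. ennreal (indicator {0<..} u * (u ^ (n - 1) / Gamma (real n) * R u)) \<partial>lborel)"
    unfolding set_lebesgue_integral_def real_scaleR_def
  proof (rule integral_eq_nn_integral)
    show "AE u in lborel. 0 \<le> indicator {0<..} u * (u ^ (n - 1) / Gamma (real n) * R u)"
    proof (rule AE_I2)
      fix u :: real
      show "0 \<le> indicator {0<..} u * (u ^ (n - 1) / Gamma (real n) * R u)"
      proof (cases "u > 0")
        case True
        have "0 \<le> R u"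
          unfolding R_def tie_prob_laplace[OF n \<A> True, symmetric]
            by (intro integral_nonneg_AE AE_I2 mult_nonneg_nonneg) (auto simp: tie_prob_def)
        then show ?thesis using True Gn by simp
      qed simp
    qed
  qed measurable
  ultimately show ?thesis
    unfolding R_def by (simp add: eppf_eq_integral_tie_prob(1)[OF prob_M normalized_rm_kernel n \<A>] \<pi>_def)
qed

end

section \<open>The limit of large parameters\<close>

lemma hypergeo_parameters_pos:
  assumes "(n::nat) > 0"
  shows "real n / 2 > 0" "(real n + 1) / 2 > 0"
  using assms by auto

text \<open>
  After the substitution \<open>u = \<omega> v\<close> dominated convergence applies. The quotient under the exponent \<open>\<kappa>\<close>
  tends to \<open>1 / (1 + v)\<close> and is at most \<open>2 / (1 + v)\<close>; for \<open>\<omega> \<ge> 2\<close> the argument of the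
  hypergeometric series is at most \<open>1 / 4\<close>.
\<close>

lemma p_B_tendsto_p_D:
  assumes \<kappa>: "\<kappa> > 0" and ns: "ns \<noteq> []" "\<forall>m\<in>set ns. m > 0"
  shows "((\<lambda>\<omega>. p_B ns \<omega> \<kappa>) \<longlongrightarrow> p_D ns \<kappa>) at_top"
proof -
  define n where "n = sum_list ns"
  define k where "k = length ns"
  have n: "n \<ge> 1"
  proof -
    obtain m where m: "m \<in> set ns" using ns(1) by (cases ns) auto
    then have "m \<le> n" unfolding n_def by (intro member_le_sum_list) auto
    then show ?thesis using m ns(2) by fastforce
  qed
  have ns_pos: "ns ! j > 0" if "j < k" for j
    using ns(2) that by (simp add: k_def)
  have Gn: "Gamma (real n) > 0" using n by (intro Gamma_real_pos) auto
  let ?F = "\<lambda>j z. hypergeo_2F1 (real (ns ! j) / 2) ((real (ns ! j) + 1) / 2) 1 z"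
  define ratio where "ratio \<omega> u = (\<omega> + sqrt (\<omega>\<^sup>2 - 1)) / (\<omega> + u + sqrt ((\<omega> + u)\<^sup>2 - 1))" for \<omega> u :: real
  define g where "g \<omega> u = u ^ (n - 1) / Gamma (real n) * ratio \<omega> u powr \<kappa> * (1 / (u + \<omega>) ^ n) *
     (\<Prod>j<k. Gamma (real (ns ! j)) * ?F j (1 / (u + \<omega>)\<^sup>2))" for \<omega> u
  have p_B: "p_B ns \<omega> \<kappa> = \<kappa> ^ k * (LINT u:{0<..}|lborel. g \<omega> u)" for \<omega>
    by (simp add: p_B_def g_def ratio_def n_def k_def Let_def)
  have [measurable]: "g \<omega> \<in> borel_measurable borel" for \<omega>
    unfolding g_def ratio_def by measurable
  define h where "h \<omega> v = indicator {0<..} v * (v ^ (n - 1) / Gamma (real n) * ratio \<omega> (\<omega> * v) powr \<kappa> *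
     (1 / (1 + v) ^ n) * (\<Prod>j<k. Gamma (real (ns ! j)) * ?F j (1 / (\<omega> * v + \<omega>)\<^sup>2)))" for \<omega> v :: real
  define h\<^sub>0 where "h\<^sub>0 v = indicator {0<..} v * (v ^ (n - 1) / Gamma (real n) * (1 + v) powr (- (\<kappa> + real n)) *
     (\<Prod>j<k. Gamma (real (ns ! j))))" for v :: real
  have scale: "(LINT u:{0<..}|lborel. g \<omega> u) = (\<integral>v. h \<omega> v \<partial>lborel)" if \<omega>: "\<omega> > 0" for \<omega>
  proof -
    have "(LINT u:{0<..}|lborel. g \<omega> u) =
        \<bar>\<omega>\<bar> *\<^sub>R (\<integral>v. indicator {0<..} (0 + \<omega> * v) *\<^sub>R g \<omega> (0 + \<omega> * v) \<partial>lborel)"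
      unfolding set_lebesgue_integral_def using \<omega> by (intro lborel_integral_real_affine) auto
    also have "\<dots> = (\<integral>v. \<omega> * (indicator {0<..} (\<omega> * v) * g \<omega> (\<omega> * v)) \<partial>lborel)"
      using \<omega> by simp
    also have "\<dots> = (\<integral>v. h \<omega> v \<partial>lborel)"
    proof (intro Bochner_Integration.integral_cong refl)
      fix v :: real
      show "\<omega> * (indicator {0<..} (\<omega> * v) * g \<omega> (\<omega> * v)) = h \<omega> v"
      proof (cases "v > 0")
        case True
        have "\<omega> * ((\<omega> * v) ^ (n - 1) * (1 / (\<omega> * v + \<omega>) ^ n)) = v ^ (n - 1) * (1 / (1 + v) ^ n)"
        proof -
          have "\<omega> * v + \<omega> = \<omega> * (1 + v)" by (simp add: algebra_simps)
          then have "(\<omega> * v + \<omega>) ^ n = \<omega> ^ n * (1 + v) ^ n"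
            by (simp only: power_mult_distrib)
          moreover have "\<omega> * (\<omega> * v) ^ (n - 1) = \<omega> ^ n * v ^ (n - 1)"
            using n power_eq_if[of \<omega> n] by (simp add: power_mult_distrib)
          moreover have "\<omega> * ((\<omega> * v) ^ (n - 1) * (1 / (\<omega> * v + \<omega>) ^ n)) =
              \<omega> * (\<omega> * v) ^ (n - 1) / (\<omega> * v + \<omega>) ^ n"
            by simp
          ultimately show ?thesis using \<omega> by simp
        qed
        moreover have "\<omega> * (A / G * R * B * Q) = \<omega> * (A * B) / G * R * Q" for A G R B Q :: real
          by (simp add: mult_ac)
        ultimately have "\<omega> * g \<omega> (\<omega> * v) = v ^ (n - 1) * (1 / (1 + v) ^ n) / Gamma (real n) * ratio \<omega> (\<omega> * v) powr \<kappa> *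
            (\<Prod>j<k. Gamma (real (ns ! j)) * ?F j (1 / (\<omega> * v + \<omega>)\<^sup>2))"
          unfolding g_def by (simp only:)
        then show ?thesis using True \<omega> by (simp add: h_def zero_less_mult_iff)
      next
        case False
        then have "\<not> \<omega> * v > 0" using \<omega> by (simp add: zero_less_mult_iff)
        then show ?thesis using False by (simp add: h_def)
      qed
    qed
    finally show ?thesis .
  qed
  define K where "K = 2 powr \<kappa> * (\<Prod>j<k. Gamma (real (ns ! j)) * ?F j (1 / 4))"
  define w where "w v = indicator {0<..} v * (v ^ (n - 1) / Gamma (real n) * (1 + v) powr (- (\<kappa> + real n)))" for v :: real
  have w_int: "integrable lborel w" "(\<integral>v. w v \<partial>lborel) = Gamma \<kappa> / Gamma (\<kappa> + real n)"
  proof -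
    have "(\<integral>\<^sup>+v. ennreal (w v) \<partial>lborel) = (\<integral>\<^sup>+v. ennreal (v ^ (n - 1) / Gamma (real n) *
        (1 + v) powr (- (\<kappa> + real n))) * indicator {0<..} v \<partial>lborel)"
      by (intro nn_integral_cong) (auto simp: w_def split: split_indicator)
    then have "(\<integral>\<^sup>+v. ennreal (w v) \<partial>lborel) = ennreal (Gamma \<kappa> / Gamma (\<kappa> + real n))"
      by (simp only: nn_integral_beta_prime[OF n \<kappa>])
    moreover have "0 \<le> w v" for v using Gn by (auto simp: w_def indicator_def)
    moreover have "0 \<le> Gamma \<kappa> / Gamma (\<kappa> + real n)"
      using \<kappa> by (intro divide_nonneg_nonneg Gamma_real_nonneg) auto
    moreover have "w \<in> borel_measurable lborel" unfolding w_def by measurable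
    ultimately have "has_bochner_integral lborel w (Gamma \<kappa> / Gamma (\<kappa> + real n))"
      by (intro has_bochner_integral_nn_integral) auto
    then show "integrable lborel w" "(\<integral>v. w v \<partial>lborel) = Gamma \<kappa> / Gamma (\<kappa> + real n)"
      by (auto simp: has_bochner_integral_iff)
  qed
  have powr_split: "(1 + v) powr (- (\<kappa> + real n)) = (1 / (1 + v)) powr \<kappa> * (1 / (1 + v) ^ n)" if "v > 0" for v
    unfolding powr_minus_divide using that by (simp add: powr_add powr_realpow powr_divide)
  have lim_ratio: "((\<lambda>\<omega>. ratio \<omega> (\<omega> * v)) \<longlongrightarrow> 1 / (1 + v)) at_top" if "v > 0" for v
  proof -
    have "\<forall>\<^sub>F \<omega> in at_top. (1 + sqrt (1 - 1 / \<omega>\<^sup>2)) / (1 + v + sqrt ((1 + v)\<^sup>2 - 1 / \<omega>\<^sup>2)) = ratio \<omega> (\<omega> * v)"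
      using eventually_gt_at_top[of 0]
    proof eventually_elim
      fix \<omega> :: real assume \<omega>: "\<omega> > 0"
      have "sqrt (\<omega>\<^sup>2 - 1) = \<omega> * sqrt (1 - 1 / \<omega>\<^sup>2)"
      proof -
        have "\<omega>\<^sup>2 - 1 = \<omega>\<^sup>2 * (1 - 1 / \<omega>\<^sup>2)" using \<omega> by (simp add: field_simps)
        then show ?thesis using \<omega> by (simp only: real_sqrt_mult real_sqrt_abs abs_of_pos)
      qed
      moreover have "sqrt ((\<omega> + \<omega> * v)\<^sup>2 - 1) = \<omega> * sqrt ((1 + v)\<^sup>2 - 1 / \<omega>\<^sup>2)"
      proof -
        have "(\<omega> + \<omega> * v)\<^sup>2 = \<omega>\<^sup>2 * (1 + v)\<^sup>2" by (simp add: power2_eq_square algebra_simps)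
        then have "(\<omega> + \<omega> * v)\<^sup>2 - 1 = \<omega>\<^sup>2 * ((1 + v)\<^sup>2 - 1 / \<omega>\<^sup>2)"
          using \<omega> by (simp add: right_diff_distrib)
        then show ?thesis using \<omega> by (simp only: real_sqrt_mult real_sqrt_abs abs_of_pos)
      qed
      ultimately have "ratio \<omega> (\<omega> * v) = (\<omega> * (1 + sqrt (1 - 1 / \<omega>\<^sup>2))) / (\<omega> * (1 + v + sqrt ((1 + v)\<^sup>2 - 1 / \<omega>\<^sup>2)))"
        by (simp add: ratio_def algebra_simps)
      then show "(1 + sqrt (1 - 1 / \<omega>\<^sup>2)) / (1 + v + sqrt ((1 + v)\<^sup>2 - 1 / \<omega>\<^sup>2)) = ratio \<omega> (\<omega> * v)"
        using \<omega> by simp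
    qed
    moreover have "((\<lambda>\<omega>. (1 + sqrt (1 - 1 / \<omega>\<^sup>2)) / (1 + v + sqrt ((1 + v)\<^sup>2 - 1 / \<omega>\<^sup>2))) \<longlongrightarrow>
        (1 + sqrt (1 - 0)) / (1 + v + sqrt ((1 + v)\<^sup>2 - 0))) at_top"
    proof -
      have "((\<lambda>\<omega> :: real. 1 / \<omega>\<^sup>2) \<longlongrightarrow> 0) at_top" by real_asymp
      then show ?thesis using that by (intro tendsto_intros) auto
    qed
    ultimately have "((\<lambda>\<omega>. ratio \<omega> (\<omega> * v)) \<longlongrightarrow> (1 + sqrt (1 - 0)) / (1 + v + sqrt ((1 + v)\<^sup>2 - 0))) at_top"
      by (rule Lim_transform_eventually[rotated])
    moreover have "(1 + sqrt (1 - 0)) / (1 + v + sqrt ((1 + v)\<^sup>2 - 0)) = 1 / (1 + v)"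
      using that by (simp add: field_simps)
    ultimately show ?thesis by simp
  qed
  have lim_F: "((\<lambda>\<omega>. ?F j (1 / (\<omega> * v + \<omega>)\<^sup>2)) \<longlongrightarrow> 1) at_top" if "v > 0" "j < k" for v j
  proof -
    have "((\<lambda>\<omega>. 1 / (\<omega> * v + \<omega>)\<^sup>2) \<longlongrightarrow> 0) at_top" using that(1) by real_asymp
    then have "((\<lambda>\<omega>. ?F j (1 / (\<omega> * v + \<omega>)\<^sup>2)) \<longlongrightarrow> ?F j 0) at_top"
      using isCont_hypergeo_2F1_0[OF hypergeo_parameters_pos[OF ns_pos[OF that(2)]]]
      by (rule isCont_tendsto_compose[rotated])
    then show ?thesis by (simp add: hypergeo_2F1_at_0)
  qed
  have h_lim: "((\<lambda>\<omega>. h \<omega> v) \<longlongrightarrow> h\<^sub>0 v) at_top" for v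
  proof (cases "v > 0")
    case True
    have "((\<lambda>\<omega>. v ^ (n - 1) / Gamma (real n) * ratio \<omega> (\<omega> * v) powr \<kappa> *
        (1 / (1 + v) ^ n) * (\<Prod>j<k. Gamma (real (ns ! j)) * ?F j (1 / (\<omega> * v + \<omega>)\<^sup>2))) \<longlongrightarrow>
        v ^ (n - 1) / Gamma (real n) * (1 / (1 + v)) powr \<kappa> * (1 / (1 + v) ^ n) *
          (\<Prod>j<k. Gamma (real (ns ! j)) * 1)) at_top"
      using True by (intro tendsto_mult tendsto_const tendsto_powr tendsto_prod lim_ratio lim_F) auto
    then show ?thesis
      using True powr_split[OF True] by (simp add: h_def h\<^sub>0_def mult.assoc)
  qed (simp add: h_def h\<^sub>0_def)
  have h_bound: "\<bar>h \<omega> v\<bar> \<le> K * w v" if \<omega>: "\<omega> \<ge> 2" for \<omega> v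
  proof (cases "v > 0")
    case True
    have \<omega>1: "\<omega>\<^sup>2 \<ge> 1" using \<omega> by (intro one_le_power) auto
    have "\<omega> + \<omega> * v \<ge> \<omega>" using \<omega> True by simp
    then have \<omega>v1: "(\<omega> + \<omega> * v)\<^sup>2 \<ge> 1" using \<omega> by (intro one_le_power) linarith
    have "sqrt (\<omega>\<^sup>2 - 1) \<le> sqrt (\<omega>\<^sup>2)" by (rule real_sqrt_le_mono) simp
    then have num: "\<omega> + sqrt (\<omega>\<^sup>2 - 1) \<le> 2 * \<omega>" using \<omega> by simp
    have den: "\<omega> * (1 + v) \<le> \<omega> + \<omega> * v + sqrt ((\<omega> + \<omega> * v)\<^sup>2 - 1)"
      using \<omega>v1 by (simp add: distrib_left)
    have dpos: "0 < \<omega> * (1 + v)" using \<omega> True by simp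
    have r0: "0 \<le> ratio \<omega> (\<omega> * v)"
      unfolding ratio_def using \<omega>1 \<omega> \<omega>v1 True
      by (intro divide_nonneg_nonneg add_nonneg_nonneg) auto
    have "ratio \<omega> (\<omega> * v) \<le> (2 * \<omega>) / (\<omega> * (1 + v))"
      unfolding ratio_def using num den dpos \<omega> by (intro frac_le) auto
    also have "\<dots> = 2 * (1 / (1 + v))" using \<omega> by simp
    finally have "ratio \<omega> (\<omega> * v) powr \<kappa> \<le> (2 * (1 / (1 + v))) powr \<kappa>"
      using r0 \<kappa> by (intro powr_mono2) auto
    also have "\<dots> = 2 powr \<kappa> * (1 / (1 + v)) powr \<kappa>"
      using True by (intro powr_mult)
    finally have r: "ratio \<omega> (\<omega> * v) powr \<kappa> \<le> 2 powr \<kappa> * (1 / (1 + v)) powr \<kappa>" .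
    have z: "1 / (\<omega> * v + \<omega>)\<^sup>2 \<le> 1 / 4"
    proof -
      have "2 \<le> \<omega> * v + \<omega>" using \<omega> True by (simp add: add_increasing)
      then have "2\<^sup>2 \<le> (\<omega> * v + \<omega>)\<^sup>2" by (intro power_mono) auto
      then show ?thesis by (intro divide_left_mono) auto
    qed
    have F: "0 \<le> ?F j (1 / (\<omega> * v + \<omega>)\<^sup>2)" "?F j (1 / (\<omega> * v + \<omega>)\<^sup>2) \<le> ?F j (1 / 4)" if "j < k" for j
      using z hypergeo_parameters_pos[OF ns_pos[OF that]]
      by (intro hypergeo_2F1_nonneg hypergeo_2F1_mono; force)+
    have G: "0 \<le> Gamma (real (ns ! j))" if "j < k" for j
      using ns_pos[OF that] by (intro Gamma_real_nonneg) auto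
    have prod: "0 \<le> (\<Prod>j<k. Gamma (real (ns ! j)) * ?F j (1 / (\<omega> * v + \<omega>)\<^sup>2))"
      "(\<Prod>j<k. Gamma (real (ns ! j)) * ?F j (1 / (\<omega> * v + \<omega>)\<^sup>2)) \<le> (\<Prod>j<k. Gamma (real (ns ! j)) * ?F j (1 / 4))"
      by (intro prod_nonneg prod_mono mult_nonneg_nonneg mult_left_mono conjI F G ballI; simp add: F G)+
    have "\<bar>h \<omega> v\<bar> = h \<omega> v"
      unfolding h_def using True Gn prod(1) by (intro abs_of_nonneg mult_nonneg_nonneg) auto
    also have "h \<omega> v = v ^ (n - 1) / Gamma (real n) * ratio \<omega> (\<omega> * v) powr \<kappa> *
        (1 / (1 + v) ^ n) * (\<Prod>j<k. Gamma (real (ns ! j)) * ?F j (1 / (\<omega> * v + \<omega>)\<^sup>2))"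
      using True by (simp add: h_def)
    also have "\<dots> \<le> v ^ (n - 1) / Gamma (real n) * (2 powr \<kappa> * (1 / (1 + v)) powr \<kappa>) *
        (1 / (1 + v) ^ n) * (\<Prod>j<k. Gamma (real (ns ! j)) * ?F j (1 / 4))"
      by (intro mult_mono r prod order_refl) (use True Gn in auto)
    also have "\<dots> = K * w v"
      using True powr_split[OF True] by (simp add: K_def w_def)
    finally show ?thesis .
  qed (simp add: h_def w_def)
  have "((\<lambda>\<omega>. \<integral>v. h \<omega> v \<partial>lborel) \<longlongrightarrow> (\<integral>v. h\<^sub>0 v \<partial>lborel)) at_top"
  proof (rule integral_dominated_convergence_at_top[where w = "\<lambda>v. K * w v"])
    show "integrable lborel (\<lambda>v. K * w v)" by (intro integrable_mult_right w_int)
    show "\<forall>\<^sub>F \<omega> in at_top. AE v in lborel. norm (h \<omega> v) \<le> K * w v"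
      using eventually_ge_at_top[of 2] by eventually_elim (auto intro!: AE_I2 h_bound)
    show "h \<omega> \<in> borel_measurable lborel" for \<omega> unfolding h_def ratio_def by measurable
    show "h\<^sub>0 \<in> borel_measurable lborel" unfolding h\<^sub>0_def by measurable
  qed (use h_lim in auto)
  moreover have "h\<^sub>0 v = w v * (\<Prod>j<k. Gamma (real (ns ! j)))" for v
    by (simp add: h\<^sub>0_def w_def)
  then have "(\<integral>v. h\<^sub>0 v \<partial>lborel) = Gamma \<kappa> / Gamma (\<kappa> + real n) * (\<Prod>j<k. Gamma (real (ns ! j)))"
    using w_int by simp
  ultimately have lim: "((\<lambda>\<omega>. \<kappa> ^ k * (\<integral>v. h \<omega> v \<partial>lborel)) \<longlongrightarrow>
      \<kappa> ^ k * (Gamma \<kappa> / Gamma (\<kappa> + real n) * (\<Prod>j<k. Gamma (real (ns ! j))))) at_top"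
    by (intro tendsto_mult tendsto_const) simp
  have p_D: "\<kappa> ^ k * (Gamma \<kappa> / Gamma (\<kappa> + real n) * (\<Prod>j<k. Gamma (real (ns ! j)))) = p_D ns \<kappa>"
    by (simp add: p_D_def n_def k_def Let_def)
  have "\<forall>\<^sub>F \<omega> in at_top. \<kappa> ^ k * (\<integral>v. h \<omega> v \<partial>lborel) = p_B ns \<omega> \<kappa>"
    using eventually_gt_at_top[of 0] by eventually_elim (simp add: p_B scale)
  with lim[unfolded p_D] show ?thesis
    by (rule Lim_transform_eventually)
qed

section \<open>The two eppfs and their limit\<close>

text \<open>
  The sets of a countable base of the topology separate points.
\<close>

lemma ex_coded_space:
  fixes P :: "'a :: euclidean_space measure"
  assumes P: "prob_space P" and sets: "sets P = sets (restrict_space borel \<Theta>)"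
    and atoms: "\<forall>x\<in>\<Theta>. measure P {x} = 0"
  shows "\<exists>q. coded_space P q"
proof -
  have "\<exists>U :: nat \<Rightarrow> 'a set. (\<forall>i. open (U i)) \<and> (\<forall>S. open S \<longrightarrow> (\<exists>k. S = \<Union>{U i |i. i \<in> k}))"
  proof (rule univ_second_countable_sequence)
    fix B :: "nat \<Rightarrow> 'a set"
    assume "\<And>n. open (B n)" "\<And>S. open S \<Longrightarrow> \<exists>k. S = \<Union>{B n |n. n \<in> k}"
    then show ?thesis by (intro exI[of _ B]) simp
  qed
  then obtain U :: "nat \<Rightarrow> 'a set" where U: "\<forall>i. open (U i)"
      "\<forall>S. open S \<longrightarrow> (\<exists>k. S = \<Union>{U i |i. i \<in> k})"
    by (elim exE conjE)
  have id: "(\<lambda>x. x) \<in> borel_measurable P"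
    unfolding measurable_cong_sets[OF sets refl] by (intro measurable_restrict_space1) simp
  have "coded_space P (set_code U)"
  proof (intro coded_space.intro coded_space_axioms.intro P id)
    show "set_code U m \<in> measurable P (count_space UNIV)" for m
    proof (rule measurable_compose[OF id])
      show "set_code U m \<in> measurable borel (count_space UNIV)"
        by (rule measurable_set_code) (simp add: U(1))
    qed
    show "set_code U m x < 2 ^ m" for m x by (rule set_code_less)
    show "\<forall>\<^sub>F m in sequentially. set_code U m x \<noteq> set_code U m y" if "x \<noteq> y" for x y
    proof -
      obtain k where k: "- {y} = \<Union>{U i |i. i \<in> k}" using U(2)[rule_format, of "- {y}"] by auto
      have "x \<in> - {y}" using that by simp
      then obtain i where "i \<in> k" "x \<in> U i" unfolding k by blast
      moreover have "y \<notin> U i" using \<open>i \<in> k\<close> k by blast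
      ultimately show ?thesis using set_code_separates by metis
    qed
    show "measure P {x} = 0" if "x \<in> space P" for x
    proof -
      have "space P = \<Theta>" using sets_eq_imp_space_eq[OF sets] by (simp add: space_restrict_space)
      then show ?thesis using atoms that by simp
    qed
  qed
  then show ?thesis by blast
qed

lemma prod_blocks:
  fixes f :: "nat \<Rightarrow> real"
  assumes "image_mset card (mset_set \<A>) = mset ns"
  shows "(\<Prod>B\<in>\<A>. f (card B)) = (\<Prod>j<length ns. f (ns ! j))"
proof -
  have "(\<Prod>B\<in>\<A>. f (card B)) = prod_mset (image_mset f (image_mset card (mset_set \<A>)))"
    by (simp add: prod_unfold_prod_mset image_mset.compositionality comp_def)
  also have "\<dots> = prod_list (map f ns)"
    by (simp add: assms prod_mset_prod_list flip: mset_map)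
  also have "\<dots> = (\<Prod>j<length ns. f (ns ! j))"
    by (simp add: prod.list_conv_set_nth lessThan_atLeast0)
  finally show ?thesis .
qed

lemma p_B_eq_integral_moments:
  assumes ns: "image_mset card (mset_set \<A>) = mset ns" and \<omega>: "\<omega> \<ge> 1"
  shows "p_B ns \<omega> \<kappa> = (LINT u:{0<..}|lborel. u ^ (sum_list ns - 1) / Gamma (real (sum_list ns)) *
     (exp (- bessel_exponent \<omega> \<kappa> u) * (\<Prod>B\<in>\<A>. bessel_moment \<omega> \<kappa> (card B) u)))"
proof -
  let ?n = "sum_list ns" and ?k = "length ns"
  let ?F = "\<lambda>j u. Gamma (real (ns ! j)) *
      hypergeo_2F1 (real (ns ! j) / 2) ((real (ns ! j) + 1) / 2) 1 (1 / (u + \<omega>)\<^sup>2)"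
  have "p_B ns \<omega> \<kappa> = (LINT u:{0<..}|lborel. \<kappa> ^ ?k * (u ^ (?n - 1) / Gamma (real ?n) *
         ((\<omega> + sqrt (\<omega>\<^sup>2 - 1)) / (\<omega> + u + sqrt ((\<omega> + u)\<^sup>2 - 1))) powr \<kappa> *
         (1 / (u + \<omega>) ^ ?n) * (\<Prod>j<?k. ?F j u)))"
    unfolding p_B_def Let_def by (rule set_integral_mult_right[symmetric])
  also have "\<dots> = (LINT u:{0<..}|lborel. u ^ (?n - 1) / Gamma (real ?n) *
     (exp (- bessel_exponent \<omega> \<kappa> u) * (\<Prod>B\<in>\<A>. bessel_moment \<omega> \<kappa> (card B) u)))"
  proof (rule set_lebesgue_integral_cong)
    show "\<forall>u. u \<in> {0<..} \<longrightarrow> \<kappa> ^ ?k * (u ^ (?n - 1) / Gamma (real ?n) *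
         ((\<omega> + sqrt (\<omega>\<^sup>2 - 1)) / (\<omega> + u + sqrt ((\<omega> + u)\<^sup>2 - 1))) powr \<kappa> *
         (1 / (u + \<omega>) ^ ?n) * (\<Prod>j<?k. ?F j u)) =
       u ^ (?n - 1) / Gamma (real ?n) *
         (exp (- bessel_exponent \<omega> \<kappa> u) * (\<Prod>B\<in>\<A>. bessel_moment \<omega> \<kappa> (card B) u))"
    proof (intro allI impI)
      fix u :: real assume "u \<in> {0<..}"
      then have u: "u > 0" by simp
      have "(\<Prod>B\<in>\<A>. bessel_moment \<omega> \<kappa> (card B) u) = (\<Prod>j<?k. bessel_moment \<omega> \<kappa> (ns ! j) u)"
        by (rule prod_blocks[OF ns])
      also have "\<dots> = (\<Prod>j<?k. \<kappa> * (1 / (u + \<omega>) ^ (ns ! j)) * ?F j u)"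
        by (intro prod.cong refl) (simp add: bessel_moment_def)
      also have "\<dots> = \<kappa> ^ ?k * (1 / (u + \<omega>) ^ (\<Sum>j<?k. ns ! j)) * (\<Prod>j<?k. ?F j u)"
        by (simp add: prod.distrib power_sum prod_dividef)
      also have "(\<Sum>j<?k. ns ! j) = ?n"
        by (simp add: sum_list_sum_nth lessThan_atLeast0)
      finally have e: "(\<Prod>B\<in>\<A>. bessel_moment \<omega> \<kappa> (card B) u) =
          \<kappa> ^ ?k * (1 / (u + \<omega>) ^ ?n) * (\<Prod>j<?k. ?F j u)" .
      show "\<kappa> ^ ?k * (u ^ (?n - 1) / Gamma (real ?n) *
         ((\<omega> + sqrt (\<omega>\<^sup>2 - 1)) / (\<omega> + u + sqrt ((\<omega> + u)\<^sup>2 - 1))) powr \<kappa> *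
         (1 / (u + \<omega>) ^ ?n) * (\<Prod>j<?k. ?F j u)) =
       u ^ (?n - 1) / Gamma (real ?n) *
         (exp (- bessel_exponent \<omega> \<kappa> u) * (\<Prod>B\<in>\<A>. bessel_moment \<omega> \<kappa> (card B) u))"
        unfolding e exp_bessel_exponent[OF \<omega> less_imp_le[OF u]] by (simp only: mult_ac)
    qed
  qed simp
  finally show ?thesis .
qed

theorem proposition5:
  fixes \<Theta> :: "(real ^ 'm) set"
    and P0 :: "(real ^ 'm) measure"
    and \<kappa> :: real
    and ns :: "nat list"
    and \<A> :: "nat set set"
  assumes "\<Theta> \<in> sets borel"
    and "sets P0 = sets (restrict_space borel \<Theta>)"
    and "prob_space P0"
    and "\<forall>x\<in>\<Theta>. measure P0 {x} = 0"
    and "\<kappa> > 0"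
    and "ns \<noteq> []"
    and "\<forall>m\<in>set ns. m > 0"
    and "partition_on {1..sum_list ns} \<A>"
    and "image_mset card (mset_set \<A>) = mset ns"
  shows "(\<forall>\<omega>\<ge>1. \<forall>(M :: 'w measure) P.
            normalized_bessel_rm M \<omega> \<kappa> P0 P \<longrightarrow>
              eppf M P (sum_list ns) \<A> = p_B ns \<omega> \<kappa>)
       \<and> ((\<lambda>\<omega>. p_B ns \<omega> \<kappa>) \<longlongrightarrow> p_D ns \<kappa>) at_top
       \<and> (\<forall>(M :: 'v measure) Q.
            dirichlet_process M (scale_measure (ennreal \<kappa>) P0) Q \<longrightarrow>
              eppf M Q (sum_list ns) \<A> = p_D ns \<kappa>)"
proof (intro conjI allI impI)
  obtain q where q: "coded_space P0 q"
    using ex_coded_space[OF assms(3,2,4)] by blast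
  interpret coded_space P0 q by (rule q)
  have n: "sum_list ns \<ge> 1"
    using assms(6,7) by (cases ns) auto
  show "eppf M P (sum_list ns) \<A> = p_B ns \<omega> \<kappa>"
    if \<omega>: "\<omega> \<ge> 1" and rm: "normalized_bessel_rm M \<omega> \<kappa> P0 P" for \<omega> and M :: "'w measure" and P
  proof -
    obtain J \<tau> where "bessel_points M \<omega> \<kappa> P0 J \<tau>" and P: "P = normalized_rm P0 J \<tau>"
      using rm by (auto simp: normalized_bessel_rm_def)
    then interpret bessel_process P0 q M \<omega> \<kappa> J \<tau>
      using \<omega> assms(5) by unfold_locales auto
    show ?thesis
      unfolding P p_B_eq_integral_moments[OF assms(9) \<omega>]
      by (rule eppf_normalized_bessel[OF n assms(8)])
  qed
  show "((\<lambda>\<omega>. p_B ns \<omega> \<kappa>) \<longlongrightarrow> p_D ns \<kappa>) at_top"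
    by (rule p_B_tendsto_p_D[OF assms(5-7)])
  show "eppf M Q (sum_list ns) \<A> = p_D ns \<kappa>"
    if "dirichlet_process M (scale_measure (ennreal \<kappa>) P0) Q" for M :: "'v measure" and Q
  proof -
    have "(\<Prod>B\<in>\<A>. \<kappa> * Gamma (real (card B))) = (\<Prod>j<length ns. \<kappa> * Gamma (real (ns ! j)))"
      by (rule prod_blocks[OF assms(9)])
    then show ?thesis
      using eppf_dirichlet_process[OF assms(5) that n assms(8)]
      by (simp add: p_D_def Let_def prod.distrib)
  qed
qed

end
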